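(* The map $\mathcal{S}h$ intertwines the extended monoid action on $B_{n-1}$-orbits on $\mathcal{B}_n$ with the monoid action on $W\times W$; that is, for every simple root $\alpha\in\Pi_{\mathfrak{k}}\sqcup\Pi_{\mathfrak{g}}$ and every $B_{n-1}$-orbit $Q$ on $\mathcal{B}_n$, $$\mathcal{S}h(m(s_\alpha)*Q)=m(s_\alpha)*\mathcal{S}h(Q).$$
   Context: Let $n\ge 2$, $G=GL(n,\mathbb{C})$, $\mathfrak{g}=\mathfrak{gl}(n)$, and let $\mathcal{B}_n$ be the variety of full flags in $\mathbb{C}^n$ with its natural $G$-action. Let $e_1,\dots,e_n$ be the standard basis; $(v_1\subset v_2\subset\dots\subset v_n)$ denotes the full flag whose $i$-th subspace is $\mathrm{span}\{v_1,\dots,v_i\}$. Embed $K=GL(n-1,\mathbb{C})$ in $G$ in the top left corner, $x\mapsto \mathrm{diag}(x,1)$, let $\mathfrak{k}=\mathfrak{gl}(n-1)$, and let $B_{n-1}$ be the upper triangular Borel subgroup of $K$, viewed as a subgroup of $G$. It acts on $\mathcal{B}_n$ with finitely many orbits. Put $\mathcal{E}_+=(e_1\subset e_2\subset\dots\subset e_n)$ and $\mathcal{E}^*=(e_n\subset e_1\subset e_2\subset\dots\subset e_{n-1})$, with stabilizers $B$ (the upper triangular matrices) and $B^*$ in $G$; identify $\mathcal{B}_n=G/B$ via $gB\leftrightarrow g\cdot\mathcal{E}_+$. The Weyl group $W=\mathcal{S}_n$ acts by $w(e_i)=e_{w(i)}$, and hence acts on the flags spanned by permutations of the standard basis. For a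 $B_{n-1}$-orbit $Q$, $\mathcal{S}h(Q):=(w,u^* )\in W\times W$, where $w,u^*$ are the unique elements with $B\cdot Q=B\cdot w(\mathcal{E}_+)$ and $B^*\cdot Q=B^*\cdot u^*(\mathcal{E}^* )$. Roots: let $\epsilon_i$ be the $i$-th coordinate functional on diagonal matrices. $\Pi_{\mathfrak{g}}=\{\epsilon_i-\epsilon_{i+1}: 1\le i\le n-1\}$ and $\Pi_{\mathfrak{k}}=\{\epsilon_i-\epsilon_{i+1}:1\le i\le n-2\}$, regarded as disjoint copies in $\Pi_{\mathfrak{k}}\sqcup\Pi_{\mathfrak{g}}$. For $\alpha=\epsilon_i-\epsilon_{i+1}$, $s_\alpha=(i,i+1)$. Extended monoid action on orbits: let $Q=B_{n-1}\cdot v\mathcal{E}_+$ with $v\in G$. For $\alpha\in\Pi_{\mathfrak{k}}$, $m(s_\alpha)*Q$ is the unique open $B_{n-1}$-orbit in $P_\alpha^K v B/B$, where $P^K_\alpha\supset B_{n-1}$ is the standard minimal parabolic subgroup of $K$ attached to $\alpha$ (left action). For $\alpha\in\Pi_{\mathfrak{g}}$, $m(s_\alpha)*Q$ is the unique open $B_{n-1}$-orbit in $B_{n-1}vP_\alpha/B$, where $P_\alpha\supset B$ is the standard minimal parabolic subgroup of $G$ attached to $\alpha$ (right action). Monoid action on $W\times W$: let $\ell$ be the length on $W$ with respect to $S=\{(1,2),\dots,(n-1,n)\}$ and $\ell^*$ the length on $W$ with respect to $S^*=\{s_1^*,\dots,s_{n-1}^*\}$, $s_1^*=(1,n)$, $s_i^*=(i-1,i)$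 for $2\le i\le n-1$. Let $\sigma=(n,n-1,\dots,2,1)$, i.e. $\sigma(i)=i-1$ for $i\ge 2$ and $\sigma(1)=n$. For $\alpha\in\Pi_{\mathfrak{g}}$ let $\alpha^*=\sigma(\alpha)$, so $s_{\alpha^*}=\sigma s_\alpha\sigma^{-1}\in S^*$. For $(w,u^* )\in W\times W$: - if $\alpha\in\Pi_{\mathfrak{k}}$ (note $s_\alpha\in S\cap S^*$), $m(s_\alpha)*(w,u^* )=(w_1,u_1)$, where $w_1=s_\alpha w$ if $\ell(s_\alpha w)>\ell(w)$ and $w_1=w$ otherwise, and $u_1=s_\alpha u^*$ if $\ell^*(s_\alpha u^* )>\ell^*(u^* )$ and $u_1=u^*$ otherwise; - if $\alpha\in\Pi_{\mathfrak{g}}$, $m(s_\alpha)*(w,u^* )=(w_1,u_1)$, where $w_1=ws_\alpha$ if $\ell(ws_\alpha)>\ell(w)$ and $w_1=w$ otherwise, and $u_1=u^*s_{\alpha^*}$ if $\ell^*(u^*s_{\alpha^*})>\ell^*(u^* )$ and $u_1=u^*$ otherwise. *)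

theory Defs
  imports
    "Jordan_Normal_Form.VS_Connect"
    "HOL-Combinatorics.Permutations"
    "HOL-Analysis.Abstract_Topology"
begin

(* Indices run over 0, ..., n - 1: the basis vector written e_i on paper (1 <= i <= n) is
   unit_vec n (i - 1), and W = S_n is the set of permutations of {..<n}. *)

section \<open>Groups of matrices\<close>

definition GL :: "nat \<Rightarrow> complex mat set" where
  "GL n = {g \<in> carrier_mat n n. invertible_mat g}"

definition embed_K :: "complex mat \<Rightarrow> complex mat" where
  "embed_K x = four_block_mat x (0\<^sub>m (dim_row x) 1) (0\<^sub>m 1 (dim_col x)) (1\<^sub>m 1)"

definition borel_K :: "nat \<Rightarrow> complex mat set" where
  "borel_K n = embed_K ` {x \<in> GL (n - 1). upper_triangular x}"

(* The minimal parabolic subgroup of GL(m) containing the upper triangular matrices and attached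
   to the i-th simple root: below the diagonal, only the entry (i + 1, i) may be nonzero. *)
definition min_parabolic :: "nat \<Rightarrow> nat \<Rightarrow> complex mat set" where
  "min_parabolic m i =
     {p \<in> GL m. \<forall>r<m. \<forall>c<r. (r, c) \<noteq> (Suc i, i) \<longrightarrow> p $$ (r, c) = 0}"

definition min_parabolic_K :: "nat \<Rightarrow> nat \<Rightarrow> complex mat set" where
  "min_parabolic_K n i = embed_K ` min_parabolic (n - 1) i"


section \<open>The flag variety\<close>

abbreviation Cspace :: "nat \<Rightarrow> (complex, complex vec) module" where
  "Cspace n \<equiv> module_vec TYPE(complex) n"

(* F ! i is the (i + 1)-dimensional member of the flag F. *)
definition flags :: "nat \<Rightarrow> complex vec set list set" where
  "flags n = {F. length F = n \<and>
     (\<forall>i<n. VectorSpace.subspace class_ring (F ! i) (Cspace n) \<and>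
            vectorspace.dim class_ring ((Cspace n)\<lparr>carrier := F ! i\<rparr>) = Suc i) \<and>
     (\<forall>i. Suc i < n \<longrightarrow> F ! i \<subseteq> F ! Suc i)}"

definition flag_of :: "nat \<Rightarrow> complex vec list \<Rightarrow> complex vec set list" where
  "flag_of n vs =
     map (\<lambda>i. LinearCombinations.module.span class_ring (Cspace n) (set (take (Suc i) vs))) [0..<n]"

definition act :: "complex mat \<Rightarrow> complex vec set list \<Rightarrow> complex vec set list" where
  "act g F = map (\<lambda>V. (\<lambda>x. g *\<^sub>v x) ` V) F"

definition act_set ::
  "complex mat set \<Rightarrow> complex vec set list set \<Rightarrow> complex vec set list set" where
  "act_set H X = {act h F | h F. h \<in> H \<and> F \<in> X}"

definition stabilizer :: "nat \<Rightarrow> complex vec set list \<Rightarrow> complex mat set" where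
  "stabilizer n F = {g \<in> GL n. act g F = F}"

definition E_plus :: "nat \<Rightarrow> complex vec set list" where
  "E_plus n = flag_of n (map (unit_vec n) [0..<n])"

definition E_star :: "nat \<Rightarrow> complex vec set list" where
  "E_star n = flag_of n (map (unit_vec n) ((n - 1) # [0..<n - 1]))"

definition borel :: "nat \<Rightarrow> complex mat set" where
  "borel n = stabilizer n (E_plus n)"

definition borel_star :: "nat \<Rightarrow> complex mat set" where
  "borel_star n = stabilizer n (E_star n)"

definition orbits :: "nat \<Rightarrow> complex vec set list set set" where
  "orbits n = {act_set (borel_K n) {F} | F. F \<in> flags n}"


section \<open>The Zariski topology\<close>

inductive_set poly_funs :: "nat \<Rightarrow> (complex mat \<Rightarrow> complex) set" for n where
  const: "(\<lambda>_. c) \<in> poly_funs n"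
| entry: "i < n \<Longrightarrow> j < n \<Longrightarrow> (\<lambda>A. A $$ (i, j)) \<in> poly_funs n"
| add: "f \<in> poly_funs n \<Longrightarrow> g \<in> poly_funs n \<Longrightarrow> (\<lambda>A. f A + g A) \<in> poly_funs n"
| mult: "f \<in> poly_funs n \<Longrightarrow> g \<in> poly_funs n \<Longrightarrow> (\<lambda>A. f A * g A) \<in> poly_funs n"

definition zariski_mat :: "nat \<Rightarrow> complex mat topology" where
  "zariski_mat n = topology (\<lambda>U. \<exists>P \<subseteq> poly_funs n.
     U = carrier_mat n n - {A \<in> carrier_mat n n. \<forall>f\<in>P. f A = 0})"

lemma openin_zariski_mat:
  "openin (zariski_mat n) U \<longleftrightarrow>
     (\<exists>P \<subseteq> poly_funs n. U = carrier_mat n n - {A \<in> carrier_mat n n. \<forall>f\<in>P. f A = 0})"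
proof -
  define D where
    "D P = carrier_mat n n - {A \<in> carrier_mat n n. \<forall>f\<in>P. f A = 0}"
    for P :: "(complex mat \<Rightarrow> complex) set"
  define opn where "opn U \<longleftrightarrow> (\<exists>P \<subseteq> poly_funs n. U = D P)" for U
  have D_iff: "A \<in> D P \<longleftrightarrow> A \<in> carrier_mat n n \<and> (\<exists>f\<in>P. f A \<noteq> 0)" for A P
    unfolding D_def by blast
  have "opn (U \<inter> V)" if U: "opn U" and V: "opn V" for U V
  proof -
    obtain P where P: "P \<subseteq> poly_funs n" "U = D P" using U unfolding opn_def by blast
    obtain R where R: "R \<subseteq> poly_funs n" "V = D R" using V unfolding opn_def by blast
    define PR where "PR = (\<Union>f\<in>P. (\<lambda>g A. f A * g A) ` R)"
    have "(\<lambda>A. f A * g A) \<in> poly_funs n" if "f \<in> P" "g \<in> R" for f g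
      using that P(1) R(1) by (intro poly_funs.mult) blast+
    then have "PR \<subseteq> poly_funs n" unfolding PR_def by blast
    moreover have "A \<in> U \<inter> V \<longleftrightarrow> A \<in> D PR" for A
    proof -
      have "(\<exists>h\<in>PR. h A \<noteq> 0) \<longleftrightarrow> (\<exists>f\<in>P. \<exists>g\<in>R. f A * g A \<noteq> 0)"
        unfolding PR_def by (simp only: UN_iff bex_UN image_iff bex_simps)
      also have "\<dots> \<longleftrightarrow> (\<exists>f\<in>P. f A \<noteq> 0) \<and> (\<exists>g\<in>R. g A \<noteq> 0)"
        unfolding mult_eq_0_iff by blast
      finally show ?thesis unfolding P(2) R(2) Int_iff D_iff by blast
    qed
    then have "U \<inter> V = D PR" by (rule Set.set_eqI)
    ultimately show ?thesis unfolding opn_def by blast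
  qed
  moreover have "opn (\<Union>K)" if K: "\<forall>U\<in>K. opn U" for K
  proof -
    obtain P where P: "\<And>U. U \<in> K \<Longrightarrow> P U \<subseteq> poly_funs n" "\<And>U. U \<in> K \<Longrightarrow> U = D (P U)"
      using K unfolding opn_def by metis
    have "(\<Union>U\<in>K. P U) \<subseteq> poly_funs n" using P(1) by (rule UN_least)
    moreover have "A \<in> \<Union>K \<longleftrightarrow> A \<in> D (\<Union>U\<in>K. P U)" for A
    proof -
      have "A \<in> \<Union>K \<longleftrightarrow> (\<exists>U\<in>K. A \<in> D (P U))" using P(2) by (metis UnionE UnionI)
      then show ?thesis unfolding D_iff by blast
    qed
    then have "\<Union>K = D (\<Union>U\<in>K. P U)" by (rule Set.set_eqI)
    ultimately show ?thesis unfolding opn_def by blast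
  qed
  ultimately have "istopology opn" unfolding istopology_def by blast
  then have "openin (topology opn) = opn" by (rule topology_inverse')
  moreover have "zariski_mat n = topology opn"
    unfolding zariski_mat_def opn_def D_def ..
  ultimately have "openin (zariski_mat n) U \<longleftrightarrow> opn U" by metis
  then show ?thesis unfolding opn_def D_def .
qed

(* The quotient topology on G/B, where g B corresponds to the flag g . E_plus. *)
definition flag_topology :: "nat \<Rightarrow> complex vec set list topology" where
  "flag_topology n = topology (\<lambda>U. U \<subseteq> flags n \<and>
     openin (subtopology (zariski_mat n) (GL n)) {g \<in> GL n. act g (E_plus n) \<in> U})"

lemma openin_flag_topology:
  "openin (flag_topology n) U \<longleftrightarrow> U \<subseteq> flags n \<and>
     openin (subtopology (zariski_mat n) (GL n)) {g \<in> GL n. act g (E_plus n) \<in> U}"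
proof -
  define pre where "pre U = {g \<in> GL n. act g (E_plus n) \<in> U}" for U
  define opn where "opn U \<longleftrightarrow> U \<subseteq> flags n \<and>
    openin (subtopology (zariski_mat n) (GL n)) (pre U)" for U
  have "opn (U \<inter> V)" if "opn U" "opn V" for U V
  proof -
    have "pre (U \<inter> V) = pre U \<inter> pre V" unfolding pre_def by blast
    moreover have "U \<inter> V \<subseteq> flags n" using that(1) unfolding opn_def by blast
    ultimately show ?thesis
      using that unfolding opn_def by (metis openin_Int)
  qed
  moreover have "opn (\<Union>K)" if K: "\<forall>U\<in>K. opn U" for K
  proof -
    have "pre (\<Union>K) = (\<Union>U\<in>K. pre U)" unfolding pre_def by blast
    moreover have "openin (subtopology (zariski_mat n) (GL n)) (\<Union>U\<in>K. pre U)"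
      using K unfolding opn_def by (intro openin_Union) blast
    moreover have "\<Union>K \<subseteq> flags n" using K unfolding opn_def by blast
    ultimately show ?thesis unfolding opn_def by metis
  qed
  ultimately have "istopology opn" unfolding istopology_def by blast
  then have "openin (topology opn) = opn" by (rule topology_inverse')
  moreover have "flag_topology n = topology opn"
    unfolding flag_topology_def opn_def pre_def ..
  ultimately have "openin (flag_topology n) U \<longleftrightarrow> opn U" by metis
  then show ?thesis unfolding opn_def pre_def .
qed


section \<open>The Weyl group\<close>

definition perm_mat :: "nat \<Rightarrow> (nat \<Rightarrow> nat) \<Rightarrow> complex mat" where
  "perm_mat n w = mat n n (\<lambda>(i, j). if i = w j then 1 else 0)"

definition simple_refl :: "nat \<Rightarrow> nat \<Rightarrow> nat" where
  "simple_refl i = Transposition.transpose i (Suc i)"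

definition gens :: "nat \<Rightarrow> (nat \<Rightarrow> nat) set" where
  "gens n = {simple_refl i | i. i < n - 1}"

definition gens_star :: "nat \<Rightarrow> (nat \<Rightarrow> nat) set" where
  "gens_star n = insert (Transposition.transpose 0 (n - 1)) {simple_refl i | i. i < n - 2}"

definition word_length :: "(nat \<Rightarrow> nat) set \<Rightarrow> (nat \<Rightarrow> nat) \<Rightarrow> nat" where
  "word_length S w = (LEAST k. \<exists>ss. length ss = k \<and> set ss \<subseteq> S \<and> foldr (\<circ>) ss id = w)"

definition sigma :: "nat \<Rightarrow> nat \<Rightarrow> nat" where
  "sigma n i = (if i = 0 then n - 1 else if i < n then i - 1 else i)"

definition refl_star :: "nat \<Rightarrow> nat \<Rightarrow> nat \<Rightarrow> nat" where
  "refl_star n i = sigma n \<circ> simple_refl i \<circ> inv_into UNIV (sigma n)"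

definition Sh :: "nat \<Rightarrow> complex vec set list set \<Rightarrow> (nat \<Rightarrow> nat) \<times> (nat \<Rightarrow> nat)" where
  "Sh n Q =
    (THE w. w permutes {..<n} \<and>
       act_set (borel n) Q = act_set (borel n) {act (perm_mat n w) (E_plus n)},
     THE u. u permutes {..<n} \<and>
       act_set (borel_star n) Q = act_set (borel_star n) {act (perm_mat n u) (E_star n)})"


section \<open>Monoid actions\<close>

(* Inl i and Inr i stand for the i-th simple root (the difference of the i-th and (i + 1)-st
   coordinate functionals, i = 0, 1, ...) of k and of g respectively. *)
definition simple_roots :: "nat \<Rightarrow> (nat + nat) set" where
  "simple_roots n = {..<n - 2} <+> {..<n - 1}"

definition m_left :: "nat \<Rightarrow> nat \<Rightarrow> complex vec set list set \<Rightarrow> complex vec set list set" where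
  "m_left n i Q = (THE Q'. Q' \<in> orbits n \<and>
     (\<exists>v \<in> GL n. Q = act_set (borel_K n) {act v (E_plus n)} \<and>
        openin (subtopology (flag_topology n)
          {act (p * v) (E_plus n) | p. p \<in> min_parabolic_K n i}) Q'))"

definition m_right :: "nat \<Rightarrow> nat \<Rightarrow> complex vec set list set \<Rightarrow> complex vec set list set" where
  "m_right n i Q = (THE Q'. Q' \<in> orbits n \<and>
     (\<exists>v \<in> GL n. Q = act_set (borel_K n) {act v (E_plus n)} \<and>
        openin (subtopology (flag_topology n)
          {act (b * v * p) (E_plus n) | b p. b \<in> borel_K n \<and> p \<in> min_parabolic n i}) Q'))"

fun m_orbit :: "nat \<Rightarrow> nat + nat \<Rightarrow> complex vec set list set \<Rightarrow> complex vec set list set" where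
  "m_orbit n (Inl i) Q = m_left n i Q"
| "m_orbit n (Inr i) Q = m_right n i Q"

definition longer :: "(nat \<Rightarrow> nat) set \<Rightarrow> (nat \<Rightarrow> nat) \<Rightarrow> (nat \<Rightarrow> nat) \<Rightarrow> nat \<Rightarrow> nat" where
  "longer S w' w = (if word_length S w' > word_length S w then w' else w)"

fun m_weyl :: "nat \<Rightarrow> nat + nat \<Rightarrow> (nat \<Rightarrow> nat) \<times> (nat \<Rightarrow> nat) \<Rightarrow> (nat \<Rightarrow> nat) \<times> (nat \<Rightarrow> nat)" where
  "m_weyl n (Inl i) (w, u) =
     (longer (gens n) (simple_refl i \<circ> w) w,
      longer (gens_star n) (simple_refl i \<circ> u) u)"
| "m_weyl n (Inr i) (w, u) =
     (longer (gens n) (w \<circ> simple_refl i) w,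
      longer (gens_star n) (u \<circ> refl_star n i) u)"

end

theory Submission
  imports Defs
begin

text \<open>A flag is written as \<^term>\<open>act g (E_plus n)\<close>, so everything can be said about matrices up to upper
  triangular matrices on the right (\<open>act_E_plus_eq_iff\<close>, \<open>flags_adapted_basis\<close>). Conjugation by the cycle
  \<^term>\<open>sigma n\<close> turns the stabilizer of the second base flag into the upper triangular matrices as
  well. The pair attached to the orbit of \<open>g\<close> therefore consists of the Bruhat cell of \<open>g\<close> and the
  Bruhat cell of a row permutation of \<open>g\<close> (\<open>Sh_orbit\<close>).

  The monoid action concerns a fibre: the orbit of \<open>v\<close> multiplied by a minimal parabolic subgroup,
  on the left inside the smaller group or on the right. Three facts determine its open orbit.

  \<^item> The fibre meets only the cells of \<open>w\<close> and of its product with the simple reflection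
    (\<open>min_parabolic_mult_cell\<close>, \<open>cell_mult_min_parabolic\<close>), and it meets the longer of the two
    (\<open>refl_mult_cell_nonempty\<close>, \<open>cell_mult_refl_nonempty\<close>). A minor that vanishes on the shorter cell and
    not on the longer one (\<open>cell_separating_minor\<close>) shows that the longer cell is open in the fibre.
    The same holds for the second pair of cells.

  \<^item> The fibre is irreducible (\<open>products_irreducible\<close>): it is the image of pairs of invertible matrices
    in affine spaces. Hence the two open parts meet.

  \<^item> The two cells together determine the orbit (\<open>same_cells_same_orbit\<close>). So the intersection of the
    two open parts is one orbit, it is open, and by irreducibility every open orbit meets it and is
    equal to it (\<open>open_orbit\<close>).

  Thus the pair of the open orbit consists of the longer elements on both sides, and this is the
  definition of the action on pairs once word length has been identified with the number of
  inversions (\<open>word_length_gens\<close>).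

  The third fact is the heart of the matter. Modulo the small Borel subgroup on the left and
  triangular matrices on the right, a matrix in the cell of \<open>w\<close> is the permutation matrix of \<open>w\<close> with
  a vector \<open>x\<close> added to one column. Row and column operations reduce \<open>x\<close> to the indicator of those
  entries that are maximal for two orders at once, the order of the rows and the order of the pivot
  positions (\<open>normal_mat_reduce\<close>). The second cell recovers these
  maximal entries from ranks of corner submatrices (\<open>star_cell_dominated\<close>).\<close>

section \<open>Invertible and triangular matrices\<close>

lemma GL_iff_det: "g \<in> GL n \<longleftrightarrow> g \<in> carrier_mat n n \<and> det g \<noteq> 0"
proof
  assume g: "g \<in> GL n"
  then have c: "g \<in> carrier_mat n n" and "invertible_mat g" by (auto simp: GL_def)
  then obtain h where "inverts_mat g h" "inverts_mat h g" by (auto simp: invertible_mat_def)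
  then have gh: "g * h = 1\<^sub>m n" and hg: "h * g = 1\<^sub>m (dim_row h)"
    using c by (auto simp: inverts_mat_def)
  have "dim_col h = n" using arg_cong[OF gh, of dim_col] by simp
  moreover have "dim_row h = n" using arg_cong[OF hg, of dim_col] c by simp
  ultimately have h: "h \<in> carrier_mat n n" by auto
  have "det g * det h = 1" using det_mult[OF c h] gh by simp
  then show "g \<in> carrier_mat n n \<and> det g \<noteq> 0" using c by auto
next
  assume a: "g \<in> carrier_mat n n \<and> det g \<noteq> 0"
  then obtain h where "h \<in> carrier_mat n n" "g * h = 1\<^sub>m n" "h * g = 1\<^sub>m n"
    using det_non_zero_imp_unit[of g n "()"] by (auto simp: Units_def ring_mat_def)
  then show "g \<in> GL n" using a
    unfolding GL_def invertible_mat_def inverts_mat_def by auto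
qed

lemma GL_carrier: "g \<in> GL n \<Longrightarrow> g \<in> carrier_mat n n"
  by (simp add: GL_def)

lemma one_GL: "1\<^sub>m n \<in> GL n"
  by (simp add: GL_iff_det)

lemma mult_GL: "g \<in> GL n \<Longrightarrow> h \<in> GL n \<Longrightarrow> g * h \<in> GL n"
  by (auto simp: GL_iff_det det_mult)

lemma GL_inverse:
  assumes "g \<in> GL n"
  obtains h where "h \<in> GL n" "g * h = 1\<^sub>m n" "h * g = 1\<^sub>m n"
proof -
  have g: "g \<in> carrier_mat n n" "det g \<noteq> 0" using assms by (auto simp: GL_iff_det)
  then obtain h where h: "h \<in> carrier_mat n n" "g * h = 1\<^sub>m n" "h * g = 1\<^sub>m n"
    using det_non_zero_imp_unit[of g n "()"] by (auto simp: Units_def ring_mat_def)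
  then have "det h \<noteq> 0" using det_mult[OF g(1) h(1)] by auto
  then show thesis using h that by (auto simp: GL_iff_det)
qed

lemmas mat_assoc = assoc_mult_mat[of _ n n _ n _ n for n] mult_carrier_mat[of _ n n _ n for n]

lemma mult_mat_index:
  assumes "A \<in> carrier_mat n n" "B \<in> carrier_mat n n" "i < n" "j < n"
  shows "(A * B) $$ (i, j) = (\<Sum>k<n. A $$ (i, k) * B $$ (k, j))"
  using assms by (auto simp: scalar_prod_def atLeast0LessThan)

lemma upper_triangular_diag_nonzero:
  assumes "g \<in> GL n" "upper_triangular g" "i < n"
  shows "g $$ (i, i) \<noteq> 0"
proof
  assume "g $$ (i, i) = 0"
  have gc: "g \<in> carrier_mat n n" using assms(1) by (rule GL_carrier)
  have "0 \<in> set (diag_mat g)"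
    using \<open>g $$ (i, i) = 0\<close> assms(3) gc by (auto simp: diag_mat_def image_iff intro!: bexI[of _ i])
  then have "det g = 0" using upper_triangular_imp_det_eq_0_iff[OF gc assms(2)] by simp
  then show False using assms(1) by (simp add: GL_iff_det)
qed

text \<open>The lowest nonzero entry of a column of the inverse lies on or above the diagonal, because the
  diagonal entries of an invertible triangular matrix are nonzero.\<close>

lemma upper_triangular_inverse:
  assumes g: "g \<in> GL n" "upper_triangular g" and h: "h \<in> carrier_mat n n" "g * h = 1\<^sub>m n"
  shows "upper_triangular h"
proof (rule upper_triangularI, rule ccontr)
  fix i c assume ic: "c < i" "i < dim_row h" "h $$ (i, c) \<noteq> 0"
  have gc: "g \<in> carrier_mat n n" using g(1) by (rule GL_carrier)
  define r where "r = Max {r. r < n \<and> h $$ (r, c) \<noteq> 0}"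
  have fin: "finite {r. r < n \<and> h $$ (r, c) \<noteq> 0}" by simp
  have ne: "i \<in> {r. r < n \<and> h $$ (r, c) \<noteq> 0}" using ic h by auto
  have r: "r < n" "h $$ (r, c) \<noteq> 0" "i \<le> r"
    using Max_in[OF fin] Max_ge[OF fin ne] ne unfolding r_def by blast+
  have above: "h $$ (k, c) = 0" if "r < k" "k < n" for k
    using Max_ge[OF fin, of k] that unfolding r_def by fastforce
  have "(g * h) $$ (r, c) = (\<Sum>k<n. g $$ (r, k) * h $$ (k, c))"
    using r ic by (intro mult_mat_index gc h) auto
  also have "\<dots> = (\<Sum>k<n. if k = r then g $$ (r, r) * h $$ (r, c) else 0)"
  proof (rule sum.cong[OF refl])
    fix k assume "k \<in> {..<n}"
    then show "g $$ (r, k) * h $$ (k, c) = (if k = r then g $$ (r, r) * h $$ (r, c) else 0)"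
      using above[of k] upper_triangularD[OF g(2), of k r] r gc
      by (cases k r rule: linorder_cases) auto
  qed
  also have "\<dots> = g $$ (r, r) * h $$ (r, c)" using r by simp
  finally have "g $$ (r, r) = 0" using r ic h(2) by auto
  then show False using upper_triangular_diag_nonzero[OF g r(1)] by simp
qed

lemma upper_triangular_mult:
  assumes "A \<in> carrier_mat n n" "B \<in> carrier_mat n n" "upper_triangular A" "upper_triangular B"
  shows "upper_triangular (A * B)"
proof (rule upper_triangularI)
  fix i j assume ij: "j < i" "i < dim_row (A * B)"
  then have "(A * B) $$ (i, j) = (\<Sum>k<n. A $$ (i, k) * B $$ (k, j))"
    using assms by (intro mult_mat_index) auto
  also have "\<dots> = 0"
  proof (rule sum.neutral, rule ballI)
    fix k assume "k \<in> {..<n}"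
    then show "A $$ (i, k) * B $$ (k, j) = 0"
      using upper_triangularD[OF assms(3), of k i] upper_triangularD[OF assms(4), of j k] ij assms(1,2)
      by (cases "k < i") auto
  qed
  finally show "(A * B) $$ (i, j) = 0" .
qed

lemma upper_triangular_GL:
  assumes "g \<in> carrier_mat n n" "upper_triangular g" "\<And>i. i < n \<Longrightarrow> g $$ (i, i) \<noteq> 0"
  shows "g \<in> GL n"
proof -
  have "0 \<notin> set (diag_mat g)" using assms by (auto simp: diag_mat_def)
  then have "det g \<noteq> 0" using upper_triangular_imp_det_eq_0_iff[OF assms(1,2)] by simp
  then show ?thesis using assms(1) by (simp add: GL_iff_det)
qed

definition UT :: "nat \<Rightarrow> complex mat set" where
  "UT n = {g \<in> GL n. upper_triangular g}"

lemma UT_GL: "b \<in> UT n \<Longrightarrow> b \<in> GL n"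
  and UT_carrier: "b \<in> UT n \<Longrightarrow> b \<in> carrier_mat n n"
  by (auto simp: UT_def GL_carrier)

lemma UT_zero: "b \<in> UT n \<Longrightarrow> j < i \<Longrightarrow> i < n \<Longrightarrow> b $$ (i, j) = 0"
  using upper_triangularD[of b j i] by (auto simp: UT_def dest!: GL_carrier)

lemma UT_diag: "b \<in> UT n \<Longrightarrow> i < n \<Longrightarrow> b $$ (i, i) \<noteq> 0"
  using upper_triangular_diag_nonzero by (auto simp: UT_def)

lemma UT_I:
  assumes "g \<in> carrier_mat n n" "\<And>i j. j < i \<Longrightarrow> i < n \<Longrightarrow> g $$ (i, j) = 0"
    "\<And>i. i < n \<Longrightarrow> g $$ (i, i) \<noteq> 0"
  shows "g \<in> UT n"
  using assms unfolding UT_def by (auto intro!: upper_triangular_GL upper_triangularI)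

lemma one_UT: "1\<^sub>m n \<in> UT n"
  by (rule UT_I) auto

lemma mult_UT: "a \<in> UT n \<Longrightarrow> b \<in> UT n \<Longrightarrow> a * b \<in> UT n"
  unfolding UT_def by (auto intro: mult_GL upper_triangular_mult GL_carrier)

lemma smult_UT: "b \<in> UT n \<Longrightarrow> d \<noteq> 0 \<Longrightarrow> d \<cdot>\<^sub>m b \<in> UT n"
  by (rule UT_I) (use UT_carrier[of b n] in \<open>auto simp: UT_zero UT_diag\<close>)

lemma UT_inverse:
  assumes "b \<in> UT n"
  obtains c where "c \<in> UT n" "b * c = 1\<^sub>m n" "c * b = 1\<^sub>m n"
proof -
  obtain c where c: "c \<in> GL n" "b * c = 1\<^sub>m n" "c * b = 1\<^sub>m n"
    using GL_inverse UT_GL[OF assms] by blast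
  then have "upper_triangular c"
    using upper_triangular_inverse assms GL_carrier[of c] unfolding UT_def by blast
  then show thesis using c that by (auto simp: UT_def)
qed


section \<open>Flags and cosets\<close>

definition coord_space :: "nat \<Rightarrow> nat set \<Rightarrow> complex vec set" where
  "coord_space n J = {v \<in> carrier_vec n. \<forall>k<n. k \<notin> J \<longrightarrow> v $ k = 0}"

lemma span_unit_vecs:
  assumes J: "J \<subseteq> {..<n}"
  shows "LinearCombinations.module.span class_ring (Cspace n) (unit_vec n ` J) = coord_space n J"
proof -
  interpret vec_space "TYPE(complex)" n .
  have sub: "unit_vec n ` J \<subseteq> carrier_vec n" by auto
  have fin: "finite (unit_vec n ` J)" using J finite_subset by blast
  have inj: "inj_on (unit_vec n :: nat \<Rightarrow> complex vec) J"
  proof (rule inj_onI)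
    fix a b assume "a \<in> J" "b \<in> J" and e: "(unit_vec n a :: complex vec) = unit_vec n b"
    then have "a < n" "b < n" using J by auto
    then show "a = b" using arg_cong[OF e, of "\<lambda>v. v $ a"] by (auto split: if_splits)
  qed
  have idx: "lincomb c (unit_vec n ` J) $ k = (if k \<in> J then c (unit_vec n k) else 0)"
    if "k < n" for k c
  proof -
    have "lincomb c (unit_vec n ` J) $ k = (\<Sum>x\<in>unit_vec n ` J. c x * x $ k)"
      using lincomb_index[OF that sub] .
    also have "\<dots> = (\<Sum>j\<in>J. c (unit_vec n j) * unit_vec n j $ k)"
      using sum.reindex[OF inj, of "\<lambda>x. c x * x $ k"] by simp
    also have "\<dots> = (\<Sum>j\<in>J. if j = k then c (unit_vec n k) else 0)"
      by (rule sum.cong) (use J that in \<open>auto simp: unit_vec_def\<close>)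
    also have "\<dots> = (if k \<in> J then c (unit_vec n k) else 0)"
      using J finite_subset by (subst sum.delta) auto
    finally show ?thesis .
  qed
  have car: "lincomb c (unit_vec n ` J) \<in> carrier_vec n" for c
    using lincomb_dim[OF fin sub] by (metis carrier_vecI)
  show ?thesis
  proof (intro equalityI subsetI)
    fix v assume "v \<in> span (unit_vec n ` J)"
    then obtain c where v: "v = lincomb c (unit_vec n ` J)"
      using finite_span[OF fin sub] by auto
    show "v \<in> coord_space n J" unfolding coord_space_def v using idx car by auto
  next
    fix v assume v: "v \<in> coord_space n J"
    define c where "c x = (\<Sum>j\<in>J. v $ j * x $ j)" for x :: "complex vec"
    have cj: "c (unit_vec n j) = v $ j" if "j \<in> J" for j
    proof -
      have "c (unit_vec n j) = (\<Sum>k\<in>J. if k = j then v $ j else 0)"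
        unfolding c_def by (rule sum.cong) (use J that in \<open>auto simp: unit_vec_def\<close>)
      then show ?thesis using that J finite_subset by (subst (asm) sum.delta) auto
    qed
    have "v = lincomb c (unit_vec n ` J)"
    proof (rule eq_vecI)
      show "dim_vec v = dim_vec (lincomb c (unit_vec n ` J))"
        using car[of c] v by (auto simp: coord_space_def)
      fix k assume "k < dim_vec (lincomb c (unit_vec n ` J))"
      then have "k < n" using car[of c] by auto
      then show "v $ k = lincomb c (unit_vec n ` J) $ k"
        using idx[of k c] cj[of k] v by (auto simp: coord_space_def)
    qed
    then show "v \<in> span (unit_vec n ` J)" using finite_span[OF fin sub] by auto
  qed
qed

lemma flag_of_unit_vecs:
  assumes "set js \<subseteq> {..<n}"
  shows "flag_of n (map (unit_vec n) js) = map (\<lambda>i. coord_space n (set (take (Suc i) js))) [0..<n]"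
proof -
  have "LinearCombinations.module.span class_ring (Cspace n) (set (take (Suc i) (map (unit_vec n) js)))
      = coord_space n (set (take (Suc i) js))" for i
    unfolding take_map set_map
    by (rule span_unit_vecs) (use assms set_take_subset[of "Suc i" js] in blast)
  then show ?thesis unfolding flag_of_def by simp
qed

lemma E_plus_eq: "E_plus n = map (\<lambda>i. coord_space n {..i}) [0..<n]"
proof -
  have "set (take (Suc i) [0..<n]) = {..i}" if "i < n" for i
    using that by (auto simp: take_upt)
  then show ?thesis unfolding E_plus_def by (subst flag_of_unit_vecs) auto
qed

lemma act_one: "act (1\<^sub>m n) F = F" if "\<And>V. V \<in> set F \<Longrightarrow> V \<subseteq> carrier_vec n"
proof -
  have "(\<lambda>x. 1\<^sub>m n *\<^sub>v x) ` V = V" if "V \<in> set F" for V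
  proof -
    have "V \<subseteq> carrier_vec n" using that \<open>\<And>V. V \<in> set F \<Longrightarrow> V \<subseteq> carrier_vec n\<close> by blast
    then have "(\<lambda>x. 1\<^sub>m n *\<^sub>v x) ` V = (\<lambda>x. x) ` V" by (intro image_cong) auto
    then show ?thesis by simp
  qed
  then show ?thesis unfolding act_def by (intro map_idI) simp
qed

lemma act_act:
  assumes "g \<in> carrier_mat n n" "h \<in> carrier_mat n n" "\<And>V. V \<in> set F \<Longrightarrow> V \<subseteq> carrier_vec n"
  shows "act g (act h F) = act (g * h) F"
proof -
  have "(*\<^sub>v) g ` (*\<^sub>v) h ` V = (*\<^sub>v) (g * h) ` V" if "V \<in> set F" for V
  proof -
    have "V \<subseteq> carrier_vec n" using assms(3) that .
    then show ?thesis unfolding image_image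
      by (intro image_cong refl) (use assms(1,2) in \<open>auto simp: assoc_mult_mat_vec\<close>)
  qed
  then show ?thesis unfolding act_def by simp
qed

lemma E_plus_carrier: "V \<in> set (E_plus n) \<Longrightarrow> V \<subseteq> carrier_vec n"
  by (auto simp: E_plus_eq coord_space_def)

lemma act_mult_E_plus:
  "g \<in> carrier_mat n n \<Longrightarrow> h \<in> carrier_mat n n \<Longrightarrow>
    act g (act h (E_plus n)) = act (g * h) (E_plus n)"
  by (rule act_act) (auto dest: E_plus_carrier)

lemma UT_maps_coord_space:
  assumes "b \<in> UT n" "i < n"
  shows "(*\<^sub>v) b ` coord_space n {..i} = coord_space n {..i}"
proof -
  have sub: "c *\<^sub>v v \<in> coord_space n {..i}" if c: "c \<in> UT n" and v: "v \<in> coord_space n {..i}" for c v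
  proof -
    have cc: "c \<in> carrier_mat n n" and vc: "v \<in> carrier_vec n"
      using c v by (auto simp: UT_carrier coord_space_def)
    have "(c *\<^sub>v v) $ k = 0" if k: "k < n" "i < k" for k
    proof -
      have "(c *\<^sub>v v) $ k = (\<Sum>l<n. c $$ (k, l) * v $ l)"
        using cc vc k by (auto simp: scalar_prod_def atLeast0LessThan)
      also have "\<dots> = 0"
      proof (rule sum.neutral, rule ballI)
        fix l assume "l \<in> {..<n}"
        then show "c $$ (k, l) * v $ l = 0"
          using UT_zero[OF c, of l k] v k by (cases "l \<le> i") (auto simp: coord_space_def)
      qed
      finally show ?thesis .
    qed
    then show ?thesis using cc vc by (auto simp: coord_space_def)
  qed
  obtain c where c: "c \<in> UT n" "b * c = 1\<^sub>m n" using UT_inverse[OF assms(1)] by blast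
  show ?thesis
  proof (intro equalityI subsetI)
    fix v assume "v \<in> (*\<^sub>v) b ` coord_space n {..i}"
    then show "v \<in> coord_space n {..i}" using sub[OF assms(1)] by blast
  next
    fix v assume v: "v \<in> coord_space n {..i}"
    then have "v = b *\<^sub>v (c *\<^sub>v v)"
      using c assms UT_carrier[of b n] UT_carrier[of c n]
      by (auto simp: coord_space_def assoc_mult_mat_vec[symmetric, of b n n c n])
    then show "v \<in> (*\<^sub>v) b ` coord_space n {..i}" using sub[OF c(1) v] by blast
  qed
qed

lemma act_E_plus_eq_self_iff:
  assumes g: "g \<in> GL n"
  shows "act g (E_plus n) = E_plus n \<longleftrightarrow> g \<in> UT n"
proof
  assume "g \<in> UT n"
  then show "act g (E_plus n) = E_plus n"
    by (auto simp: E_plus_eq act_def UT_maps_coord_space)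
next
  assume e: "act g (E_plus n) = E_plus n"
  have gc: "g \<in> carrier_mat n n" using g by (rule GL_carrier)
  have "g $$ (i, j) = 0" if "j < i" "i < n" for i j
  proof -
    have "(*\<^sub>v) g ` coord_space n {..j} = coord_space n {..j}"
      using arg_cong[OF e, of "\<lambda>F. F ! j"] that by (simp add: E_plus_eq act_def)
    moreover have "unit_vec n j \<in> coord_space n {..j}"
      by (auto simp: coord_space_def unit_vec_def)
    ultimately have "g *\<^sub>v unit_vec n j \<in> coord_space n {..j}" by blast
    moreover have "(g *\<^sub>v unit_vec n j) $ i = g $$ (i, j)"
      using gc that by simp
    ultimately show ?thesis using that gc by (auto simp: coord_space_def)
  qed
  then show "g \<in> UT n" using g gc unfolding UT_def by (auto intro!: upper_triangularI)
qed

lemma borel_eq: "borel n = UT n"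
  unfolding borel_def stabilizer_def using act_E_plus_eq_self_iff by (auto simp: UT_GL)

lemma act_E_plus_eq_iff:
  assumes g: "g \<in> GL n" and h: "h \<in> GL n"
  shows "act g (E_plus n) = act h (E_plus n) \<longleftrightarrow> (\<exists>b\<in>UT n. h = g * b)"
proof -
  note C = GL_carrier[OF g] GL_carrier[OF h]
  obtain k where k: "k \<in> GL n" "g * k = 1\<^sub>m n" "k * g = 1\<^sub>m n" using GL_inverse[OF g] by blast
  note kc = GL_carrier[OF k(1)]
  show ?thesis
  proof
    assume e: "act g (E_plus n) = act h (E_plus n)"
    have "act (k * h) (E_plus n) = act k (act g (E_plus n))"
      using act_mult_E_plus[OF kc C(2)] e by simp
    also have "\<dots> = E_plus n"
      using act_mult_E_plus[OF kc C(1)] k(3) by (simp add: act_one E_plus_carrier)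
    finally have "k * h \<in> UT n" using act_E_plus_eq_self_iff mult_GL[OF k(1) h] by blast
    moreover have "h = g * (k * h)"
      using assoc_mult_mat[OF C(1) kc C(2)] k(2) C(2) by simp
    ultimately show "\<exists>b\<in>UT n. h = g * b" by blast
  next
    assume "\<exists>b\<in>UT n. h = g * b"
    then obtain b where b: "b \<in> UT n" "h = g * b" by blast
    then show "act g (E_plus n) = act h (E_plus n)"
      using act_mult_E_plus[OF C(1) UT_carrier[OF b(1)]] act_E_plus_eq_self_iff[OF UT_GL[OF b(1)]]
      by simp
  qed
qed

lemma subspace_Cspace_iff:
  "VectorSpace.subspace class_ring W (Cspace n) \<longleftrightarrow>
    W \<subseteq> carrier_vec n \<and> 0\<^sub>v n \<in> W \<and> (\<forall>v\<in>W. \<forall>w\<in>W. v + w \<in> W) \<and> (\<forall>c. \<forall>v\<in>W. c \<cdot>\<^sub>v v \<in> W)"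
proof -
  interpret vec_space "TYPE(complex)" n .
  have "vectorspace class_ring V" by (rule vec_vs)
  moreover have "Module.module class_ring V" by (rule vec_module)
  ultimately show ?thesis
    unfolding VectorSpace.subspace_def submodule_def by (auto simp: module_vec_simps)
qed

text \<open>Splitting off the last coordinate of a vector gives an induction on the size of its support,
  which avoids linear combinations of columns.\<close>

lemma mult_coord_space_subset:
  assumes g: "g \<in> carrier_mat n n"
    and W: "VectorSpace.subspace class_ring W (Cspace n)"
    and cols: "\<And>j. j < m \<Longrightarrow> col g j \<in> W" and m: "m \<le> n"
  shows "(*\<^sub>v) g ` coord_space n {..<m} \<subseteq> W"
  using cols m
proof (induction m)
  case 0
  have "v = 0\<^sub>v n" if "v \<in> coord_space n {..<0}" for v
    using that by (intro eq_vecI) (auto simp: coord_space_def)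
  moreover have "g *\<^sub>v 0\<^sub>v n = 0\<^sub>v n" using g by (intro eq_vecI) auto
  ultimately show ?case using W by (auto simp: subspace_Cspace_iff)
next
  case (Suc m)
  show ?case
  proof (rule image_subsetI)
    fix v assume v: "v \<in> coord_space n {..<Suc m}"
    define v' where "v' = vec n (\<lambda>k. if k = m then 0 else v $ k)"
    have vc: "v \<in> carrier_vec n" "v' \<in> carrier_vec n" using v by (auto simp: coord_space_def v'_def)
    have "v' \<in> coord_space n {..<m}"
      using v by (auto simp: coord_space_def v'_def)
    then have 1: "g *\<^sub>v v' \<in> W" using Suc.IH Suc.prems by auto
    have "v = v' + (v $ m) \<cdot>\<^sub>v unit_vec n m"
      using vc Suc.prems(2) by (intro eq_vecI) (auto simp: v'_def)
    then have "g *\<^sub>v v = g *\<^sub>v v' + g *\<^sub>v ((v $ m) \<cdot>\<^sub>v unit_vec n m)"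
      using g vc by (metis mult_add_distrib_mat_vec smult_carrier_vec unit_vec_carrier)
    also have "g *\<^sub>v ((v $ m) \<cdot>\<^sub>v unit_vec n m) = (v $ m) \<cdot>\<^sub>v col g m"
      using g Suc.prems(2) by (intro eq_vecI) auto
    finally show "g *\<^sub>v v \<in> W"
      using 1 Suc.prems(1)[of m] W by (auto simp: subspace_Cspace_iff)
  qed
qed

text \<open>Independent subsets of a subspace are independent in the whole space, so their size is bounded
  and a maximal one is a basis.\<close>

lemma subspace_fin_dim:
  assumes W: "VectorSpace.subspace class_ring W (Cspace n)"
  shows "vectorspace.fin_dim class_ring ((Cspace n)\<lparr>carrier := W\<rparr>)"
proof -
  interpret vec_space "TYPE(complex)" n .
  have Wc: "W \<subseteq> carrier_vec n" using W by (simp add: subspace_Cspace_iff)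
  interpret w: vectorspace class_ring "vs W" using W by (rule subspace_is_vs)
  have bound: "finite A \<and> card A \<le> n" if A: "A \<subseteq> W \<and> w.lin_indpt A" for A
  proof -
    have "lin_indpt A" using span_li_not_depend(2)[of A W] A W by auto
    then show ?thesis using li_le_dim[of A] A Wc fin_dim dim_is_n by auto
  qed
  have "w.lin_indpt {}" by (auto simp: w.lin_dep_def)
  then obtain A where A: "finite A" "maximal A (\<lambda>A. A \<subseteq> W \<and> w.lin_indpt A)"
    using maximal_exists[of "\<lambda>A. A \<subseteq> W \<and> w.lin_indpt A" n "{}"] bound by auto
  then have "w.basis A" using w.max_li_is_basis[of A] by simp
  then show ?thesis using A(1) unfolding w.fin_dim_def w.basis_def by auto
qed

lemma GL_first_columns:
  assumes g: "g \<in> GL n" and m: "m \<le> n"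
  shows "card (col g ` {..<m}) = m"
    and "\<not> LinearCombinations.module.lin_dep class_ring (Cspace n) (col g ` {..<m})"
proof -
  interpret vec_space "TYPE(complex)" n .
  have gc: "g \<in> carrier_mat n n" and d: "det g \<noteq> 0" using g by (auto simp: GL_iff_det)
  have "inj_on (col g) {..<m}"
  proof (rule inj_onI, rule ccontr)
    fix i j assume "i \<in> {..<m}" "j \<in> {..<m}" "col g i = col g j" "i \<noteq> j"
    then have "det g = 0" using det_identical_columns[OF gc, of i j] m by auto
    then show False using d by simp
  qed
  then show "card (col g ` {..<m}) = m" by (simp add: card_image)
  have "lin_indpt (set (cols g))" using lin_dep_cols_imp_det_0[OF gc] d by blast
  moreover have "col g ` {..<m} \<subseteq> set (cols g)" using gc m by (auto simp: cols_def)
  ultimately show "lin_indpt (col g ` {..<m})" using subset_li_is_li by blast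
qed

lemma span_first_columns:
  assumes g: "g \<in> carrier_mat n n" and m: "m \<le> n"
  shows "LinearCombinations.module.span class_ring (Cspace n) (col g ` {..<m})
    = (*\<^sub>v) g ` coord_space n {..<m}" (is "?S = ?V")
    and "VectorSpace.subspace class_ring ((*\<^sub>v) g ` coord_space n {..<m}) (Cspace n)"
proof -
  interpret vec_space "TYPE(complex)" n .
  have cc: "col g ` {..<m} \<subseteq> carrier_vec n" using g by auto
  have S: "VectorSpace.subspace class_ring ?S V" using span_is_subspace[of "col g ` {..<m}"] cc by simp
  have "col g j \<in> ?S" if "j < m" for j using in_own_span[of "col g ` {..<m}"] cc that by auto
  then have 1: "?V \<subseteq> ?S" using mult_coord_space_subset[OF g S] m by blast
  show V: "VectorSpace.subspace class_ring ?V V"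
    unfolding subspace_Cspace_iff
  proof (intro conjI ballI allI)
    have "0\<^sub>v n = g *\<^sub>v 0\<^sub>v n" using g by auto
    moreover have "0\<^sub>v n \<in> coord_space n {..<m}" by (auto simp: coord_space_def)
    ultimately show "0\<^sub>v n \<in> ?V" by blast
    show "?V \<subseteq> carrier_vec n" using g by (auto simp: coord_space_def)
    fix v assume "v \<in> ?V"
    then obtain x where x: "x \<in> coord_space n {..<m}" "v = g *\<^sub>v x" by blast
    show "c \<cdot>\<^sub>v v \<in> ?V" for c
    proof -
      have "c \<cdot>\<^sub>v x \<in> coord_space n {..<m}" using x(1) by (auto simp: coord_space_def)
      moreover have "c \<cdot>\<^sub>v v = g *\<^sub>v (c \<cdot>\<^sub>v x)"
        using x g by (auto simp: coord_space_def mult_mat_vec)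
      ultimately show ?thesis by blast
    qed
    fix w assume "w \<in> ?V"
    then obtain y where y: "y \<in> coord_space n {..<m}" "w = g *\<^sub>v y" by blast
    have "x + y \<in> coord_space n {..<m}" using x(1) y(1) by (auto simp: coord_space_def)
    moreover have "v + w = g *\<^sub>v (x + y)"
      using x y g by (auto simp: coord_space_def mult_add_distrib_mat_vec)
    ultimately show "v + w \<in> ?V" by blast
  qed
  have "col g j \<in> ?V" if "j < m" for j
  proof -
    have "unit_vec n j \<in> coord_space n {..<m}" using that by (auto simp: coord_space_def unit_vec_def)
    moreover have "g *\<^sub>v unit_vec n j = col g j" using g that m by (intro eq_vecI) auto
    ultimately show ?thesis by (metis imageI)
  qed
  then have "?S \<subseteq> ?V" using span_is_subset[of "col g ` {..<m}" ?V] V by auto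
  then show "?S = ?V" using 1 by blast
qed

lemma dim_first_columns:
  assumes g: "g \<in> GL n" and m: "m \<le> n"
  shows "vectorspace.dim class_ring ((Cspace n)\<lparr>carrier := (*\<^sub>v) g ` coord_space n {..<m}\<rparr>) = m"
proof -
  interpret vec_space "TYPE(complex)" n .
  note gc = GL_carrier[OF g]
  define W where "W = (*\<^sub>v) g ` coord_space n {..<m}"
  have W: "VectorSpace.subspace class_ring W V" and S: "span (col g ` {..<m}) = W"
    unfolding W_def using span_first_columns[OF gc m] by auto
  interpret w: vectorspace class_ring "vs W" using W by (rule subspace_is_vs)
  have "col g ` {..<m} \<subseteq> carrier_vec n" using gc by auto
  then have sub: "col g ` {..<m} \<subseteq> W" using in_own_span[of "col g ` {..<m}"] unfolding S by auto
  have "w.span (col g ` {..<m}) = W" "w.lin_indpt (col g ` {..<m})"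
    using span_li_not_depend[of "col g ` {..<m}" W] sub W S GL_first_columns(2)[OF g m] by auto
  then have "w.basis (col g ` {..<m})" using sub by (auto simp: w.basis_def)
  then have "w.dim = card (col g ` {..<m})" by (intro w.dim_basis) auto
  then show ?thesis using GL_first_columns(1)[OF g m] unfolding W_def by simp
qed

lemma subspace_eq_first_columns:
  assumes g: "g \<in> GL n" and m: "m \<le> n"
    and W: "VectorSpace.subspace class_ring W (Cspace n)"
    and dim: "vectorspace.dim class_ring ((Cspace n)\<lparr>carrier := W\<rparr>) = m"
    and cols: "\<And>j. j < m \<Longrightarrow> col g j \<in> W"
  shows "W = (*\<^sub>v) g ` coord_space n {..<m}"
proof -
  interpret vec_space "TYPE(complex)" n .
  note gc = GL_carrier[OF g]
  interpret w: vectorspace class_ring "vs W" using W by (rule subspace_is_vs)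
  have sub: "col g ` {..<m} \<subseteq> W" using cols by auto
  have "w.lin_indpt (col g ` {..<m})"
    using span_li_not_depend(2)[of "col g ` {..<m}" W] sub W GL_first_columns(2)[OF g m] by auto
  then have "w.basis (col g ` {..<m})"
    using subspace_fin_dim[OF W] sub GL_first_columns(1)[OF g m] dim
    by (intro w.dim_li_is_basis) auto
  then have "w.span (col g ` {..<m}) = W" by (auto simp: w.basis_def)
  then show ?thesis
    using span_li_not_depend(1)[of "col g ` {..<m}" W] sub W span_first_columns(1)[OF gc m] by auto
qed

lemma act_GL_flags:
  assumes g: "g \<in> GL n"
  shows "act g (E_plus n) \<in> flags n"
proof -
  note gc = GL_carrier[OF g]
  have nth: "act g (E_plus n) ! i = (*\<^sub>v) g ` coord_space n {..<Suc i}" if "i < n" for i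
    using that by (simp add: act_def E_plus_eq lessThan_Suc_atMost)
  have "coord_space n {..<Suc i} \<subseteq> coord_space n {..<Suc (Suc i)}" for i
    by (auto simp: coord_space_def)
  then have "act g (E_plus n) ! i \<subseteq> act g (E_plus n) ! Suc i" if "Suc i < n" for i
    using that by (simp add: nth image_mono)
  moreover have "length (act g (E_plus n)) = n" by (simp add: act_def E_plus_eq)
  ultimately show ?thesis
    unfolding flags_def using span_first_columns(2)[OF gc] dim_first_columns[OF g] nth by auto
qed

text \<open>A vector of each member that lies outside the preceding member gives the columns of a matrix;
  they are independent, and equality of dimensions identifies the flag.\<close>

lemma flags_adapted_basis:
  assumes F: "F \<in> flags n"
  obtains g where "g \<in> GL n" "F = act g (E_plus n)"
proof -
  \<comment> \<open>The value at 0 stands for the zero space that precedes the first member.\<close>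
  define P where "P i = (if i = 0 then {0\<^sub>v n} else F ! (i - 1))" for i
  have sub: "VectorSpace.subspace class_ring (F ! i) (Cspace n)"
    and dim: "vectorspace.dim class_ring ((Cspace n)\<lparr>carrier := F ! i\<rparr>) = Suc i" if "i < n" for i
    using F that by (auto simp: flags_def)
  have Psub: "VectorSpace.subspace class_ring (P i) (Cspace n)" if "i < n" for i
    using that sub[of "i - 1"] by (auto simp: P_def subspace_Cspace_iff)
  have dimP: "vectorspace.dim class_ring ((Cspace n)\<lparr>carrier := P i\<rparr>) = i" if "i < n" for i
  proof (cases "i = 0")
    case True
    have "coord_space n {..<0} = {0\<^sub>v n}"
      by (auto simp: coord_space_def intro!: eq_vecI)
    then have "(*\<^sub>v) (1\<^sub>m n) ` coord_space n {..<0} = {0\<^sub>v n}" by simp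
    then show ?thesis using dim_first_columns[OF one_GL, of 0 n] True by (simp add: P_def)
  next
    case False
    then show ?thesis using dim[of "i - 1"] that by (simp add: P_def)
  qed
  have mono: "F ! i \<subseteq> F ! j" if "i \<le> j" "j < n" for i j
    using that
  proof (induction j)
    case (Suc j)
    then have "F ! j \<subseteq> F ! Suc j" using F by (auto simp: flags_def)
    then show ?case using Suc by (cases "i = Suc j") auto
  qed simp
  have PF: "P i \<subseteq> F ! i" if "i < n" for i
    using that sub[of i] mono[of "i - 1" i] by (auto simp: P_def subspace_Cspace_iff)
  have "\<exists>v. v \<in> F ! i \<and> v \<notin> P i" if "i < n" for i
    using dim[OF that] dimP[OF that] PF[OF that] by (metis n_not_Suc_n subset_antisym subsetI)
  then obtain v where v: "v i \<in> F ! i" "v i \<notin> P i" if "i < n" for i by metis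
  have vc: "v i \<in> carrier_vec n" if "i < n" for i
    using v(1)[OF that] sub[OF that] by (auto simp: subspace_Cspace_iff)
  define g where "g = mat n n (\<lambda>(r, c). v c $ r)"
  have gc: "g \<in> carrier_mat n n" by (simp add: g_def)
  have col: "col g i = v i" if "i < n" for i
    using that vc[OF that] by (intro eq_vecI) (auto simp: g_def)
  have "det g \<noteq> 0"
  proof
    \<comment> \<open>The last nonzero coordinate of a kernel vector would put some v r into the
      preceding member of the flag.\<close>
    assume "det g = 0"
    then obtain x where x: "x \<in> carrier_vec n" "x \<noteq> 0\<^sub>v n" "g *\<^sub>v x = 0\<^sub>v n"
      using det_0_iff_vec_prod_zero[OF gc] by blast
    have fin: "finite {r. r < n \<and> x $ r \<noteq> 0}" by simp
    have ne: "{r. r < n \<and> x $ r \<noteq> 0} \<noteq> {}"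
      using x(1,2) by (metis (mono_tags, lifting) carrier_vecD empty_Collect_eq eq_vecI index_zero_vec)
    define r where "r = Max {r. r < n \<and> x $ r \<noteq> 0}"
    have r: "r < n" "x $ r \<noteq> 0" using Max_in[OF fin ne] by (auto simp: r_def)
    have above: "x $ k = 0" if "r < k" "k < n" for k
      using Max_ge[OF fin, of k] that by (fastforce simp: r_def)
    define x' where "x' = vec n (\<lambda>k. if k = r then 0 else - x $ k / x $ r)"
    have x': "x' \<in> coord_space n {..<r}"
      using above by (auto simp: coord_space_def x'_def)
    have "x = x $ r \<cdot>\<^sub>v (unit_vec n r - x')"
      using x(1) r by (intro eq_vecI) (auto simp: x'_def)
    then have "0\<^sub>v n = g *\<^sub>v (x $ r \<cdot>\<^sub>v (unit_vec n r - x'))" using x(3) by simp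
    also have "\<dots> = x $ r \<cdot>\<^sub>v (g *\<^sub>v (unit_vec n r - x'))"
      using gc by (intro mult_mat_vec) (auto simp: x'_def)
    also have "g *\<^sub>v (unit_vec n r - x') = g *\<^sub>v unit_vec n r - g *\<^sub>v x'"
      using gc by (intro mult_minus_distrib_mat_vec) (auto simp: x'_def)
    also have "g *\<^sub>v unit_vec n r = v r"
      using gc r(1) col[OF r(1)] vc[OF r(1)] by (intro eq_vecI) (auto simp: g_def)
    finally have e: "0\<^sub>v n = x $ r \<cdot>\<^sub>v (v r - g *\<^sub>v x')" .
    have "v r = g *\<^sub>v x'"
    proof (rule eq_vecI)
      show "dim_vec (v r) = dim_vec (g *\<^sub>v x')" using vc[OF r(1)] gc by auto
      fix k assume "k < dim_vec (g *\<^sub>v x')"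
      then show "v r $ k = (g *\<^sub>v x') $ k"
        using arg_cong[OF e, of "\<lambda>w. w $ k"] r(2) gc vc[OF r(1)] by auto
    qed
    moreover have "(*\<^sub>v) g ` coord_space n {..<r} \<subseteq> P r"
    proof (rule mult_coord_space_subset[OF gc Psub[OF r(1)]])
      fix j assume "j < r"
      then have "j \<le> r - 1" "r - 1 < n" "j < n" "r \<noteq> 0" using r(1) by auto
      then show "col g j \<in> P r"
        using col[of j] v(1)[of j] mono[of j "r - 1"] by (auto simp: P_def)
    qed (use r(1) in simp)
    ultimately have "v r \<in> P r" using x' by auto
    then show False using v(2)[OF r(1)] by simp
  qed
  then have g: "g \<in> GL n" using gc by (simp add: GL_iff_det)
  have "F ! i = act g (E_plus n) ! i" if i: "i < n" for i
  proof -
    have "F ! i = (*\<^sub>v) g ` coord_space n {..<Suc i}"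
      using i col v(1) mono
      by (intro subspace_eq_first_columns[OF g _ sub[OF i] dim[OF i]]) (auto simp: subset_iff less_Suc_eq_le)
    then show ?thesis using i by (simp add: act_def E_plus_eq lessThan_Suc_atMost)
  qed
  moreover have "length F = n" using F by (simp add: flags_def)
  ultimately have "F = act g (E_plus n)"
    by (intro nth_equalityI) (auto simp: act_def E_plus_eq)
  then show thesis using g that by blast
qed

section \<open>The Bruhat decomposition\<close>

abbreviation perm_inv :: "(nat \<Rightarrow> nat) \<Rightarrow> nat \<Rightarrow> nat" where
  "perm_inv w \<equiv> inv_into UNIV w"

lemma permutes_lt: "w permutes {..<n} \<Longrightarrow> i < n \<Longrightarrow> w i < n"
  using permutes_in_image[of w "{..<n}" i] by simp

lemma permutes_inv_lt: "w permutes {..<n} \<Longrightarrow> i < n \<Longrightarrow> perm_inv w i < n"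
  using permutes_lt[OF permutes_inv] by blast

lemma perm_mat_carrier [simp]: "perm_mat n w \<in> carrier_mat n n"
  by (simp add: perm_mat_def)

lemma one_mult_perm_mat [simp]: "1\<^sub>m n * perm_mat n w = perm_mat n w" "perm_mat n w * 1\<^sub>m n = perm_mat n w"
  using left_mult_one_mat[OF perm_mat_carrier] right_mult_one_mat[OF perm_mat_carrier] by auto

lemma perm_mat_index: "i < n \<Longrightarrow> j < n \<Longrightarrow> perm_mat n w $$ (i, j) = (if i = w j then 1 else 0)"
  by (simp add: perm_mat_def)

lemma perm_mat_mult_index:
  assumes w: "w permutes {..<n}" and A: "A \<in> carrier_mat n n" and ij: "i < n" "j < n"
  shows "(perm_mat n w * A) $$ (i, j) = A $$ (perm_inv w i, j)"
proof -
  have "(perm_mat n w * A) $$ (i, j) = (\<Sum>k<n. perm_mat n w $$ (i, k) * A $$ (k, j))"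
    using A ij by (intro mult_mat_index) auto
  also have "\<dots> = (\<Sum>k<n. if k = perm_inv w i then A $$ (perm_inv w i, j) else 0)"
    by (rule sum.cong) (use ij w permutes_inv_eq[OF w] in \<open>auto simp: perm_mat_index\<close>)
  also have "\<dots> = A $$ (perm_inv w i, j)" using permutes_inv_lt[OF w ij(1)] by simp
  finally show ?thesis .
qed

lemma mult_perm_mat_index:
  assumes w: "w permutes {..<n}" and A: "A \<in> carrier_mat n n" and ij: "i < n" "j < n"
  shows "(A * perm_mat n w) $$ (i, j) = A $$ (i, w j)"
proof -
  have "(A * perm_mat n w) $$ (i, j) = (\<Sum>k<n. A $$ (i, k) * perm_mat n w $$ (k, j))"
    using A ij by (intro mult_mat_index) auto
  also have "\<dots> = (\<Sum>k<n. if k = w j then A $$ (i, w j) else 0)"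
    by (rule sum.cong) (use ij in \<open>auto simp: perm_mat_index\<close>)
  also have "\<dots> = A $$ (i, w j)" using permutes_lt[OF w ij(2)] by simp
  finally show ?thesis .
qed

lemma perm_mat_comp:
  assumes w: "w permutes {..<n}" and v: "v permutes {..<n}"
  shows "perm_mat n (w \<circ> v) = perm_mat n w * perm_mat n v"
proof (rule eq_matI)
  fix i j assume "i < dim_row (perm_mat n w * perm_mat n v)" "j < dim_col (perm_mat n w * perm_mat n v)"
  then have "i < n" "j < n" by (auto simp: perm_mat_def)
  then show "perm_mat n (w \<circ> v) $$ (i, j) = (perm_mat n w * perm_mat n v) $$ (i, j)"
    using permutes_lt[OF v] by (simp add: mult_perm_mat_index[OF v] perm_mat_index)
qed (auto simp: perm_mat_def)

lemma perm_mat_id: "perm_mat n id = 1\<^sub>m n"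
  by (rule eq_matI) (auto simp: perm_mat_def)

lemma perm_mat_inverse:
  assumes "w permutes {..<n}"
  shows "perm_mat n w * perm_mat n (perm_inv w) = 1\<^sub>m n" "perm_mat n (perm_inv w) * perm_mat n w = 1\<^sub>m n"
  using perm_mat_comp[OF assms permutes_inv[OF assms]] perm_mat_comp[OF permutes_inv[OF assms] assms]
    permutes_inv_o[OF assms] by (simp_all add: perm_mat_id)

lemma perm_mat_GL: "w permutes {..<n} \<Longrightarrow> perm_mat n w \<in> GL n"
  using det_mult[of "perm_mat n w" n "perm_mat n (perm_inv w)"] perm_mat_inverse(1)[of w n]
  by (auto simp: GL_iff_det)

definition bruhat_cell :: "nat \<Rightarrow> (nat \<Rightarrow> nat) \<Rightarrow> complex mat set" where
  "bruhat_cell n w = {b * perm_mat n w * c | b c. b \<in> UT n \<and> c \<in> UT n}"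

lemma bruhat_cell_GL: "w permutes {..<n} \<Longrightarrow> g \<in> bruhat_cell n w \<Longrightarrow> g \<in> GL n"
  by (auto simp: bruhat_cell_def intro!: mult_GL perm_mat_GL dest: UT_GL)

lemma perm_mat_bruhat_cell: "perm_mat n w \<in> bruhat_cell n w"
proof -
  have "perm_mat n w = 1\<^sub>m n * perm_mat n w * 1\<^sub>m n"
    by simp
  then show ?thesis using one_UT unfolding bruhat_cell_def by blast
qed

lemma bruhat_cell_mult_UT:
  assumes "g \<in> bruhat_cell n w" and b: "b \<in> UT n" and c: "c \<in> UT n"
  shows "b * g * c \<in> bruhat_cell n w"
proof -
  obtain b' c' where bc: "b' \<in> UT n" "c' \<in> UT n" "g = b' * perm_mat n w * c'"
    using assms(1) by (auto simp: bruhat_cell_def)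
  note C = UT_carrier[OF b] UT_carrier[OF c] UT_carrier[OF bc(1)] UT_carrier[OF bc(2)]
  have "b * g * c = (b * b') * perm_mat n w * (c' * c)"
    unfolding bc(3) using C perm_mat_carrier[of n w] by (simp add: mat_assoc[where n = n])
  then show ?thesis using mult_UT b c bc unfolding bruhat_cell_def by blast
qed

lemma bruhat_cell_left: "g \<in> bruhat_cell n w \<Longrightarrow> g \<in> carrier_mat n n \<Longrightarrow> b \<in> UT n \<Longrightarrow> b * g \<in> bruhat_cell n w"
  using bruhat_cell_mult_UT[OF _ _ one_UT, of g n w b] UT_carrier[of b n] by simp

lemma bruhat_cell_right: "g \<in> bruhat_cell n w \<Longrightarrow> g \<in> carrier_mat n n \<Longrightarrow> c \<in> UT n \<Longrightarrow> g * c \<in> bruhat_cell n w"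
  using bruhat_cell_mult_UT[OF _ one_UT, of g n w c] by simp

lemma bruhat_cell_representative:
  assumes "g \<in> bruhat_cell n w"
  obtains b c where "b \<in> UT n" "c \<in> UT n" "perm_mat n w = b * g * c"
proof -
  obtain b' c' where bc: "b' \<in> UT n" "c' \<in> UT n" "g = b' * perm_mat n w * c'"
    using assms by (auto simp: bruhat_cell_def)
  obtain b where b: "b \<in> UT n" "b * b' = 1\<^sub>m n" using UT_inverse[OF bc(1)] by blast
  obtain c where c: "c \<in> UT n" "c' * c = 1\<^sub>m n" using UT_inverse[OF bc(2)] by blast
  note C = UT_carrier[OF b(1)] UT_carrier[OF c(1)] UT_carrier[OF bc(1)] UT_carrier[OF bc(2)]
  have "b * g * c = (b * b') * perm_mat n w * (c' * c)"
    unfolding bc(3) using C perm_mat_carrier[of n w] by (simp add: mat_assoc[where n = n])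
  then have "perm_mat n w = b * g * c" using b c by simp
  then show thesis using that b c by blast
qed

text \<open>Gaussian elimination, one column at a time: earlier columns clear the rows of earlier pivots,
  and the lowest remaining nonzero entry becomes the next pivot because upper triangular row
  operations can clear everything above it.\<close>

lemma column_reduction:
  assumes g: "g \<in> GL n" and "q \<le> n"
  shows "\<exists>b\<in>UT n. \<exists>c\<in>UT n. \<exists>f. inj_on f {..<q} \<and> f ` {..<q} \<subseteq> {..<n} \<and>
    (\<forall>j<q. \<forall>i<n. (b * g * c) $$ (i, j) = (if i = f j then 1 else 0))"
  using assms(2)
proof (induction q)
  case 0
  then show ?case using one_UT by (intro bexI[of _ "1\<^sub>m n"]) auto
next
  case (Suc q)
  then obtain b c f where bc: "b \<in> UT n" "c \<in> UT n" and f: "inj_on f {..<q}" "f ` {..<q} \<subseteq> {..<n}"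
    and M: "\<And>i j. j < q \<Longrightarrow> i < n \<Longrightarrow> (b * g * c) $$ (i, j) = (if i = f j then 1 else 0)"
    by (auto simp: Suc_le_eq)
  have q: "q < n" using Suc.prems by simp
  have fn: "f k < n" if "k < q" for k using f(2) that by auto
  define m where "m = b * g * c"
  have m: "m \<in> GL n" unfolding m_def using bc g by (auto intro!: mult_GL dest: UT_GL)
  note mc = GL_carrier[OF m]
  \<comment> \<open>Column operations with the earlier columns clear the rows of the earlier pivots.\<close>
  define c1 where "c1 = mat n n (\<lambda>(k, j). if k = j then 1 else if j = q \<and> k < q then - m $$ (f k, q) else 0)"
  have c1: "c1 \<in> UT n" by (rule UT_I) (auto simp: c1_def)
  note c1c = UT_carrier[OF c1]
  define m1 where "m1 = m * c1"
  have m1: "m1 \<in> GL n" unfolding m1_def using m c1 by (auto intro!: mult_GL dest: UT_GL)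
  note m1c = GL_carrier[OF m1]
  have m1_other: "m1 $$ (i, j) = m $$ (i, j)" if "i < n" "j < n" "j \<noteq> q" for i j
  proof -
    have "m1 $$ (i, j) = (\<Sum>k<n. m $$ (i, k) * c1 $$ (k, j))"
      unfolding m1_def using that by (intro mult_mat_index mc c1c)
    also have "\<dots> = (\<Sum>k<n. if k = j then m $$ (i, j) else 0)"
      by (rule sum.cong) (use that in \<open>auto simp: c1_def\<close>)
    finally show ?thesis using that by simp
  qed
  have m1_pivot: "m1 $$ (f l, q) = 0" if l: "l < q" for l
  proof -
    have "m1 $$ (f l, q) = (\<Sum>k<n. m $$ (f l, k) * c1 $$ (k, q))"
      unfolding m1_def using fn[OF l] q by (intro mult_mat_index mc c1c)
    also have "\<dots> = (\<Sum>k<n. (if k = q then m $$ (f l, q) else 0) - (if k = l then m $$ (f l, q) else 0))"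
    proof (rule sum.cong[OF refl])
      fix k assume k: "k \<in> {..<n}"
      show "m $$ (f l, k) * c1 $$ (k, q)
        = (if k = q then m $$ (f l, q) else 0) - (if k = l then m $$ (f l, q) else 0)"
      proof (cases "k < q")
        case True
        then have "m $$ (f l, k) = (if k = l then 1 else 0)"
          using M[of k "f l"] fn[OF l] f(1) l by (auto simp: m_def inj_on_def)
        then show ?thesis using True k q by (auto simp: c1_def)
      next
        case False
        then show ?thesis using k q l by (auto simp: c1_def)
      qed
    qed
    also have "\<dots> = 0" using q l by (simp add: sum_subtractf)
    finally show ?thesis .
  qed
  obtain h where h: "h \<in> GL n" "h * m1 = 1\<^sub>m n" using GL_inverse[OF m1] by blast
  have ne: "{r. r < n \<and> m1 $$ (r, q) \<noteq> 0} \<noteq> {}"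
  proof
    assume "{r. r < n \<and> m1 $$ (r, q) \<noteq> 0} = {}"
    then have "(h * m1) $$ (q, q) = 0"
      using mult_mat_index[OF GL_carrier[OF h(1)] m1c q q] by (auto intro!: sum.neutral)
    then show False using h(2) q by simp
  qed
  have fin: "finite {r. r < n \<and> m1 $$ (r, q) \<noteq> 0}" by simp
  define r where "r = Max {r. r < n \<and> m1 $$ (r, q) \<noteq> 0}"
  have r: "r < n" "m1 $$ (r, q) \<noteq> 0" using Max_in[OF fin ne] by (auto simp: r_def)
  have below: "m1 $$ (k, q) = 0" if "r < k" "k < n" for k
    using Max_ge[OF fin, of k] that by (fastforce simp: r_def)
  have rf: "f l \<noteq> r" if "l < q" for l using m1_pivot[OF that] r(2) by auto
  \<comment> \<open>Row operations with row r clear the entries above the new pivot and scale it to 1.\<close>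
  define b1 where "b1 = mat n n (\<lambda>(i, k). if i = r \<and> k = r then 1 / m1 $$ (r, q) else if i = k then 1
    else if k = r \<and> i < r then - m1 $$ (i, q) / m1 $$ (r, q) else 0)"
  have b1: "b1 \<in> UT n" by (rule UT_I) (use r in \<open>auto simp: b1_def\<close>)
  note b1c = UT_carrier[OF b1]
  define f' where "f' = f(q := r)"
  have "(b1 * m1) $$ (i, j) = (if i = f' j then 1 else 0)" if j: "j < Suc q" and i: "i < n" for i j
  proof -
    have e: "(b1 * m1) $$ (i, j) = (\<Sum>k<n. b1 $$ (i, k) * m1 $$ (k, j))"
      using i j q by (intro mult_mat_index b1c m1c) auto
    show ?thesis
    proof (cases "j = q")
      case False
      then have jq: "j < q" using j by simp
      have "(b1 * m1) $$ (i, j) = (\<Sum>k<n. if k = f j then b1 $$ (i, f j) else 0)"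
        unfolding e
      proof (rule sum.cong[OF refl])
        fix k assume "k \<in> {..<n}"
        then show "b1 $$ (i, k) * m1 $$ (k, j) = (if k = f j then b1 $$ (i, f j) else 0)"
          using m1_other[of k j] M[OF jq, of k] q False jq by (simp add: m_def)
      qed
      also have "\<dots> = b1 $$ (i, f j)" using fn[OF jq] by simp
      also have "\<dots> = (if i = f j then 1 else 0)" using i fn[OF jq] rf[OF jq] by (simp add: b1_def)
      finally show ?thesis using jq by (simp add: f'_def)
    next
      case True
      have "(b1 * m1) $$ (i, j) = (\<Sum>k<n. (if k = r then b1 $$ (i, r) * m1 $$ (r, q) else 0)
          + (if k = i then if i = r then 0 else m1 $$ (i, q) else 0))"
        unfolding e by (rule sum.cong) (use i r True in \<open>auto simp: b1_def\<close>)
      also have "\<dots> = b1 $$ (i, r) * m1 $$ (r, q) + (if i = r then 0 else m1 $$ (i, q))"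
        using r i by (simp add: sum.distrib)
      also have "\<dots> = (if i = r then 1 else 0)"
        using r i below[of i] by (cases i r rule: linorder_cases) (auto simp: b1_def)
      finally show ?thesis using True by (simp add: f'_def)
    qed
  qed
  moreover have "b1 * m1 = (b1 * b) * g * (c * c1)"
    unfolding m1_def m_def
    using b1c c1c UT_carrier[OF bc(1)] UT_carrier[OF bc(2)] GL_carrier[OF g]
    by (simp add: mat_assoc[where n = n])
  moreover have "inj_on f' {..<Suc q}"
    unfolding f'_def lessThan_Suc by (rule inj_on_fun_updI[THEN inj_on_insert[THEN iffD2, OF conjI]])
      (use f(1) rf in auto)
  moreover have "f' ` {..<Suc q} \<subseteq> {..<n}" using fn r(1) by (auto simp: f'_def less_Suc_eq)
  ultimately show ?case
    using mult_UT[OF b1 bc(1)] mult_UT[OF bc(2) c1] by metis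
qed

lemma bruhat_exists:
  assumes g: "g \<in> GL n"
  obtains w where "w permutes {..<n}" "g \<in> bruhat_cell n w"
proof -
  obtain b c f where bc: "b \<in> UT n" "c \<in> UT n" and f: "inj_on f {..<n}" "f ` {..<n} \<subseteq> {..<n}"
    and "\<forall>j<n. \<forall>i<n. (b * g * c) $$ (i, j) = (if i = f j then 1 else 0)"
    using column_reduction[OF g order_refl] by (elim bexE exE conjE) (rule that)
  then have M: "(b * g * c) $$ (i, j) = (if i = f j then 1 else 0)" if "j < n" "i < n" for i j
    using that by blast
  define w where "w i = (if i < n then f i else i)" for i
  have "f ` {..<n} = {..<n}" using f by (intro endo_inj_surj) auto
  then have "bij_betw w {..<n} {..<n}"
    using f(1) by (auto simp: bij_betw_def w_def inj_on_def image_def)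
  then have w: "w permutes {..<n}" by (rule bij_imp_permutes) (auto simp: w_def)
  have "b * g * c = perm_mat n w"
    by (rule eq_matI) (use M GL_carrier[OF g] UT_carrier[OF bc(1)] UT_carrier[OF bc(2)] in \<open>auto simp: perm_mat_def w_def\<close>)
  moreover obtain b' where b': "b' \<in> UT n" "b' * b = 1\<^sub>m n" using UT_inverse[OF bc(1)] by blast
  moreover obtain c' where c': "c' \<in> UT n" "c * c' = 1\<^sub>m n" using UT_inverse[OF bc(2)] by blast
  moreover have "b' * (b * g * c) * c' = (b' * b) * g * (c * c')"
    using GL_carrier[OF g] UT_carrier[OF bc(1)] UT_carrier[OF bc(2)] UT_carrier[OF b'(1)] UT_carrier[OF c'(1)]
    by (simp add: mat_assoc[where n = n])
  ultimately have "g = b' * perm_mat n w * c'" using GL_carrier[OF g] by simp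
  then have "g \<in> bruhat_cell n w" using b' c' unfolding bruhat_cell_def by blast
  then show thesis using w that by blast
qed

subsection \<open>Minors that separate cells\<close>

text \<open>Filling up a block with the identity keeps the size \<open>n\<close>, so that a principal minor is the
  determinant of a matrix of the same size.\<close>

definition principal :: "nat \<Rightarrow> nat set \<Rightarrow> (nat \<Rightarrow> nat \<Rightarrow> complex) \<Rightarrow> complex mat" where
  "principal n C G = mat n n (\<lambda>(k, l). if k \<in> C \<and> l \<in> C then G k l else if k = l then 1 else 0)"

lemma principal_carrier [simp]: "principal n C G \<in> carrier_mat n n"
  by (simp add: principal_def)

text \<open>The block factors through one index less than its size, so the filled-up matrix is a product
  whose left factor has a zero column.\<close>

lemma det_principal_zero:
  assumes C: "C \<subseteq> {..<n}" "a \<in> C"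
    and G: "\<And>k l. k \<in> C \<Longrightarrow> l \<in> C \<Longrightarrow> G k l = (\<Sum>m\<in>C - {a}. \<beta> k m * \<gamma> m l)"
  shows "det (principal n C G) = 0"
proof -
  define P where "P = principal n C (\<lambda>k m. if m = a then 0 else \<beta> k m)"
  define R where "R = principal n C \<gamma>"
  have Pc: "P \<in> carrier_mat n n" and Rc: "R \<in> carrier_mat n n" by (simp_all add: P_def R_def)
  have fin: "finite C" using C(1) finite_subset by blast
  have "principal n C G = P * R"
  proof (rule eq_matI)
    fix k l assume "k < dim_row (P * R)" "l < dim_col (P * R)"
    then have kl: "k < n" "l < n" using Pc Rc by auto
    have e: "(P * R) $$ (k, l) = (\<Sum>m<n. P $$ (k, m) * R $$ (m, l))"
      using kl by (intro mult_mat_index Pc Rc)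
    show "principal n C G $$ (k, l) = (P * R) $$ (k, l)"
    proof (cases "k \<in> C")
      case False
      have "(\<Sum>m<n. P $$ (k, m) * R $$ (m, l)) = (\<Sum>m<n. if m = k then R $$ (k, l) else 0)"
        by (rule sum.cong) (use kl False in \<open>auto simp: P_def principal_def\<close>)
      then show ?thesis using e kl False by (simp add: R_def principal_def)
    next
      case kC: True
      show ?thesis
      proof (cases "l \<in> C")
        case False
        have "(\<Sum>m<n. P $$ (k, m) * R $$ (m, l)) = (\<Sum>m<n. if m = l then P $$ (k, l) else 0)"
          by (rule sum.cong) (use kl False in \<open>auto simp: R_def principal_def\<close>)
        then show ?thesis using e kl False kC by (simp add: P_def principal_def)
      next
        case True
        have "(\<Sum>m<n. P $$ (k, m) * R $$ (m, l)) = (\<Sum>m<n. if m \<in> C - {a} then \<beta> k m * \<gamma> m l else 0)"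
          by (rule sum.cong) (use kl True kC in \<open>auto simp: P_def R_def principal_def\<close>)
        also have "\<dots> = (\<Sum>m\<in>C - {a}. \<beta> k m * \<gamma> m l)"
          using C(1) by (subst sum.inter_restrict[symmetric]) (auto intro!: sum.cong)
        finally show ?thesis using e G[OF kC True] kl kC True by (simp add: principal_def)
      qed
    qed
  qed (use Pc Rc in \<open>auto simp: principal_def\<close>)
  moreover have "det P = 0"
  proof -
    have an: "a < n" using C by auto
    have "P *\<^sub>v unit_vec n a = 0\<^sub>v n"
      using an C(2) Pc by (intro eq_vecI) (auto simp: P_def principal_def)
    moreover have "unit_vec n a \<noteq> (0\<^sub>v n :: complex vec)" using an by simp
    ultimately show ?thesis using det_0_iff_vec_prod_zero[OF Pc] by (metis unit_vec_carrier)
  qed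
  ultimately show ?thesis using det_mult[OF Pc Rc] by simp
qed

lemma poly_funs_sum: "finite I \<Longrightarrow> (\<And>i. i \<in> I \<Longrightarrow> f i \<in> poly_funs n) \<Longrightarrow> (\<lambda>A. \<Sum>i\<in>I. f i A) \<in> poly_funs n"
  by (induction I rule: finite_induct) (auto intro: poly_funs.intros)

lemma poly_funs_prod: "finite I \<Longrightarrow> (\<And>i. i \<in> I \<Longrightarrow> f i \<in> poly_funs n) \<Longrightarrow> (\<lambda>A. \<Prod>i\<in>I. f i A) \<in> poly_funs n"
  by (induction I rule: finite_induct) (auto intro: poly_funs.intros)

lemma poly_funs_det:
  assumes "\<And>i j. i < m \<Longrightarrow> j < m \<Longrightarrow> (\<lambda>A. M A i j) \<in> poly_funs n"
  shows "(\<lambda>A. det (mat m m (\<lambda>(i, j). M A i j))) \<in> poly_funs n"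
proof -
  have "det (mat m m (\<lambda>(i, j). M A i j))
      = (\<Sum>p\<in>{p. p permutes {0..<m}}. signof p * (\<Prod>i = 0..<m. M A i (p i)))" for A
  proof -
    have "(\<Prod>i = 0..<m. mat m m (\<lambda>(i, j). M A i j) $$ (i, p i)) = (\<Prod>i = 0..<m. M A i (p i))"
      if "p permutes {0..<m}" for p
      using that by (intro prod.cong) auto
    then show ?thesis by (subst det_def'[of _ m]) (auto intro!: sum.cong)
  qed
  then show ?thesis
    by (simp only:) (intro poly_funs_sum poly_funs_prod poly_funs.mult poly_funs.const assms,
        auto simp: finite_permutations)
qed

lemma poly_funs_translate:
  assumes f: "f \<in> poly_funs n" and A: "A \<in> carrier_mat n n" and B: "B \<in> carrier_mat n n"
  shows "\<exists>f'\<in>poly_funs n. \<forall>g\<in>carrier_mat n n. f' g = f (A * g * B)"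
  using f
proof induction
  case (const c)
  then show ?case by (intro bexI[of _ "\<lambda>_. c"]) (auto intro: poly_funs.const)
next
  case (entry i j)
  let ?f = "\<lambda>g. \<Sum>l<n. (\<Sum>k<n. A $$ (i, k) * g $$ (k, l)) * B $$ (l, j)"
  have "?f \<in> poly_funs n" by (intro poly_funs_sum poly_funs.intros) auto
  moreover have "?f g = (A * g * B) $$ (i, j)" if g: "g \<in> carrier_mat n n" for g
  proof -
    have "(A * g * B) $$ (i, j) = (\<Sum>l<n. (A * g) $$ (i, l) * B $$ (l, j))"
      using entry g A B by (intro mult_mat_index) auto
    also have "\<dots> = ?f g"
      by (rule sum.cong) (use entry mult_mat_index[OF A g] in auto)
    finally show ?thesis by simp
  qed
  ultimately show ?case by (intro bexI[of _ ?f]) auto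
next
  case (add f1 f2)
  then obtain f1' f2' where "f1' \<in> poly_funs n" "f2' \<in> poly_funs n"
    "\<forall>g\<in>carrier_mat n n. f1' g = f1 (A * g * B)" "\<forall>g\<in>carrier_mat n n. f2' g = f2 (A * g * B)" by blast
  then show ?case by (intro bexI[of _ "\<lambda>g. f1' g + f2' g"]) (auto intro: poly_funs.add)
next
  case (mult f1 f2)
  then obtain f1' f2' where "f1' \<in> poly_funs n" "f2' \<in> poly_funs n"
    "\<forall>g\<in>carrier_mat n n. f1' g = f1 (A * g * B)" "\<forall>g\<in>carrier_mat n n. f2' g = f2 (A * g * B)" by blast
  then show ?case by (intro bexI[of _ "\<lambda>g. f1' g * f2' g"]) (auto intro: poly_funs.mult)
qed

text \<open>On the rows from \<open>w' a\<close> downwards and the columns up to \<open>a\<close>, the permutation \<open>w'\<close> has one pivot more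
  than \<open>w\<close>. The number of pivots in such a lower left corner is its rank, and the rank does not change
  under triangular matrices on either side, so the minor on the pivots of \<open>w'\<close> vanishes on the cell
  of \<open>w\<close>.\<close>

lemma cell_separating_minor:
  assumes w: "w permutes {..<n}" and w': "w' permutes {..<n}"
    and a: "a < n" "\<And>k. k < a \<Longrightarrow> w k = w' k" "w a < w' a"
  obtains f where "f \<in> poly_funs n" "\<And>g. g \<in> bruhat_cell n w \<Longrightarrow> f g = 0" "f (perm_mat n w') \<noteq> 0"
proof -
  define C where "C = {k. k \<le> a \<and> w' a \<le> w' k}"
  have C: "C \<subseteq> {..<n}" "a \<in> C" using a by (auto simp: C_def)
  have Cw: "k \<in> C - {a} \<longleftrightarrow> k \<le> a \<and> w' a \<le> w k" for k
    using a(2)[of k] a(3) by (cases "k = a") (auto simp: C_def)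
  define f where "f g = det (principal n C (\<lambda>k l. g $$ (w' k, l)))" for g
  have "f \<in> poly_funs n"
    unfolding f_def principal_def
  proof (rule poly_funs_det)
    fix k l assume "k < n" "l < n"
    then show "(\<lambda>g. if k \<in> C \<and> l \<in> C then g $$ (w' k, l) else if k = l then 1 else 0) \<in> poly_funs n"
      using poly_funs.entry[of "w' k" n l] permutes_lt[OF w', of k]
        poly_funs.const[of "if k = l then 1 else 0" n]
      by (cases "k \<in> C \<and> l \<in> C") auto
  qed
  moreover have "f g = 0" if "g \<in> bruhat_cell n w" for g
  proof -
    obtain b c where bc: "b \<in> UT n" "c \<in> UT n" "g = b * perm_mat n w * c"
      using \<open>g \<in> bruhat_cell n w\<close> by (auto simp: bruhat_cell_def)
    note C' = UT_carrier[OF bc(1)] UT_carrier[OF bc(2)]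
    have "g $$ (w' k, l) = (\<Sum>m\<in>C - {a}. b $$ (w' k, w m) * c $$ (m, l))"
      if kl: "k \<in> C" "l \<in> C" for k l
    proof -
      have k: "k < n" "w' k < n" "l < n" using kl C(1) permutes_lt[OF w'] by auto
      have "g $$ (w' k, l) = (\<Sum>m<n. (b * perm_mat n w) $$ (w' k, m) * c $$ (m, l))"
        unfolding bc(3) using k C' by (intro mult_mat_index) auto
      also have "\<dots> = (\<Sum>m<n. if m \<in> C - {a} then b $$ (w' k, w m) * c $$ (m, l) else 0)"
      proof (rule sum.cong[OF refl])
        fix m assume m: "m \<in> {..<n}"
        have "(b * perm_mat n w) $$ (w' k, m) = b $$ (w' k, w m)"
          using mult_perm_mat_index[OF w C'(1)] k m by simp
        moreover have "b $$ (w' k, w m) * c $$ (m, l) = 0" if "m \<notin> C - {a}"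
        proof (cases "m \<le> l")
          case True
          then have "w m < w' k" using that kl Cw[of m] by (auto simp: C_def)
          then show ?thesis using UT_zero[OF bc(1)] k by simp
        next
          case False
          then show ?thesis using UT_zero[OF bc(2)] m by simp
        qed
        ultimately show "(b * perm_mat n w) $$ (w' k, m) * c $$ (m, l)
          = (if m \<in> C - {a} then b $$ (w' k, w m) * c $$ (m, l) else 0)" by simp
      qed
      also have "\<dots> = (\<Sum>m\<in>C - {a}. b $$ (w' k, w m) * c $$ (m, l))"
        using C(1) by (subst sum.inter_restrict[symmetric]) (auto intro!: sum.cong)
      finally show ?thesis .
    qed
    then show ?thesis unfolding f_def by (rule det_principal_zero[OF C])
  qed
  moreover have "f (perm_mat n w') \<noteq> 0"
  proof -
    have "principal n C (\<lambda>k l. perm_mat n w' $$ (w' k, l)) = 1\<^sub>m n"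
      by (rule eq_matI)
        (use permutes_lt[OF w'] permutes_inj[OF w'] in \<open>auto simp: principal_def perm_mat_index inj_eq\<close>)
    then show ?thesis by (simp add: f_def)
  qed
  ultimately show thesis by (rule that)
qed

text \<open>Two different permutations are separated by a minor at the first place where they differ.\<close>

lemma bruhat_unique:
  assumes w: "w permutes {..<n}" and w': "w' permutes {..<n}"
    and g: "g \<in> bruhat_cell n w" "g \<in> bruhat_cell n w'"
  shows "w = w'"
proof (rule ccontr)
  assume "w \<noteq> w'"
  have no: False if v: "v permutes {..<n}" "v' permutes {..<n}" "g \<in> bruhat_cell n v" "g \<in> bruhat_cell n v'"
    and a: "a < n" "\<And>k. k < a \<Longrightarrow> v k = v' k" "v a < v' a" for v v' a
  proof -
    obtain f where "f \<in> poly_funs n" and f: "\<And>g. g \<in> bruhat_cell n v \<Longrightarrow> f g = 0" "f (perm_mat n v') \<noteq> 0"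
      using cell_separating_minor[of v n v' a] v a by blast
    obtain b c where "b \<in> UT n" "c \<in> UT n" "perm_mat n v' = b * g * c"
      using bruhat_cell_representative[OF v(4)] .
    then show False using f bruhat_cell_mult_UT[OF v(3)] by metis
  qed
  define a where "a = (LEAST k. w k \<noteq> w' k)"
  have eq: "w k = w' k" if "k < a" for k
    using not_less_Least[of k "\<lambda>k. w k \<noteq> w' k"] that unfolding a_def by auto
  have ne: "w a \<noteq> w' a"
    using \<open>w \<noteq> w'\<close> LeastI_ex[of "\<lambda>k. w k \<noteq> w' k"] unfolding a_def by auto
  then have "a < n" using w w' by (metis lessThan_iff permutes_not_in)
  then show False
    using no[OF w w' g, of a] no[OF w' w g(2,1), of a] eq ne by (metis linorder_neqE_nat)
qed

section \<open>Minimal parabolic subgroups\<close>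

lemma simple_refl_permutes: "Suc i < n \<Longrightarrow> simple_refl i permutes {..<n}"
  unfolding simple_refl_def by (rule permutes_swap_id) auto

lemma simple_refl_simps [simp]:
  "simple_refl i i = Suc i" "simple_refl i (Suc i) = i"
  by (auto simp: simple_refl_def)

lemma simple_refl_other: "k \<noteq> i \<Longrightarrow> k \<noteq> Suc i \<Longrightarrow> simple_refl i k = k"
  by (simp add: simple_refl_def Transposition.transpose_def)

lemma simple_refl_involutory [simp]: "simple_refl i (simple_refl i k) = k"
  by (simp add: simple_refl_def)

lemma simple_refl_comp [simp]: "simple_refl i \<circ> (simple_refl i \<circ> w) = w" "w \<circ> simple_refl i \<circ> simple_refl i = w"
  by (auto simp: fun_eq_iff)

lemma perm_inv_simple_refl [simp]: "perm_inv (simple_refl i) = simple_refl i"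
  by (rule inv_unique_comp) (auto simp: fun_eq_iff)

lemma simple_refl_square:
  assumes "Suc i < n"
  shows "perm_mat n (simple_refl i) * perm_mat n (simple_refl i) = 1\<^sub>m n"
  using perm_mat_inverse(1)[OF simple_refl_permutes[OF assms]] by simp

definition elem_mat :: "nat \<Rightarrow> nat \<Rightarrow> nat \<Rightarrow> complex \<Rightarrow> complex mat" where
  "elem_mat n a b t = mat n n (\<lambda>(k, l). (if k = l then 1 else 0) + (if k = a \<and> l = b then t else 0))"

lemma elem_mat_carrier [simp]: "elem_mat n a b t \<in> carrier_mat n n"
  by (simp add: elem_mat_def)

lemma elem_mat_UT: "a < b \<Longrightarrow> elem_mat n a b t \<in> UT n"
  by (rule UT_I) (auto simp: elem_mat_def)

lemma mult_elem_mat_index: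
  assumes "A \<in> carrier_mat n n" "r < n" "c < n" "a < n"
  shows "(A * elem_mat n a b t) $$ (r, c) = A $$ (r, c) + (if c = b then t * A $$ (r, a) else 0)"
proof -
  have "(A * elem_mat n a b t) $$ (r, c) = (\<Sum>k<n. A $$ (r, k) * elem_mat n a b t $$ (k, c))"
    using assms by (intro mult_mat_index) auto
  also have "\<dots> = (\<Sum>k<n. (if k = c then A $$ (r, c) else 0)
      + (if k = a then if c = b then t * A $$ (r, a) else 0 else 0))"
    by (rule sum.cong) (use assms in \<open>auto simp: elem_mat_def algebra_simps\<close>)
  finally show ?thesis using assms by (simp add: sum.distrib)
qed

lemma elem_mat_mult_index:
  assumes "A \<in> carrier_mat n n" "r < n" "c < n" "b < n"
  shows "(elem_mat n a b t * A) $$ (r, c) = A $$ (r, c) + (if r = a then t * A $$ (b, c) else 0)"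
proof -
  have "(elem_mat n a b t * A) $$ (r, c) = (\<Sum>k<n. elem_mat n a b t $$ (r, k) * A $$ (k, c))"
    using assms by (intro mult_mat_index) auto
  also have "\<dots> = (\<Sum>k<n. (if k = r then A $$ (r, c) else 0)
      + (if k = b then if r = a then t * A $$ (b, c) else 0 else 0))"
    by (rule sum.cong) (use assms in \<open>auto simp: elem_mat_def algebra_simps\<close>)
  finally show ?thesis using assms by (simp add: sum.distrib)
qed

lemma elem_mat_inverse:
  assumes "a < n" "b < n" "a \<noteq> b"
  shows "elem_mat n a b (- t) * elem_mat n a b t = 1\<^sub>m n"
  by (rule eq_matI) (use assms in \<open>auto simp: elem_mat_mult_index[OF elem_mat_carrier], auto simp: elem_mat_def\<close>)

lemma perm_mat_elem_mat:
  assumes w: "w permutes {..<n}" and ab: "a < n" "b < n"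
  shows "perm_mat n w * elem_mat n a b t = elem_mat n (w a) (w b) t * perm_mat n w"
proof (rule eq_matI)
  fix r c assume "r < dim_row (elem_mat n (w a) (w b) t * perm_mat n w)"
    "c < dim_col (elem_mat n (w a) (w b) t * perm_mat n w)"
  then have rc: "r < n" "c < n" by (auto simp: perm_mat_def elem_mat_def)
  show "(perm_mat n w * elem_mat n a b t) $$ (r, c) = (elem_mat n (w a) (w b) t * perm_mat n w) $$ (r, c)"
    using rc ab permutes_lt[OF w] permutes_inj[OF w]
    by (auto simp: mult_elem_mat_index elem_mat_mult_index perm_mat_index inj_eq)
qed (auto simp: perm_mat_def elem_mat_def)

lemma min_parabolic_zero:
  "p \<in> min_parabolic n i \<Longrightarrow> c < r \<Longrightarrow> r < n \<Longrightarrow> (r, c) \<noteq> (Suc i, i) \<Longrightarrow> p $$ (r, c) = 0"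
  by (simp add: min_parabolic_def)

lemma min_parabolic_GL: "p \<in> min_parabolic n i \<Longrightarrow> p \<in> GL n"
  by (simp add: min_parabolic_def)

lemma min_parabolicI:
  "p \<in> GL n \<Longrightarrow> (\<And>r c. c < r \<Longrightarrow> r < n \<Longrightarrow> (r, c) \<noteq> (Suc i, i) \<Longrightarrow> p $$ (r, c) = 0) \<Longrightarrow> p \<in> min_parabolic n i"
  by (auto simp: min_parabolic_def)

lemma UT_subset_min_parabolic: "UT n \<subseteq> min_parabolic n i"
  by (auto simp: UT_zero UT_GL intro!: min_parabolicI)

lemma min_parabolic_mult_UT:
  assumes p: "p \<in> min_parabolic n i" and b: "b \<in> UT n"
  shows "p * b \<in> min_parabolic n i" "b * p \<in> min_parabolic n i"
proof -
  note pc = GL_carrier[OF min_parabolic_GL[OF p]]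
  note bc = UT_carrier[OF b]
  show "p * b \<in> min_parabolic n i"
  proof (rule min_parabolicI)
    show "p * b \<in> GL n" using p b by (auto intro!: mult_GL dest: UT_GL min_parabolic_GL)
    fix r c assume rc: "c < r" "r < n" "(r, c) \<noteq> (Suc i, i)"
    have "p $$ (r, k) * b $$ (k, c) = 0" if "k < n" for k
      using min_parabolic_zero[OF p, of k r] UT_zero[OF b, of c k] rc that by (cases "k \<le> c") auto
    then show "(p * b) $$ (r, c) = 0"
      using mult_mat_index[OF pc bc, of r c] rc by (auto intro!: sum.neutral)
  qed
  show "b * p \<in> min_parabolic n i"
  proof (rule min_parabolicI)
    show "b * p \<in> GL n" using p b by (auto intro!: mult_GL dest: UT_GL min_parabolic_GL)
    fix r c assume rc: "c < r" "r < n" "(r, c) \<noteq> (Suc i, i)"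
    have "b $$ (r, k) * p $$ (k, c) = 0" if "k < n" for k
      using min_parabolic_zero[OF p, of c k] UT_zero[OF b, of k r] rc that by (cases "r \<le> k") auto
    then show "(b * p) $$ (r, c) = 0"
      using mult_mat_index[OF bc pc, of r c] rc by (auto intro!: sum.neutral)
  qed
qed

lemma min_parabolic_mult_refl:
  assumes p: "p \<in> min_parabolic n i" and i: "Suc i < n"
  shows "p * perm_mat n (simple_refl i) \<in> min_parabolic n i"
    and "perm_mat n (simple_refl i) * p \<in> min_parabolic n i"
proof -
  let ?s = "simple_refl i"
  note s = simple_refl_permutes[OF i]
  note pc = GL_carrier[OF min_parabolic_GL[OF p]]
  note z = min_parabolic_zero[OF p]
  show "p * perm_mat n ?s \<in> min_parabolic n i"
  proof (rule min_parabolicI)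
    show "p * perm_mat n ?s \<in> GL n" by (intro mult_GL perm_mat_GL s min_parabolic_GL[OF p])
    fix r c assume rc: "c < r" "r < n" "(r, c) \<noteq> (Suc i, i)"
    have "p $$ (r, ?s c) = 0"
      using rc z[of c r] z[of "Suc i" r] z[of i r] by (cases "c = i"; cases "c = Suc i") (auto simp: simple_refl_other)
    then show "(p * perm_mat n ?s) $$ (r, c) = 0" using mult_perm_mat_index[OF s pc, of r c] rc by simp
  qed
  show "perm_mat n ?s * p \<in> min_parabolic n i"
  proof (rule min_parabolicI)
    show "perm_mat n ?s * p \<in> GL n" by (intro mult_GL perm_mat_GL s min_parabolic_GL[OF p])
    fix r c assume rc: "c < r" "r < n" "(r, c) \<noteq> (Suc i, i)"
    have "p $$ (?s r, c) = 0"
      using rc i z[of c r] z[of c "Suc i"] z[of c i] by (cases "r = i"; cases "r = Suc i") (auto simp: simple_refl_other)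
    then show "(perm_mat n ?s * p) $$ (r, c) = 0" using perm_mat_mult_index[OF s pc, of r c] rc by simp
  qed
qed

text \<open>A parabolic element outside the Borel subgroup is triangular up to a reflection and one
  column operation; the column operation can be carried through a permutation matrix as long as
  it stays upper triangular, and this is the length condition.\<close>

lemma min_parabolic_mult_perm_mat_aux:
  assumes p: "p \<in> min_parabolic n i" and i: "Suc i < n" and w: "w permutes {..<n}"
    and len: "perm_inv w i < perm_inv w (Suc i)"
  shows "p * perm_mat n w \<in> bruhat_cell n w \<union> bruhat_cell n (simple_refl i \<circ> w)"
proof (cases "p $$ (Suc i, i) = 0")
  case True
  have "p \<in> UT n"
    using p min_parabolic_zero[OF p] True GL_carrier[of p n]
    unfolding UT_def by (auto simp: min_parabolic_def intro!: upper_triangularI)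
  then show ?thesis using bruhat_cell_left[OF perm_mat_bruhat_cell perm_mat_carrier] by blast
next
  case False
  let ?s = "simple_refl i"
  note s = simple_refl_permutes[OF i]
  note pG = min_parabolic_GL[OF p]
  note pc = GL_carrier[OF pG]
  note z = min_parabolic_zero[OF p]
  \<comment> \<open>This multiple of column i clears the diagonal entry that the exchange of the two columns would move below the diagonal.\<close>
  define t where "t = p $$ (Suc i, Suc i) / p $$ (Suc i, i)"
  define u where "u = elem_mat n i (Suc i) (- t)"
  define v where "v = elem_mat n i (Suc i) t"
  define v' where "v' = elem_mat n (perm_inv w i) (perm_inv w (Suc i)) t"
  have uU: "u \<in> UT n" and uc: "u \<in> carrier_mat n n" and vc: "v \<in> carrier_mat n n"
    and v'c: "v' \<in> carrier_mat n n" by (auto simp: u_def v_def v'_def intro!: elem_mat_UT)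
  define b where "b = p * u * perm_mat n ?s"
  have bG: "b \<in> GL n" unfolding b_def by (intro mult_GL perm_mat_GL pG s UT_GL[OF uU])
  note bc = GL_carrier[OF bG]
  have ent: "b $$ (r, c) = p $$ (r, ?s c) - (if c = i then t * p $$ (r, i) else 0)" if "r < n" "c < n" for r c
    unfolding b_def
    using that i pc uc permutes_lt[OF s that(2)] mult_perm_mat_index[OF s _ that, of "p * u"]
    by (cases "c = i"; cases "c = Suc i") (auto simp: u_def mult_elem_mat_index simple_refl_other)
  have "b \<in> UT n"
    unfolding UT_def
  proof (intro CollectI conjI bG upper_triangularI)
    fix c r assume rc: "c < r" "r < dim_row b"
    then have "r < n" using bc by auto
    then show "b $$ (r, c) = 0"
      using rc ent[of r c] z[of c r] z[of i r] z[of "Suc i" r] False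
      by (cases "c = i"; cases "c = Suc i"; cases "r = Suc i") (auto simp: simple_refl_other t_def)
  qed
  moreover have "p * perm_mat n w = b * perm_mat n (?s \<circ> w) * v'"
  proof -
    have "perm_mat n w * v' = v * perm_mat n w"
      unfolding v_def v'_def using perm_mat_elem_mat[OF w, of "perm_inv w i" "perm_inv w (Suc i)" t]
        permutes_inv_lt[OF w] permutes_inverses(1)[OF w] i by simp
    then have "b * perm_mat n (?s \<circ> w) * v' = p * (u * ((perm_mat n ?s * perm_mat n ?s) * (v * perm_mat n w)))"
      unfolding b_def perm_mat_comp[OF s w] using pc uc v'c vc
      by (simp add: mat_assoc[where n = n])
    also have "\<dots> = p * ((u * v) * perm_mat n w)"
      using vc uc simple_refl_square[OF i] mult_carrier_mat[OF vc perm_mat_carrier[of n w]]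
      by (simp add: mat_assoc[where n = n])
    also have "u * v = 1\<^sub>m n" unfolding u_def v_def using i by (intro elem_mat_inverse) auto
    finally show ?thesis using pc by (simp add: comp_def)
  qed
  moreover have "v' \<in> UT n" unfolding v'_def using len by (rule elem_mat_UT)
  ultimately have "p * perm_mat n w \<in> bruhat_cell n (?s \<circ> w)" unfolding bruhat_cell_def by blast
  then show ?thesis by blast
qed

text \<open>If the length condition fails for \<open>w\<close>, then it holds for the reflected permutation, and the
  reflection itself belongs to the parabolic subgroup.\<close>

lemma min_parabolic_mult_perm_mat:
  assumes p: "p \<in> min_parabolic n i" and i: "Suc i < n" and w: "w permutes {..<n}"
  shows "p * perm_mat n w \<in> bruhat_cell n w \<union> bruhat_cell n (simple_refl i \<circ> w)"
proof (cases "perm_inv w i < perm_inv w (Suc i)")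
  case True
  then show ?thesis using min_parabolic_mult_perm_mat_aux[OF assms] by blast
next
  case False
  let ?s = "simple_refl i"
  note s = simple_refl_permutes[OF i]
  note pc = GL_carrier[OF min_parabolic_GL[OF p]]
  have ne: "perm_inv w i \<noteq> perm_inv w (Suc i)" using permutes_inj[OF permutes_inv[OF w]] by (simp add: inj_eq)
  have v: "?s \<circ> w permutes {..<n}" using permutes_compose[OF w s] .
  have inv: "perm_inv (?s \<circ> w) k = perm_inv w (?s k)" for k
    using o_inv_distrib[of ?s w] permutes_bij[OF w] permutes_bij[OF s] by simp
  have "p * perm_mat n ?s * perm_mat n (?s \<circ> w) = p * (perm_mat n ?s * perm_mat n ?s * perm_mat n w)"
    unfolding perm_mat_comp[OF s w] using pc
    by (simp add: mat_assoc[where n = n])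
  then have "p * perm_mat n w = p * perm_mat n ?s * perm_mat n (?s \<circ> w)"
    using simple_refl_square[OF i] by simp
  moreover have "perm_inv (?s \<circ> w) i < perm_inv (?s \<circ> w) (Suc i)"
    using inv False ne by simp
  ultimately show ?thesis
    using min_parabolic_mult_perm_mat_aux[OF min_parabolic_mult_refl(1)[OF p i] i v] by auto
qed

lemma min_parabolic_mult_cell:
  assumes p: "p \<in> min_parabolic n i" and i: "Suc i < n" and w: "w permutes {..<n}"
    and g: "g \<in> bruhat_cell n w"
  shows "p * g \<in> bruhat_cell n w \<union> bruhat_cell n (simple_refl i \<circ> w)"
proof -
  obtain b c where bc: "b \<in> UT n" "c \<in> UT n" "g = b * perm_mat n w * c"
    using g by (auto simp: bruhat_cell_def)
  note C = UT_carrier[OF bc(1)] UT_carrier[OF bc(2)] GL_carrier[OF min_parabolic_GL[OF p]]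
  have "p * g = (p * b) * perm_mat n w * c"
    unfolding bc(3) using C by (simp add: mat_assoc[where n = n])
  moreover have "(p * b) * perm_mat n w \<in> bruhat_cell n w \<union> bruhat_cell n (simple_refl i \<circ> w)"
    using min_parabolic_mult_perm_mat[OF min_parabolic_mult_UT(1)[OF p bc(1)] i w] .
  moreover have "(p * b) * perm_mat n w \<in> carrier_mat n n" using C by (metis mult_carrier_mat perm_mat_carrier)
  ultimately show ?thesis using bruhat_cell_right[OF _ _ bc(2)] by auto
qed

lemma bruhat_cell_inverse:
  assumes w: "w permutes {..<n}" and g: "g \<in> bruhat_cell n w" and h: "h \<in> carrier_mat n n" "g * h = 1\<^sub>m n"
  shows "h \<in> bruhat_cell n (perm_inv w)"
proof -
  let ?v = "perm_mat n (perm_inv w)"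
  obtain b c where bc: "b \<in> UT n" "c \<in> UT n" "g = b * perm_mat n w * c"
    using g by (auto simp: bruhat_cell_def)
  obtain b' where b': "b' \<in> UT n" "b' * b = 1\<^sub>m n" using UT_inverse[OF bc(1)] by blast
  obtain c' where c': "c' \<in> UT n" "c' * c = 1\<^sub>m n" using UT_inverse[OF bc(2)] by blast
  note C = UT_carrier[OF bc(1)] UT_carrier[OF bc(2)] UT_carrier[OF b'(1)] UT_carrier[OF c'(1)]
  have "(c' * ?v * b') * g = c' * (?v * ((b' * b) * perm_mat n w) * c)"
    unfolding bc(3) using C by (simp add: mat_assoc[where n = n])
  also have "\<dots> = 1\<^sub>m n" using b'(2) c'(2) C(2) perm_mat_inverse(2)[OF w] by simp
  finally have inv: "(c' * ?v * b') * g = 1\<^sub>m n" .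
  have vc: "c' * ?v * b' \<in> carrier_mat n n" and gc: "g \<in> carrier_mat n n"
    using C bc(3) by (auto simp: mat_assoc[where n = n])
  have "c' * ?v * b' = ((c' * ?v * b') * g) * h"
    using assoc_mult_mat[OF vc gc h(1)] h(2) right_mult_one_mat[OF vc] by simp
  then have "h = c' * ?v * b'" unfolding inv using h(1) by simp
  then show ?thesis using b'(1) c'(1) unfolding bruhat_cell_def by blast
qed

text \<open>A parabolic element lies in the cell of the identity or in that of the reflection. Both cells are
  contained in the parabolic subgroup and closed under inversion.\<close>

lemma min_parabolic_inverse:
  assumes p: "p \<in> min_parabolic n i" and i: "Suc i < n" and h: "h \<in> carrier_mat n n" "p * h = 1\<^sub>m n"
  shows "h \<in> min_parabolic n i"
proof -
  let ?s = "simple_refl i"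
  note s = simple_refl_permutes[OF i] and id = permutes_id[of "{..<n}"]
  have "p \<in> bruhat_cell n id \<union> bruhat_cell n (?s \<circ> id)"
    using min_parabolic_mult_perm_mat[OF p i id] GL_carrier[OF min_parabolic_GL[OF p]] by (simp only: perm_mat_id right_mult_one_mat)
  then have "h \<in> bruhat_cell n id \<union> bruhat_cell n ?s"
    using bruhat_cell_inverse[OF id _ h] bruhat_cell_inverse[OF s _ h] by (simp only: comp_id inv_id perm_inv_simple_refl Un_iff) blast
  then obtain b c where bc: "b \<in> UT n" "c \<in> UT n"
    and "h = b * perm_mat n id * c \<or> h = b * perm_mat n ?s * c"
    unfolding bruhat_cell_def by blast
  moreover have "b * perm_mat n id \<in> min_parabolic n i"
    unfolding perm_mat_id using bc(1) UT_carrier[OF bc(1)] UT_subset_min_parabolic by auto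
  moreover have "b * perm_mat n ?s \<in> min_parabolic n i"
    using min_parabolic_mult_refl(1)[OF _ i] bc(1) UT_subset_min_parabolic by blast
  ultimately show ?thesis using min_parabolic_mult_UT(1)[OF _ bc(2)] by metis
qed

lemma perm_inv_simple_refl_comp:
  assumes w: "w permutes {..<n}"
  shows "perm_inv (simple_refl i \<circ> w) = perm_inv w \<circ> simple_refl i"
proof -
  have "bij (simple_refl i)" by (simp add: simple_refl_def)
  then show ?thesis using o_inv_distrib[OF _ permutes_bij[OF w], of "simple_refl i"] by simp
qed

text \<open>Inversion exchanges left and right multiplication, so the mirror image of
  \<open>min_parabolic_mult_cell\<close> needs no second elimination.\<close>

lemma cell_mult_min_parabolic:
  assumes p: "p \<in> min_parabolic n i" and i: "Suc i < n" and w: "w permutes {..<n}"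
    and g: "g \<in> bruhat_cell n w"
  shows "g * p \<in> bruhat_cell n w \<union> bruhat_cell n (w \<circ> simple_refl i)"
proof -
  let ?s = "simple_refl i"
  note s = simple_refl_permutes[OF i] and v = permutes_inv[OF w]
  have sv: "?s \<circ> perm_inv w permutes {..<n}" by (rule permutes_compose[OF v s])
  obtain p' where p': "p' \<in> GL n" "p * p' = 1\<^sub>m n" "p' * p = 1\<^sub>m n" using GL_inverse[OF min_parabolic_GL[OF p]] .
  obtain g' where g': "g' \<in> GL n" "g * g' = 1\<^sub>m n" "g' * g = 1\<^sub>m n" using GL_inverse[OF bruhat_cell_GL[OF w g]] .
  note C = GL_carrier[OF p'(1)] GL_carrier[OF g'(1)] GL_carrier[OF min_parabolic_GL[OF p]]
    GL_carrier[OF bruhat_cell_GL[OF w g]]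
  have "p' * g' \<in> bruhat_cell n (perm_inv w) \<union> bruhat_cell n (?s \<circ> perm_inv w)"
    by (rule min_parabolic_mult_cell[OF min_parabolic_inverse[OF p i C(1) p'(2)] i v
          bruhat_cell_inverse[OF w g C(2) g'(2)]])
  moreover have "(p' * g') * (g * p) = p' * ((g' * g) * p)" using C by (simp add: mat_assoc[where n = n])
  then have "(p' * g') * (g * p) = 1\<^sub>m n" using g'(3) p'(3) C by simp
  ultimately have "g * p \<in> bruhat_cell n (perm_inv (perm_inv w)) \<union> bruhat_cell n (perm_inv (?s \<circ> perm_inv w))"
    using bruhat_cell_inverse[OF v _ mult_carrier_mat[OF C(4,3)]] bruhat_cell_inverse[OF sv _ mult_carrier_mat[OF C(4,3)]]
    by blast
  then show ?thesis
    unfolding perm_inv_simple_refl_comp[OF v] inv_inv_eq[OF permutes_bij[OF w]] .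
qed

section \<open>The Borel subgroup of the smaller group\<close>

text \<open>This describes the image of the embedding of the smaller group without mentioning the embedded
  block: the last row and the last column are those of the identity.\<close>

definition last_trivial :: "nat \<Rightarrow> complex mat \<Rightarrow> bool" where
  "last_trivial n g \<longleftrightarrow> (\<forall>j<n - 1. g $$ (j, n - 1) = 0 \<and> g $$ (n - 1, j) = 0) \<and> g $$ (n - 1, n - 1) = 1"

lemma embed_K_index:
  assumes "x \<in> carrier_mat (n - 1) (n - 1)" "r < n" "c < n"
  shows "embed_K x $$ (r, c) = (if r < n - 1 \<and> c < n - 1 then x $$ (r, c) else if r = c then 1 else 0)"
  using assms by (auto simp: embed_K_def)

lemma embed_K_carrier:
  assumes "x \<in> carrier_mat (n - 1) (n - 1)" "0 < n"
  shows "embed_K x \<in> carrier_mat n n"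
  using assms by (auto simp: embed_K_def)

lemma embed_K_GL:
  assumes x: "x \<in> carrier_mat (n - 1) (n - 1)" and n: "0 < n"
  shows "embed_K x \<in> GL n \<longleftrightarrow> x \<in> GL (n - 1)"
proof -
  have "det (embed_K x) = det x * det (1\<^sub>m 1 :: complex mat)"
    unfolding embed_K_def
    by (rule det_four_block_mat_lower_left_zero[where n = "n - 1" and m = 1]) (use x in auto)
  then show ?thesis using x embed_K_carrier[OF x n] by (auto simp: GL_iff_det)
qed

lemma embed_K_last_trivial:
  "x \<in> carrier_mat (n - 1) (n - 1) \<Longrightarrow> 0 < n \<Longrightarrow> last_trivial n (embed_K x)"
  by (auto simp: last_trivial_def embed_K_index)

lemma last_trivial_embed_K:
  assumes g: "g \<in> carrier_mat n n" "last_trivial n g" and n: "0 < n"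
  shows "g = embed_K (mat (n - 1) (n - 1) (\<lambda>ij. g $$ ij))"
proof (rule eq_matI)
  let ?x = "mat (n - 1) (n - 1) (\<lambda>ij. g $$ ij)"
  have x: "?x \<in> carrier_mat (n - 1) (n - 1)" by simp
  fix r c assume "r < dim_row (embed_K ?x)" "c < dim_col (embed_K ?x)"
  then have rc: "r < n" "c < n" using embed_K_carrier[OF x n] by auto
  then consider "r < n - 1" "c < n - 1" | "r = n - 1" "c < n - 1" | "r < n - 1" "c = n - 1" | "r = n - 1" "c = n - 1"
    by linarith
  then show "g $$ (r, c) = embed_K ?x $$ (r, c)"
    unfolding embed_K_index[OF x rc] using g(2) by cases (auto simp: last_trivial_def)
qed (use g(1) n in \<open>auto simp: embed_K_def\<close>)

lemma borel_K_iff: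
  assumes n: "0 < n"
  shows "g \<in> borel_K n \<longleftrightarrow> g \<in> UT n \<and> last_trivial n g"
proof
  assume "g \<in> borel_K n"
  then obtain x where x: "x \<in> GL (n - 1)" "upper_triangular x" "g = embed_K x"
    by (auto simp: borel_K_def)
  note xc = GL_carrier[OF x(1)]
  have "upper_triangular g"
  proof (rule upper_triangularI)
    fix r c assume rc: "c < r" "r < dim_row g"
    then have "r < n" using embed_K_carrier[OF xc n] x(3) by auto
    then show "g $$ (r, c) = 0"
      using rc x(3) xc upper_triangularD[OF x(2), of c r] by (auto simp: embed_K_index[OF xc])
  qed
  then show "g \<in> UT n \<and> last_trivial n g"
    using x embed_K_GL[OF xc n] embed_K_last_trivial[OF xc n] by (simp add: UT_def)
next
  assume g: "g \<in> UT n \<and> last_trivial n g"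
  define x where "x = mat (n - 1) (n - 1) (\<lambda>ij. g $$ ij)"
  have xc: "x \<in> carrier_mat (n - 1) (n - 1)" by (simp add: x_def)
  have e: "g = embed_K x" unfolding x_def using last_trivial_embed_K g n UT_carrier by blast
  have "x \<in> GL (n - 1)" using e g embed_K_GL[OF xc n] UT_GL by auto
  moreover have "upper_triangular x"
    using g by (auto simp: x_def UT_zero)
  ultimately show "g \<in> borel_K n" unfolding borel_K_def e by blast
qed

lemma min_parabolic_K_iff:
  assumes i: "Suc i < n - 1"
  shows "g \<in> min_parabolic_K n i \<longleftrightarrow> g \<in> min_parabolic n i \<and> last_trivial n g"
proof
  have n: "0 < n" using i by simp
  {
    assume "g \<in> min_parabolic_K n i"
    then obtain x where x: "x \<in> min_parabolic (n - 1) i" "g = embed_K x"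
      by (auto simp: min_parabolic_K_def)
    note xc = GL_carrier[OF min_parabolic_GL[OF x(1)]]
    have "g \<in> min_parabolic n i"
    proof (rule min_parabolicI)
      show "g \<in> GL n" using x embed_K_GL[OF xc n] min_parabolic_GL by simp
      fix r c assume "c < r" "r < n" "(r, c) \<noteq> (Suc i, i)"
      then show "g $$ (r, c) = 0"
        using x(2) min_parabolic_zero[OF x(1), of c r] by (auto simp: embed_K_index[OF xc])
    qed
    then show "g \<in> min_parabolic n i \<and> last_trivial n g" using x embed_K_last_trivial[OF xc n] by simp
  }
  assume g: "g \<in> min_parabolic n i \<and> last_trivial n g"
  define x where "x = mat (n - 1) (n - 1) (\<lambda>ij. g $$ ij)"
  have xc: "x \<in> carrier_mat (n - 1) (n - 1)" by (simp add: x_def)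
  have gG: "g \<in> GL n" using g min_parabolic_GL by blast
  have e: "g = embed_K x" unfolding x_def using last_trivial_embed_K g n GL_carrier[OF gG] by blast
  have "x \<in> GL (n - 1)" using e gG embed_K_GL[OF xc n] by auto
  then have "x \<in> min_parabolic (n - 1) i"
    using g min_parabolic_zero[of g n i] by (intro min_parabolicI) (auto simp: x_def)
  then show "g \<in> min_parabolic_K n i" unfolding min_parabolic_K_def e by blast
qed

lemma last_trivial_mult:
  assumes A: "A \<in> carrier_mat n n" and B: "B \<in> carrier_mat n n" and n: "0 < n" and r: "r < n"
  shows "last_trivial n B \<Longrightarrow> (A * B) $$ (r, n - 1) = A $$ (r, n - 1)"
    and "last_trivial n A \<Longrightarrow> (A * B) $$ (n - 1, r) = B $$ (n - 1, r)"
proof -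
  have n1: "n - 1 < n" using n by simp
  assume B1: "last_trivial n B"
  have "(A * B) $$ (r, n - 1) = (\<Sum>k<n. A $$ (r, k) * B $$ (k, n - 1))"
    by (rule mult_mat_index[OF A B r n1])
  also have "\<dots> = (\<Sum>k<n. if k = n - 1 then A $$ (r, n - 1) else 0)"
    by (rule sum.cong) (use B1 in \<open>auto simp: last_trivial_def\<close>)
  finally show "(A * B) $$ (r, n - 1) = A $$ (r, n - 1)" using n1 by simp
next
  have n1: "n - 1 < n" using n by simp
  assume A1: "last_trivial n A"
  have "(A * B) $$ (n - 1, r) = (\<Sum>k<n. A $$ (n - 1, k) * B $$ (k, r))"
    by (rule mult_mat_index[OF A B n1 r])
  also have "\<dots> = (\<Sum>k<n. if k = n - 1 then B $$ (n - 1, r) else 0)"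
    by (rule sum.cong) (use A1 in \<open>auto simp: last_trivial_def\<close>)
  finally show "(A * B) $$ (n - 1, r) = B $$ (n - 1, r)" using n1 by simp
qed

lemma last_trivial_closed:
  assumes "A \<in> carrier_mat n n" "B \<in> carrier_mat n n" "0 < n" "last_trivial n A" "last_trivial n B"
  shows "last_trivial n (A * B)"
  unfolding last_trivial_def
  using assms(3-5) last_trivial_mult[OF assms(1-3)] by (auto simp: last_trivial_def)

lemma borel_K_UT: "0 < n \<Longrightarrow> k \<in> borel_K n \<Longrightarrow> k \<in> UT n"
  by (simp add: borel_K_iff)

lemma one_borel_K: "0 < n \<Longrightarrow> 1\<^sub>m n \<in> borel_K n"
  by (auto simp: borel_K_iff one_UT last_trivial_def)

lemma mult_borel_K: "0 < n \<Longrightarrow> k \<in> borel_K n \<Longrightarrow> l \<in> borel_K n \<Longrightarrow> k * l \<in> borel_K n"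
  by (simp add: borel_K_iff mult_UT last_trivial_closed UT_carrier)

lemma borel_K_inverse:
  assumes n: "0 < n" and k: "k \<in> borel_K n"
  obtains l where "l \<in> borel_K n" "k * l = 1\<^sub>m n" "l * k = 1\<^sub>m n"
proof -
  have kU: "k \<in> UT n" and kl: "last_trivial n k" using k n by (auto simp: borel_K_iff)
  obtain l where l: "l \<in> UT n" "k * l = 1\<^sub>m n" "l * k = 1\<^sub>m n" using UT_inverse[OF kU] by blast
  have "last_trivial n l"
    using last_trivial_mult(1)[OF UT_carrier[OF l(1)] UT_carrier[OF kU] n _ kl, unfolded l(3), symmetric]
      UT_zero[OF l(1)] n
    by (auto simp: last_trivial_def)
  then show thesis using l that n by (simp add: borel_K_iff)
qed

text \<open>The orbit relation of the small Borel subgroup on flags, lifted to matrices.\<close>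

definition same_orbit :: "nat \<Rightarrow> complex mat \<Rightarrow> complex mat \<Rightarrow> bool" where
  "same_orbit n g h \<longleftrightarrow> (\<exists>k\<in>borel_K n. \<exists>c\<in>UT n. h = k * g * c)"

lemma same_orbitI: "k \<in> borel_K n \<Longrightarrow> c \<in> UT n \<Longrightarrow> h = k * g * c \<Longrightarrow> same_orbit n g h"
  by (auto simp: same_orbit_def)

lemma same_orbit_sym:
  assumes n: "0 < n" and g: "g \<in> carrier_mat n n" and e: "same_orbit n g h"
  shows "same_orbit n h g"
proof -
  obtain k c where kc: "k \<in> borel_K n" "c \<in> UT n" "h = k * g * c" using e by (auto simp: same_orbit_def)
  obtain l where l: "l \<in> borel_K n" "l * k = 1\<^sub>m n" using borel_K_inverse[OF n kc(1)] by blast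
  obtain d where d: "d \<in> UT n" "c * d = 1\<^sub>m n" using UT_inverse[OF kc(2)] by blast
  note C = UT_carrier[OF kc(2)] UT_carrier[OF d(1)] UT_carrier[OF borel_K_UT[OF n kc(1)]]
    UT_carrier[OF borel_K_UT[OF n l(1)]]
  have "l * h * d = (l * k) * g * (c * d)"
    unfolding kc(3) using C g by (simp add: mat_assoc[where n = n])
  then have "g = l * h * d" using l d g by simp
  then show ?thesis using l d by (intro same_orbitI)
qed

lemma same_orbit_trans:
  assumes n: "0 < n" and g: "g \<in> carrier_mat n n" and e: "same_orbit n g h" "same_orbit n h f"
  shows "same_orbit n g f"
proof -
  obtain k c where kc: "k \<in> borel_K n" "c \<in> UT n" "h = k * g * c" using e(1) by (auto simp: same_orbit_def)
  obtain l d where ld: "l \<in> borel_K n" "d \<in> UT n" "f = l * h * d" using e(2) by (auto simp: same_orbit_def)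
  note C = UT_carrier[OF kc(2)] UT_carrier[OF ld(2)] UT_carrier[OF borel_K_UT[OF n kc(1)]]
    UT_carrier[OF borel_K_UT[OF n ld(1)]]
  have "f = (l * k) * g * (c * d)"
    unfolding kc(3) ld(3) using C g
    by (simp add: mat_assoc[where n = n])
  then show ?thesis using mult_borel_K[OF n ld(1) kc(1)] mult_UT[OF kc(2) ld(2)] by (intro same_orbitI)
qed

section \<open>The second Bruhat decomposition\<close>

lemma sigma_permutes: "sigma n permutes {..<n}"
proof (rule bij_imp_permutes)
  show "bij_betw (sigma n) {..<n} {..<n}"
    by (rule bij_betw_byWitness[where f' = "\<lambda>i. if i = n - 1 then 0 else Suc i"])
      (auto simp: sigma_def)
qed (auto simp: sigma_def)

text \<open>Multiplication by this matrix carries the second base flag to the first one. The second Bruhat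
  decomposition of \<open>g\<close> thereby becomes the first one of \<^term>\<open>star_shift n * g\<close>.\<close>

definition star_shift :: "nat \<Rightarrow> complex mat" where
  "star_shift n = perm_mat n (perm_inv (sigma n))"

lemma star_shift_carrier [simp]: "star_shift n \<in> carrier_mat n n"
  by (simp add: star_shift_def)

lemma star_shift_GL: "star_shift n \<in> GL n"
  unfolding star_shift_def by (rule perm_mat_GL[OF permutes_inv[OF sigma_permutes]])

lemma star_shift_inverse:
  "star_shift n * perm_mat n (sigma n) = 1\<^sub>m n" "perm_mat n (sigma n) * star_shift n = 1\<^sub>m n"
  unfolding star_shift_def using perm_mat_inverse[OF sigma_permutes] by auto

lemma star_shift_mult_index:
  assumes "A \<in> carrier_mat n n" "i < n" "j < n"
  shows "(star_shift n * A) $$ (i, j) = A $$ (sigma n i, j)"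
  unfolding star_shift_def
  using perm_mat_mult_index[OF permutes_inv[OF sigma_permutes] assms]
    inv_inv_eq[OF permutes_bij[OF sigma_permutes]] by simp

lemma star_conj_index:
  assumes "A \<in> carrier_mat n n" "i < n" "j < n"
  shows "(star_shift n * A * perm_mat n (sigma n)) $$ (i, j) = A $$ (sigma n i, sigma n j)"
  using assms permutes_lt[OF sigma_permutes] mult_carrier_mat[OF star_shift_carrier assms(1)]
  by (simp add: mult_perm_mat_index[OF sigma_permutes] star_shift_mult_index)

lemma star_conj_borel_K:
  assumes n: "0 < n" and k: "k \<in> borel_K n"
  shows "star_shift n * k * perm_mat n (sigma n) \<in> UT n"
proof (rule UT_I)
  have kU: "k \<in> UT n" and kl: "last_trivial n k" using k n by (auto simp: borel_K_iff)
  note kc = UT_carrier[OF kU]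
  show "star_shift n * k * perm_mat n (sigma n) \<in> carrier_mat n n"
    using kc by (metis mult_carrier_mat perm_mat_carrier star_shift_carrier)
  fix i
  show "i < n \<Longrightarrow> (star_shift n * k * perm_mat n (sigma n)) $$ (i, i) \<noteq> 0"
    using UT_diag[OF kU] permutes_lt[OF sigma_permutes] by (simp add: star_conj_index[OF kc])
  fix j assume ij: "j < i" "i < n"
  have "k $$ (sigma n i, sigma n j) = 0"
  proof (cases "j = 0")
    case True
    then show ?thesis using ij kl by (auto simp: last_trivial_def sigma_def)
  next
    case False
    then show ?thesis using ij UT_zero[OF kU, of "j - 1" "i - 1"] by (auto simp: sigma_def)
  qed
  then show "(star_shift n * k * perm_mat n (sigma n)) $$ (i, j) = 0"
    using ij by (simp add: star_conj_index[OF kc])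
qed

lemma star_shift_pull:
  assumes "A \<in> carrier_mat n n" "g \<in> carrier_mat n n"
  shows "star_shift n * (A * g) = (star_shift n * A * perm_mat n (sigma n)) * (star_shift n * g)"
proof -
  have "(star_shift n * A * perm_mat n (sigma n)) * (star_shift n * g)
      = star_shift n * (A * ((perm_mat n (sigma n) * star_shift n) * g))"
    using assms by (simp add: mat_assoc[where n = n])
  then show ?thesis using star_shift_inverse(2) assms by simp
qed

lemma star_cell_same_orbit:
  assumes n: "0 < n" and g: "g \<in> carrier_mat n n" "star_shift n * g \<in> bruhat_cell n u" and e: "same_orbit n g h"
  shows "star_shift n * h \<in> bruhat_cell n u"
proof -
  obtain k c where kc: "k \<in> borel_K n" "c \<in> UT n" "h = k * g * c" using e by (auto simp: same_orbit_def)
  note C = UT_carrier[OF borel_K_UT[OF n kc(1)]] UT_carrier[OF kc(2)]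
  have "star_shift n * h = (star_shift n * (k * g)) * c"
    unfolding kc(3) using C g(1) by (simp add: mat_assoc[where n = n])
  then show ?thesis
    using bruhat_cell_mult_UT[OF g(2) star_conj_borel_K[OF n kc(1)] kc(2)] star_shift_pull[OF C(1) g(1)] by simp
qed

lemma cell_same_orbit:
  assumes n: "0 < n" and g: "g \<in> bruhat_cell n w" and e: "same_orbit n g h"
  shows "h \<in> bruhat_cell n w"
  using e bruhat_cell_mult_UT[OF g] borel_K_UT[OF n] by (auto simp: same_orbit_def)

section \<open>An orbit is determined by its two cells\<close>

text \<open>Up to the small Borel subgroup and scalars, an upper triangular matrix is determined by its last
  column. Multiplication by a permutation matrix moves this column to the position of the pivot of
  the last row.\<close>

definition normal_mat :: "nat \<Rightarrow> (nat \<Rightarrow> nat) \<Rightarrow> (nat \<Rightarrow> complex) \<Rightarrow> complex mat" where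
  "normal_mat n w x = mat n n (\<lambda>(r, c). (if r = w c then 1 else 0)
    + (if c = perm_inv w (n - 1) \<and> r < n - 1 then x r else 0))"

lemma normal_mat_carrier [simp]: "normal_mat n w x \<in> carrier_mat n n"
  by (simp add: normal_mat_def)

definition shear :: "nat \<Rightarrow> (nat \<Rightarrow> complex) \<Rightarrow> complex mat" where
  "shear n x = mat n n (\<lambda>(r, c). (if r = c then 1 else 0) + (if c = n - 1 \<and> r < n - 1 then x r else 0))"

lemma shear_UT: "shear n x \<in> UT n"
  by (rule UT_I) (auto simp: shear_def)

lemma normal_mat_factor:
  assumes w: "w permutes {..<n}"
  shows "normal_mat n w x = shear n x * perm_mat n w"
proof (rule sym, rule eq_matI)
  fix r l assume "r < dim_row (normal_mat n w x)" "l < dim_col (normal_mat n w x)"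
  then have rl: "r < n" "l < n" by (auto simp: normal_mat_def)
  have "w l = n - 1 \<longleftrightarrow> l = perm_inv w (n - 1)" using permutes_inv_eq[OF w, of "n - 1" l] by auto
  then show "(shear n x * perm_mat n w) $$ (r, l) = normal_mat n w x $$ (r, l)"
    using mult_perm_mat_index[OF w UT_carrier[OF shear_UT] rl] permutes_lt[OF w rl(2)] rl
    by (auto simp: shear_def normal_mat_def)
qed (auto simp: normal_mat_def perm_mat_def shear_def)

text \<open>An upper triangular matrix that carries \<open>g\<close> to a permutation matrix is a product of a scalar, an
  element of the small Borel subgroup and a matrix that differs from the identity in its last
  column.\<close>

lemma cell_normal_form:
  assumes n: "0 < n" and w: "w permutes {..<n}" and g: "g \<in> bruhat_cell n w"
  obtains x where "same_orbit n g (normal_mat n w x)"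
proof -
  have gG: "g \<in> GL n" using bruhat_cell_GL[OF w g] .
  note gc = GL_carrier[OF gG]
  obtain b c where bc: "b \<in> UT n" "c \<in> UT n" "perm_mat n w = b * g * c"
    using bruhat_cell_representative[OF g] .
  note C = UT_carrier[OF bc(1)] UT_carrier[OF bc(2)]
  have n1: "n - 1 < n" using n by simp
  define d where "d = b $$ (n - 1, n - 1)"
  have d: "d \<noteq> 0" unfolding d_def using UT_diag[OF bc(1) n1] .
  define k where "k = mat n n (\<lambda>(r, c). if r < n - 1 \<and> c < n - 1 then b $$ (r, c) / d else if r = c then 1 else 0)"
  have "k \<in> UT n"
    by (rule UT_I) (use UT_zero[OF bc(1)] UT_diag[OF bc(1)] d in \<open>auto simp: k_def\<close>)
  then have k: "k \<in> borel_K n" using n by (auto simp: borel_K_iff k_def last_trivial_def)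
  note kc = UT_carrier[OF borel_K_UT[OF n k]]
  define x where "x r = - b $$ (r, n - 1) / d" for r
  define A where "A = shear n x"
  have Ac: "A \<in> carrier_mat n n" unfolding A_def by (rule UT_carrier[OF shear_UT])
  have Ab: "A * b = d \<cdot>\<^sub>m k"
  proof (rule eq_matI)
    fix r l assume "r < dim_row (d \<cdot>\<^sub>m k)" "l < dim_col (d \<cdot>\<^sub>m k)"
    then have rl: "r < n" "l < n" using kc by auto
    have "(A * b) $$ (r, l) = (\<Sum>m<n. A $$ (r, m) * b $$ (m, l))" by (rule mult_mat_index[OF Ac C(1) rl])
    also have "\<dots> = (\<Sum>m<n. (if m = r then b $$ (r, l) else 0)
        + (if m = n - 1 then if r < n - 1 then x r * b $$ (n - 1, l) else 0 else 0))"
      by (rule sum.cong) (use rl in \<open>auto simp: A_def shear_def algebra_simps\<close>)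
    also have "\<dots> = b $$ (r, l) + (if r < n - 1 then x r * b $$ (n - 1, l) else 0)"
      using rl n1 by (simp add: sum.distrib)
    also have "\<dots> = (d \<cdot>\<^sub>m k) $$ (r, l)"
    proof (cases "l < n - 1")
      case True
      then have "b $$ (n - 1, l) = 0" using UT_zero[OF bc(1) _ n1] by blast
      moreover have "r = n - 1" if "\<not> r < n - 1" using that rl by linarith
      ultimately show ?thesis using True rl d kc by (auto simp: k_def)
    next
      case False
      then have l: "l = n - 1" using rl by linarith
      have "r = n - 1" if "\<not> r < n - 1" using that rl by linarith
      then show ?thesis using l rl d n1 kc by (auto simp: k_def x_def d_def)
    qed
    finally show "(A * b) $$ (r, l) = (d \<cdot>\<^sub>m k) $$ (r, l)" .
  qed (use Ac C kc in auto)
  have "normal_mat n w x = (A * b) * g * c"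
    unfolding normal_mat_factor[OF w] A_def[symmetric] bc(3) using C gc Ac
    by (simp add: mat_assoc[where n = n])
  also have "\<dots> = k * g * (d \<cdot>\<^sub>m c)"
    unfolding Ab using kc gc C(2)
    by (simp add: mult_smult_assoc_mat[of _ n n _ n] mult_smult_distrib[of _ n n _ n] mult_carrier_mat[of _ n n _ n])
  finally show thesis using that same_orbitI[OF k smult_UT[OF bc(2) d]] by blast
qed

abbreviation char_fun :: "nat set \<Rightarrow> nat \<Rightarrow> complex" where
  "char_fun M \<equiv> \<lambda>m. of_bool (m \<in> M)"

text \<open>Only entries whose pivot position lies to the right of the pivot of the last row matter: the
  columns before that pivot clear the other entries.\<close>

definition right_support :: "nat \<Rightarrow> (nat \<Rightarrow> nat) \<Rightarrow> (nat \<Rightarrow> complex) \<Rightarrow> nat set" where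
  "right_support n w x = {m. m < n - 1 \<and> x m \<noteq> 0 \<and> perm_inv w (n - 1) < perm_inv w m}"

text \<open>A matrix unit in row \<open>i\<close> and column \<open>m\<close> is upper triangular and remains so after conjugation by \<open>w\<close>
  exactly under this condition.\<close>

definition dominated :: "(nat \<Rightarrow> nat) \<Rightarrow> nat \<Rightarrow> nat \<Rightarrow> bool" where
  "dominated w i m \<longleftrightarrow> i \<le> m \<and> perm_inv w i \<le> perm_inv w m"

definition peaks :: "nat \<Rightarrow> (nat \<Rightarrow> nat) \<Rightarrow> (nat \<Rightarrow> complex) \<Rightarrow> nat set" where
  "peaks n w x = {m \<in> right_support n w x. \<forall>m'\<in>right_support n w x. dominated w m m' \<longrightarrow> m' = m}"

lemma dominated_refl: "dominated w i i"
  by (simp add: dominated_def)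

lemma dominated_trans: "dominated w i j \<Longrightarrow> dominated w j k \<Longrightarrow> dominated w i k"
  by (auto simp: dominated_def)

lemma dominated_antisym: "dominated w i j \<Longrightarrow> dominated w j i \<Longrightarrow> i = j"
  by (auto simp: dominated_def)

lemma ex_peak:
  assumes "i \<in> right_support n w x"
  shows "\<exists>m\<in>peaks n w x. dominated w i m"
proof -
  have fin: "finite {m \<in> right_support n w x. dominated w i m}" by (simp add: right_support_def)
  have ne: "i \<in> {m \<in> right_support n w x. dominated w i m}" using assms dominated_refl by blast
  define m where "m = Max {m \<in> right_support n w x. dominated w i m}"
  have m: "m \<in> right_support n w x" "dominated w i m" using Max_in[OF fin] ne unfolding m_def by blast+
  have "m' = m" if "m' \<in> right_support n w x" "dominated w m m'" for m'
  proof -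
    have "m' \<le> m" using Max_ge[OF fin, of m'] that m dominated_trans unfolding m_def by blast
    then show ?thesis using that(2) by (simp add: dominated_def)
  qed
  then show ?thesis using m by (auto simp: peaks_def)
qed

lemma peaks_eq:
  assumes "\<And>m. m \<in> right_support n w x \<Longrightarrow> \<exists>m'\<in>right_support n w y. dominated w m m'"
    and "\<And>m. m \<in> right_support n w y \<Longrightarrow> \<exists>m'\<in>right_support n w x. dominated w m m'"
  shows "peaks n w x = peaks n w y"
proof -
  have "peaks n w x \<subseteq> peaks n w y"
    if xy: "\<And>m. m \<in> right_support n w x \<Longrightarrow> \<exists>m'\<in>right_support n w y. dominated w m m'"
      and yx: "\<And>m. m \<in> right_support n w y \<Longrightarrow> \<exists>m'\<in>right_support n w x. dominated w m m'" for x y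
  proof
    fix m assume m: "m \<in> peaks n w x"
    have max: "m' = m" if "m' \<in> right_support n w y" "dominated w m m'" for m'
    proof -
      obtain m'' where "m'' \<in> right_support n w x" "dominated w m' m''" using yx \<open>m' \<in> right_support n w y\<close> by blast
      moreover from this have "m'' = m" using m dominated_trans[OF \<open>dominated w m m'\<close>] by (auto simp: peaks_def)
      ultimately show "m' = m" using dominated_antisym \<open>dominated w m m'\<close> by blast
    qed
    obtain m' where "m' \<in> right_support n w y" "dominated w m m'" using xy m by (auto simp: peaks_def)
    then show "m \<in> peaks n w y" using max by (auto simp: peaks_def)
  qed
  then show ?thesis using assms by blast
qed

context
  fixes n :: nat and w :: "nat \<Rightarrow> nat"
  assumes n: "0 < n" and w: "w permutes {..<n}"
begin

abbreviation (input) "pivot \<equiv> perm_inv w (n - 1)"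

lemma inv_eq_pivot_iff: "r < n \<Longrightarrow> perm_inv w r = pivot \<longleftrightarrow> r = n - 1"
  using permutes_inj[OF permutes_inv[OF w]] by (simp add: inj_eq)

lemma eq_pivot_iff: "c = pivot \<longleftrightarrow> w c = n - 1"
  using permutes_inv_eq[OF w, of "n - 1" c] by auto

lemma pivot_lt: "pivot < n"
  using permutes_inv_lt[OF w, of "n - 1"] n by simp

lemma normal_mat_index:
  "r < n \<Longrightarrow> c < n \<Longrightarrow> normal_mat n w x $$ (r, c)
    = (if r = w c then 1 else 0) + (if c = pivot \<and> r < n - 1 then x r else 0)"
  by (simp add: normal_mat_def)

text \<open>A triangular matrix that subtracts from each entry a multiple of the peak above it stays
  triangular after conjugation by the permutation, because domination refers to both orders.
  It leaves the peaks and the entries to the left of the pivot; the latter are removed by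
  column operations.\<close>

lemma normal_mat_reduce: "same_orbit n (normal_mat n w x) (normal_mat n w (char_fun (peaks n w x)))"
proof -
  let ?S = "right_support n w x" and ?M = "peaks n w x"
  obtain \<mu> where \<mu>: "\<mu> i \<in> ?M" "dominated w i (\<mu> i)" if "i \<in> ?S" for i
    using ex_peak[of _ n w x] by metis
  have MS: "?M \<subseteq> ?S" by (auto simp: peaks_def)
  have S: "m < n - 1" "x m \<noteq> 0" "pivot < perm_inv w m" if "m \<in> ?S" for m
    using that by (auto simp: right_support_def)
  \<comment> \<open>Rows of peaks are scaled, and each other row of the right support is cleared by the peak chosen for it.\<close>
  define kf where "kf r c = (if r = c then if r \<in> ?M then 1 / x r else 1
    else if r \<in> ?S - ?M \<and> c = \<mu> r then - x r / x (\<mu> r) else 0)" for r c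
  define k where "k = mat n n (\<lambda>(r, c). kf r c)"
  have kf0: "dominated w r c" if "kf r c \<noteq> 0" for r c
    using that \<mu>[of r] dominated_refl by (auto simp: kf_def split: if_splits)
  have kfd: "kf r r \<noteq> 0" for r using MS S by (auto simp: kf_def)
  have "k \<in> UT n"
    by (rule UT_I) (use kf0 kfd in \<open>force simp: k_def dominated_def\<close>)+
  moreover have kl: "kf r (n - 1) = (if r = n - 1 then 1 else 0)" "kf (n - 1) r = (if r = n - 1 then 1 else 0)" for r
    using S(1)[of "n - 1"] MS S(1)[OF subsetD[OF MS \<mu>(1)[of r]]] by (auto simp: kf_def)
  ultimately have k: "k \<in> borel_K n"
    using n by (auto simp: borel_K_iff k_def last_trivial_def)
  \<comment> \<open>The conjugate of k by the permutation matrix.\<close>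
  define l where "l = mat n n (\<lambda>(a, b). kf (w a) (w b))"
  have l: "l \<in> UT n"
    by (rule UT_I) (use kf0 kfd permutes_inverses(2)[OF w] in \<open>force simp: l_def dominated_def\<close>)+
  define z where "z r = (if r \<in> ?M then 1 else if r \<in> ?S then 0 else x r)" for r
  have fin: "finite ?S" by (simp add: right_support_def)
  have kx: "(\<Sum>m<n - 1. kf r m * x m) = z r" if r: "r < n - 1" for r
  proof (cases "r \<in> ?S - ?M")
    case False
    have "(\<Sum>m<n - 1. kf r m * x m) = (\<Sum>m<n - 1. if m = r then kf r r * x r else 0)"
      by (rule sum.cong) (use False in \<open>auto simp: kf_def\<close>)
    then show ?thesis using r False MS S(2)[of r] by (auto simp: kf_def z_def)
  next
    case True
    then have m: "\<mu> r < n - 1" "x (\<mu> r) \<noteq> 0" "\<mu> r \<noteq> r" using \<mu>[of r] MS S by auto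
    have "(\<Sum>m<n - 1. kf r m * x m)
        = (\<Sum>m<n - 1. (if m = r then x r else 0) + (if m = \<mu> r then kf r (\<mu> r) * x (\<mu> r) else 0))"
      by (rule sum.cong) (use True m in \<open>auto simp: kf_def\<close>)
    then show ?thesis using r True m by (simp add: sum.distrib kf_def z_def)
  qed
  have wi: "w (perm_inv w r) = r" for r by (rule permutes_inverses(1)[OF w])
  have row_pos: "r = w m \<longleftrightarrow> m = perm_inv w r" for r m using permutes_inv_eq[OF w, of r m] by auto
  have kN: "k * normal_mat n w x = normal_mat n w z * l"
  proof (rule eq_matI)
    fix r c assume "r < dim_row (normal_mat n w z * l)" "c < dim_col (normal_mat n w z * l)"
    then have rc: "r < n" "c < n" by (auto simp: normal_mat_def l_def)
    have "(k * normal_mat n w x) $$ (r, c) = (\<Sum>m<n. k $$ (r, m) * normal_mat n w x $$ (m, c))"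
      using rc UT_carrier[OF borel_K_UT[OF n k]] by (intro mult_mat_index) auto
    also have "\<dots> = (\<Sum>m<n. (if m = w c then kf r (w c) else 0)
        + (if m < n - 1 then if c = pivot then kf r m * x m else 0 else 0))"
      by (rule sum.cong) (use rc in \<open>auto simp: normal_mat_index k_def algebra_simps\<close>)
    also have "\<dots> = kf r (w c) + (if c = pivot then \<Sum>m<n - 1. kf r m * x m else 0)"
      using permutes_lt[OF w rc(2)]
      by (auto simp: sum.distrib sum.If_cases intro!: sum.cong)
    also have "(\<Sum>m<n - 1. kf r m * x m) = (if r < n - 1 then z r else 0)"
    proof (cases "r < n - 1")
      case False
      then have "r = n - 1" using rc by linarith
      then show ?thesis using kl(2) by (auto intro!: sum.neutral)
    next
      case True
      then show ?thesis using kx[of r] by simp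
    qed
    finally have lhs: "(k * normal_mat n w x) $$ (r, c)
        = kf r (w c) + (if c = pivot \<and> r < n - 1 then z r else 0)" by simp
    have "(normal_mat n w z * l) $$ (r, c) = (\<Sum>m<n. normal_mat n w z $$ (r, m) * l $$ (m, c))"
      using rc UT_carrier[OF l] by (intro mult_mat_index) auto
    also have "\<dots> = (\<Sum>m<n. (if m = perm_inv w r then kf r (w c) else 0)
        + (if m = pivot then if r < n - 1 then z r * kf (n - 1) (w c) else 0 else 0))"
      by (rule sum.cong) (use rc inv_eq_pivot_iff[OF rc(1)] in \<open>auto simp: normal_mat_index l_def algebra_simps row_pos wi\<close>)
    also have "\<dots> = kf r (w c) + (if r < n - 1 then z r * kf (n - 1) (w c) else 0)"
      using pivot_lt permutes_inv_lt[OF w rc(1)] by (simp add: sum.distrib)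
    finally show "(k * normal_mat n w x) $$ (r, c) = (normal_mat n w z * l) $$ (r, c)"
      using lhs kl(2)[of "w c"] eq_pivot_iff[of c] by auto
  qed (auto simp: normal_mat_def k_def l_def)
  \<comment> \<open>Column operations with the columns before the pivot; they clear the entries outside the right support.\<close>
  define e where "e = mat n n (\<lambda>(a, b). (if a = b then 1 else 0) - (if b = pivot \<and> a < pivot then z (w a) else 0))"
  have e: "e \<in> UT n" by (rule UT_I) (auto simp: e_def)
  have Ne: "normal_mat n w z * e = normal_mat n w (char_fun ?M)"
  proof (rule eq_matI)
    fix r c assume "r < dim_row (normal_mat n w (char_fun ?M))" "c < dim_col (normal_mat n w (char_fun ?M))"
    then have rc: "r < n" "c < n" by (auto simp: normal_mat_def)
    have "(normal_mat n w z * e) $$ (r, c) = (\<Sum>m<n. normal_mat n w z $$ (r, m) * e $$ (m, c))"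
      using rc UT_carrier[OF e] by (intro mult_mat_index) auto
    also have "\<dots> = (\<Sum>m<n. (if m = c then normal_mat n w z $$ (r, c) else 0)
        - (if m = perm_inv w r then if c = pivot \<and> perm_inv w r < pivot then z r else 0 else 0))"
      by (rule sum.cong)
        (use rc inv_eq_pivot_iff[OF rc(1)] in \<open>auto simp: normal_mat_index e_def algebra_simps row_pos wi\<close>)
    also have "\<dots> = normal_mat n w z $$ (r, c) - (if c = pivot \<and> perm_inv w r < pivot then z r else 0)"
      using rc permutes_inv_lt[OF w rc(1)] by (simp add: sum_subtractf)
    also have "\<dots> = normal_mat n w (char_fun ?M) $$ (r, c)"
    proof (cases "r < n - 1")
      case True
      then have "perm_inv w r \<noteq> pivot" using inv_eq_pivot_iff[OF rc(1)] by simp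
      moreover have "r \<notin> ?M" if "perm_inv w r < pivot" using that MS S(3)[of r] by auto
      moreover have "z r = char_fun ?M r" if "pivot < perm_inv w r"
        using that True MS by (auto simp: z_def right_support_def)
      ultimately show ?thesis using rc True by (auto simp: normal_mat_index)
    next
      case False
      then have "r = n - 1" using rc by linarith
      then show ?thesis using rc by (auto simp: normal_mat_index)
    qed
    finally show "(normal_mat n w z * e) $$ (r, c) = normal_mat n w (char_fun ?M) $$ (r, c)" .
  qed (auto simp: normal_mat_def e_def)
  obtain l' where l': "l' \<in> UT n" "l * l' = 1\<^sub>m n" using UT_inverse[OF l] by blast
  have "k * normal_mat n w x * (l' * e) = (normal_mat n w z * l) * (l' * e)" unfolding kN ..
  also have "\<dots> = normal_mat n w z * ((l * l') * e)"
    using UT_carrier[OF l] UT_carrier[OF l'(1)] UT_carrier[OF e]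
    by (simp add: mat_assoc[where n = n])
  also have "\<dots> = normal_mat n w (char_fun ?M)"
    using Ne l'(2) UT_carrier[OF e] by simp
  finally show ?thesis by (rule same_orbitI[OF k mult_UT[OF l'(1) e] sym])
qed

end

lemma det_one_column:
  fixes M :: "complex mat"
  assumes j: "j < n" "\<xi> j \<noteq> 0"
    and M: "M \<in> carrier_mat n n"
      "\<And>k l. k < n \<Longrightarrow> l < n \<Longrightarrow> M $$ (k, l) = (if l = j then \<xi> k else if k = l then 1 else 0)"
  shows "det M \<noteq> 0"
proof
  assume "det M = 0"
  then obtain v where v: "v \<in> carrier_vec n" "v \<noteq> 0\<^sub>v n" "M *\<^sub>v v = 0\<^sub>v n"
    using det_0_iff_vec_prod_zero[OF M(1)] by blast
  have row: "(if k = j then 0 else v $ k) + \<xi> k * v $ j = 0" if k: "k < n" for k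
  proof -
    have "0 = (M *\<^sub>v v) $ k" using v(3) k by simp
    also have "\<dots> = (\<Sum>l<n. M $$ (k, l) * v $ l)"
      using M(1) v(1) k by (auto simp: scalar_prod_def atLeast0LessThan)
    also have "\<dots> = (\<Sum>l<n. (if l = k then if k = j then 0 else v $ k else 0) + (if l = j then \<xi> k * v $ j else 0))"
      by (rule sum.cong) (use k M(2) in auto)
    finally show ?thesis using k j by (simp add: sum.distrib)
  qed
  have "v $ j = 0" using row[OF j(1)] j(2) by simp
  then have "v $ k = 0" if "k < n" for k using row[OF that] that by (cases "k = j") auto
  then show False using v(1,2) by (metis carrier_vecD eq_vecI index_zero_vec)
qed

text \<open>If no entry of \<open>y\<close> dominated the entry \<open>m\<close> of \<open>x\<close>, then the submatrix on the rows from \<open>m\<close> to the last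
  row but one and on the columns before the pivot position of \<open>m\<close> would have smaller rank for \<open>y\<close> than
  for \<open>x\<close>: in the column that carries the added vector, the nonzero entry \<open>m\<close> is independent of the
  pivots, whereas all entries of \<open>y\<close> in these rows lie in rows of pivots. The second Borel subgroup does
  not change the rank, since among these rows it acts by triangular matrices and does not mix in the
  last row.\<close>

lemma star_cell_dominated:
  assumes n: "0 < n" and w: "w permutes {..<n}"
    and cells: "star_shift n * normal_mat n w x \<in> bruhat_cell n u"
      "star_shift n * normal_mat n w y \<in> bruhat_cell n u"
    and m: "m \<in> right_support n w x"
  shows "\<exists>m'\<in>right_support n w y. dominated w m m'"
proof (rule ccontr)
  assume neg: "\<not> (\<exists>m'\<in>right_support n w y. dominated w m m')"
  let ?S = "star_shift n" and ?X = "normal_mat n w x" and ?Y = "normal_mat n w y"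
    and ?T = "perm_mat n (sigma n)"
  define j where "j = perm_inv w (n - 1)"
  define i where "i = perm_inv w m"
  have mS: "m < n - 1" "x m \<noteq> 0" "j < i" using m by (auto simp: right_support_def i_def j_def)
  have jn: "j < n" unfolding j_def by (rule pivot_lt[OF n w])
  have i_n: "i < n" unfolding i_def using permutes_inv_lt[OF w] mS by simp
  have wi: "w i = m" and wj: "w j = n - 1" using permutes_inverses(1)[OF w] by (auto simp: i_def j_def)
  obtain b1 c1 where bc1: "b1 \<in> UT n" "c1 \<in> UT n" "perm_mat n u = b1 * (?S * ?Y) * c1"
    using bruhat_cell_representative[OF cells(2)] .
  obtain b2 c2 where bc2: "b2 \<in> UT n" "c2 \<in> UT n" "?S * ?X = b2 * perm_mat n u * c2"
    using cells(1) by (auto simp: bruhat_cell_def)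
  define b where "b = b2 * b1"
  define c where "c = c1 * c2"
  have b: "b \<in> UT n" and c: "c \<in> UT n" unfolding b_def c_def using bc1 bc2 mult_UT by auto
  note carriers = UT_carrier[OF b] UT_carrier[OF c] UT_carrier[OF bc1(1)] UT_carrier[OF bc1(2)]
    UT_carrier[OF bc2(1)] UT_carrier[OF bc2(2)]
  define \<beta> where "\<beta> = ?T * b * ?S"
  have \<beta>c: "\<beta> \<in> carrier_mat n n" unfolding \<beta>_def using carriers by (metis mult_carrier_mat perm_mat_carrier star_shift_carrier)
  have Yc: "?Y * c \<in> carrier_mat n n" using carriers by (metis mult_carrier_mat normal_mat_carrier)
  have SX: "?S * ?X = b * (?S * ?Y) * c"
    unfolding bc2(3) bc1(3) b_def c_def using carriers
    by (simp add: mat_assoc[where n = n])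
  have X: "?X = \<beta> * (?Y * c)"
  proof -
    have "?X = (?T * ?S) * ?X" using star_shift_inverse(2) by (simp add: left_mult_one_mat[OF normal_mat_carrier])
    also have "\<dots> = ?T * (?S * ?X)" by (rule assoc_mult_mat[of _ n n _ n _ n]) auto
    also have "\<dots> = \<beta> * (?Y * c)" unfolding SX \<beta>_def using carriers
      by (simp add: mat_assoc[where n = n])
    finally show ?thesis .
  qed
  have "?S * \<beta> * ?T = (?S * ?T) * b * (?S * ?T)"
    unfolding \<beta>_def using carriers by (simp add: mat_assoc[where n = n])
  then have conj: "?S * \<beta> * ?T = b" using star_shift_inverse(1) carriers by simp
  \<comment> \<open>The second Borel subgroup is triangular apart from its last row.\<close>
  have \<beta>0: "\<beta> $$ (r, s) = 0" if "r < n - 1" "s = n - 1 \<or> s < r" for r s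
  proof -
    have "b $$ (Suc r, if s = n - 1 then 0 else Suc s) = \<beta> $$ (r, s)"
      using star_conj_index[OF \<beta>c, of "Suc r" "if s = n - 1 then 0 else Suc s"] that
      unfolding conj by (auto simp: sigma_def)
    moreover have "b $$ (Suc r, if s = n - 1 then 0 else Suc s) = 0"
      using UT_zero[OF b, of "if s = n - 1 then 0 else Suc s" "Suc r"] that by (auto split: if_splits)
    ultimately show ?thesis by simp
  qed
  \<comment> \<open>The columns of the pivots inside the submatrix; the column j of the added vector joins them, and the entry m of that vector serves as its pivot.\<close>
  define K where "K = {k. k < i \<and> m \<le> w k \<and> w k \<noteq> n - 1}"
  define C where "C = insert j K"
  have jK: "j \<notin> K" using wj by (simp add: K_def)
  then have CK: "C - {j} = K" by (auto simp: C_def)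
  have C_sub: "C \<subseteq> {..<n}" "j \<in> C" using i_n jn by (auto simp: C_def K_def)
  have C_lt: "k < i" if "k \<in> C" for k using that mS(3) by (auto simp: C_def K_def)
  define w' where "w' k = (if k = j then m else w k)" for k
  have w': "m \<le> w' k" "w' k < n - 1" if "k \<in> C" for k
  proof -
    show "m \<le> w' k" using that by (auto simp: w'_def C_def K_def)
    have "w k < n" using permutes_lt[OF w] C_sub that by auto
    then show "w' k < n - 1" using that mS(1) by (auto simp: w'_def C_def K_def)
  qed
  have zero: "(?Y * c) $$ (w s', l) = 0"
    if s': "s' < n" "s' \<notin> K" "m \<le> w s'" "w s' \<noteq> n - 1" and l: "l \<in> C" for s' l
  proof -
    have ws: "w s' < n - 1" using permutes_lt[OF w s'(1)] s'(4) by linarith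
    have s'i: "i \<le> s'" using s' by (auto simp: K_def)
    have "y (w s') = 0"
    proof (rule ccontr)
      assume "y (w s') \<noteq> 0"
      then have "w s' \<in> right_support n w y" "dominated w m (w s')"
        using ws s'i s'(3) mS(3) permutes_inverses(2)[OF w]
        by (auto simp: right_support_def dominated_def i_def j_def)
      then show False using neg by blast
    qed
    then have "?Y $$ (w s', s) * c $$ (s, l) = 0" if "s < n" for s
      using that s'i C_lt[OF l] s'(1) ws UT_zero[OF c, of l s] permutes_inj[OF w] permutes_lt[OF w s'(1)]
      by (cases "s \<le> l") (auto simp: normal_mat_index[OF n w] inj_eq)
    then show ?thesis
      using mult_mat_index[OF normal_mat_carrier carriers(2), of "w s'" l] permutes_lt[OF w s'(1)]
        subsetD[OF C_sub(1) l]
      by (auto intro!: sum.neutral)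
  qed
  have "?X $$ (w' k, l) = (\<Sum>s\<in>C - {j}. \<beta> $$ (w' k, w s) * (?Y * c) $$ (w s, l))"
    if kl: "k \<in> C" "l \<in> C" for k l
  proof -
    have k: "w' k < n" "l < n" using w'[OF kl(1)] C_sub kl by auto
    have "?X $$ (w' k, l) = (\<Sum>r<n. \<beta> $$ (w' k, r) * (?Y * c) $$ (r, l))"
      unfolding X by (rule mult_mat_index[OF \<beta>c Yc k])
    also have "\<dots> = (\<Sum>s<n. \<beta> $$ (w' k, w s) * (?Y * c) $$ (w s, l))"
      using sum.permute[OF w, of "\<lambda>r. \<beta> $$ (w' k, r) * (?Y * c) $$ (r, l)"] by (simp add: comp_def)
    also have "\<dots> = (\<Sum>s<n. if s \<in> C - {j} then \<beta> $$ (w' k, w s) * (?Y * c) $$ (w s, l) else 0)"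
    proof (rule sum.cong[OF refl])
      fix s assume s: "s \<in> {..<n}"
      have "\<beta> $$ (w' k, w s) * (?Y * c) $$ (w s, l) = 0" if "s \<notin> K"
      proof (cases "w s = n - 1 \<or> w s < w' k")
        case True
        then show ?thesis using \<beta>0[OF w'(2)[OF kl(1)]] by auto
      next
        case False
        then show ?thesis using zero[OF _ that _ _ kl(2)] s w'(1)[OF kl(1)] by auto
      qed
      then show "\<beta> $$ (w' k, w s) * (?Y * c) $$ (w s, l)
        = (if s \<in> C - {j} then \<beta> $$ (w' k, w s) * (?Y * c) $$ (w s, l) else 0)" unfolding CK by auto
    qed
    also have "\<dots> = (\<Sum>s\<in>C - {j}. \<beta> $$ (w' k, w s) * (?Y * c) $$ (w s, l))"
      using C_sub(1) by (subst sum.inter_restrict[symmetric]) (auto intro!: sum.cong)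
    finally show ?thesis .
  qed
  then have "det (principal n C (\<lambda>k l. ?X $$ (w' k, l))) = 0" by (rule det_principal_zero[OF C_sub])
  moreover have "det (principal n C (\<lambda>k l. ?X $$ (w' k, l))) \<noteq> 0"
  proof (rule det_one_column[OF jn])
    show "(if j \<in> C then x (w' j) else 0) \<noteq> 0" using mS(2) C_sub(2) by (simp add: w'_def)
    fix k l assume kl: "k < n" "l < n"
    have X: "?X $$ (w' k, l) = (if w' k = w l then 1 else 0) + (if l = j then x (w' k) else 0)"
      if "k \<in> C" using w'(2)[OF that] kl by (simp add: normal_mat_index[OF n w] j_def)
    show "principal n C (\<lambda>k l. ?X $$ (w' k, l)) $$ (k, l)
      = (if l = j then if k \<in> C then x (w' k) else 0 else if k = l then 1 else 0)"
    proof (cases "k \<in> C \<and> l \<in> C")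
      case True
      have "w' k \<noteq> w j" using w'(2)[of k] True wj by simp
      moreover have "w' k = w l \<longleftrightarrow> k = l" if "l \<noteq> j"
      proof (cases "k = j")
        case True
        then show ?thesis using \<open>k \<in> C \<and> l \<in> C\<close> C_lt[of l] wi that permutes_inj[OF w]
          by (auto simp: w'_def inj_eq dest: injD)
      next
        case False
        then show ?thesis using permutes_inj[OF w] by (simp add: w'_def inj_eq)
      qed
      ultimately show ?thesis using True kl X by (auto simp: principal_def)
    next
      case False
      then show ?thesis using kl C_sub(2) by (auto simp: principal_def)
    qed
  qed simp
  ultimately show False by simp
qed

text \<open>The second cell determines which entries are dominated, hence the peaks, hence the reduced normal
  form.\<close>

lemma same_cells_same_orbit:
  assumes n: "0 < n" and w: "w permutes {..<n}"
    and g: "g \<in> bruhat_cell n w" "star_shift n * g \<in> bruhat_cell n u"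
    and h: "h \<in> bruhat_cell n w" "star_shift n * h \<in> bruhat_cell n u"
  shows "same_orbit n g h"
proof -
  note C = GL_carrier[OF bruhat_cell_GL[OF w g(1)]] GL_carrier[OF bruhat_cell_GL[OF w h(1)]]
  obtain x where x: "same_orbit n g (normal_mat n w x)" using cell_normal_form[OF n w g(1)] .
  obtain y where y: "same_orbit n h (normal_mat n w y)" using cell_normal_form[OF n w h(1)] .
  note X = star_cell_same_orbit[OF n C(1) g(2) x] and Y = star_cell_same_orbit[OF n C(2) h(2) y]
  have "peaks n w x = peaks n w y"
    by (rule peaks_eq; rule star_cell_dominated[OF n w]) (use X Y in auto)
  then have "same_orbit n (normal_mat n w x) (normal_mat n w (char_fun (peaks n w y)))"
    using normal_mat_reduce[OF n w, of x] by simp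
  then have "same_orbit n g (normal_mat n w (char_fun (peaks n w y)))"
    using same_orbit_trans[OF n C(1) x] by blast
  moreover have "same_orbit n h (normal_mat n w (char_fun (peaks n w y)))"
    using same_orbit_trans[OF n C(2) y normal_mat_reduce[OF n w]] .
  ultimately show ?thesis using same_orbit_trans[OF n C(1)] same_orbit_sym[OF n C(2)] by blast
qed

section \<open>Length and inversions\<close>

definition inversions :: "nat \<Rightarrow> (nat \<Rightarrow> nat) \<Rightarrow> (nat \<times> nat) set" where
  "inversions n w = {(a, b). a < b \<and> b < n \<and> w b < w a}"

lemma finite_inversions: "finite (inversions n w)"
  by (rule finite_subset[of _ "{..<n} \<times> {..<n}"]) (auto simp: inversions_def)

lemma simple_refl_mono: "a < b \<Longrightarrow> (a, b) \<noteq> (i, Suc i) \<Longrightarrow> simple_refl i a < simple_refl i b"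
  by (auto simp: simple_refl_def Transposition.transpose_def)

lemma simple_refl_lt: "Suc i < n \<Longrightarrow> b < n \<Longrightarrow> simple_refl i b < n"
  using permutes_lt[OF simple_refl_permutes] .

text \<open>Apart from the pair of the two exchanged neighbours, the reflection permutes the pairs and
  preserves their order.\<close>

lemma card_inversions_ascent:
  assumes i: "Suc i < n" and asc: "w i < w (Suc i)"
  shows "card (inversions n (w \<circ> simple_refl i)) = Suc (card (inversions n w))"
proof -
  let ?s = "simple_refl i"
  let ?f = "\<lambda>(a, b). (?s a, ?s b)"
  have "inversions n (w \<circ> ?s) = insert (i, Suc i) (?f ` inversions n w)"
  proof (intro equalityI subsetI)
    fix x assume x: "x \<in> inversions n (w \<circ> ?s)"
    obtain a b where ab: "x = (a, b)" by fastforce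
    show "x \<in> insert (i, Suc i) (?f ` inversions n w)"
    proof (cases "x = (i, Suc i)")
      case False
      then have "(?s a, ?s b) \<in> inversions n w"
        using x ab i simple_refl_mono[of a b i] simple_refl_lt[OF i] by (auto simp: inversions_def)
      moreover have "x = ?f (?s a, ?s b)" using ab by simp
      ultimately show ?thesis by blast
    qed simp
  next
    fix x assume "x \<in> insert (i, Suc i) (?f ` inversions n w)"
    then consider "x = (i, Suc i)" | a b where "x = (?s a, ?s b)" "(a, b) \<in> inversions n w" by auto
    then show "x \<in> inversions n (w \<circ> ?s)"
    proof cases
      case 1
      then show ?thesis using asc i by (simp add: inversions_def)
    next
      case 2
      then have "(a, b) \<noteq> (i, Suc i)" using asc by (auto simp: inversions_def)
      then show ?thesis using 2 simple_refl_mono[of a b i] simple_refl_lt[OF i] by (auto simp: inversions_def)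
    qed
  qed
  moreover have "(i, Suc i) \<notin> ?f ` inversions n w"
  proof
    assume "(i, Suc i) \<in> ?f ` inversions n w"
    then obtain a b where ab: "(a, b) \<in> inversions n w" "?s a = i" "?s b = Suc i" by auto
    have "a = Suc i" "b = i"
      using ab(2,3) simple_refl_involutory[of i a] simple_refl_involutory[of i b] by simp_all
    then show False using ab(1) by (simp add: inversions_def)
  qed
  moreover have "inj_on ?f (inversions n w)"
    by (rule inj_on_inverseI[where g = ?f]) auto
  ultimately show ?thesis using finite_inversions by (simp add: card_image)
qed

lemma card_inversions_descent:
  assumes i: "Suc i < n" and desc: "w (Suc i) < w i"
  shows "card (inversions n w) = Suc (card (inversions n (w \<circ> simple_refl i)))"
  using card_inversions_ascent[OF i, of "w \<circ> simple_refl i"] desc by simp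

lemma card_inversions_perm_inv:
  assumes w: "w permutes {..<n}"
  shows "card (inversions n (perm_inv w)) = card (inversions n w)"
proof -
  note inv = permutes_inverses[OF w] permutes_lt[OF w] permutes_inv_lt[OF w]
  have "bij_betw (\<lambda>(a, b). (w b, w a)) (inversions n w) (inversions n (perm_inv w))"
    by (rule bij_betw_byWitness[where f' = "\<lambda>(a, b). (perm_inv w b, perm_inv w a)"])
      (use inv in \<open>auto simp: inversions_def\<close>)
  then show ?thesis using bij_betw_same_card by metis
qed

lemma foldr_comp_append: "foldr (\<circ>) (ss @ ts) id = foldr (\<circ>) ss id \<circ> foldr (\<circ>) ts id"
  by (induction ss) (auto simp: comp_assoc)

lemma word_permutes:
  assumes "set ss \<subseteq> gens n"
  shows "foldr (\<circ>) ss id permutes {..<n}"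
  using assms
proof (induction ss)
  case Nil
  then show ?case using permutes_id[of "{..<n}"] by (simp add: id_def)
next
  case (Cons s ss)
  then obtain i where "s = simple_refl i" "Suc i < n" by (auto simp: gens_def)
  moreover have "foldr (\<circ>) ss id permutes {..<n}" by (rule Cons.IH) (use Cons.prems in simp)
  moreover have "foldr (\<circ>) (s # ss) id = s \<circ> foldr (\<circ>) ss id" by simp
  ultimately show ?case using permutes_compose[OF _ simple_refl_permutes] by metis
qed

lemma card_inversions_le_word:
  assumes "set ss \<subseteq> gens n"
  shows "card (inversions n (foldr (\<circ>) ss id)) \<le> length ss"
  using assms
proof (induction ss rule: rev_induct)
  case Nil
  have "inversions n id = {}" by (auto simp: inversions_def)
  then show ?case by (simp add: id_def)
next
  case (snoc s ss)
  then obtain i where i: "s = simple_refl i" "Suc i < n" by (auto simp: gens_def)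
  let ?w = "foldr (\<circ>) ss id"
  have "?w permutes {..<n}" using snoc.prems by (intro word_permutes) simp
  then have "?w i \<noteq> ?w (Suc i)" using permutes_inj[of ?w] by (simp add: inj_eq)
  moreover have e: "foldr (\<circ>) (ss @ [s]) id = ?w \<circ> simple_refl i" unfolding foldr_comp_append i(1) by simp
  moreover have "card (inversions n ?w) \<le> length ss" by (rule snoc.IH) (use snoc.prems in simp)
  moreover have "length (ss @ [s]) = Suc (length ss)" by simp
  ultimately show ?case
    using card_inversions_ascent[OF i(2), of ?w] card_inversions_descent[OF i(2), of ?w]
    unfolding e by linarith
qed

text \<open>A permutation without descents is the identity; otherwise a reflection at a descent removes one
  inversion.\<close>

lemma ex_word_card_inversions:
  assumes "w permutes {..<n}"
  shows "\<exists>ss. length ss = card (inversions n w) \<and> set ss \<subseteq> gens n \<and> foldr (\<circ>) ss id = w"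
  using assms
proof (induction "card (inversions n w)" arbitrary: w rule: less_induct)
  case less
  note w = less.prems
  show ?case
  proof (cases "\<exists>i. Suc i < n \<and> w (Suc i) < w i")
    case True
    then obtain i where i: "Suc i < n" "w (Suc i) < w i" by blast
    note c = card_inversions_descent[OF i]
    have "w \<circ> simple_refl i permutes {..<n}" by (rule permutes_compose[OF simple_refl_permutes[OF i(1)] w])
    then obtain ss where ss: "length ss = card (inversions n (w \<circ> simple_refl i))" "set ss \<subseteq> gens n"
      "foldr (\<circ>) ss id = w \<circ> simple_refl i" using less.hyps c by (metis lessI)
    have "foldr (\<circ>) (ss @ [simple_refl i]) id = w \<circ> simple_refl i \<circ> simple_refl i"
      unfolding foldr_comp_append ss(3) by simp
    then have "foldr (\<circ>) (ss @ [simple_refl i]) id = w" unfolding simple_refl_comp(2) .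
    then show ?thesis using ss c i(1)
      by (intro exI[of _ "ss @ [simple_refl i]"]) (auto simp: gens_def)
  next
    case False
    have ge: "k \<le> w k" if "k < n" for k
      using that
    proof (induction k)
      case (Suc k)
      have "w k \<noteq> w (Suc k)" using permutes_inj[OF w] by (simp add: inj_eq)
      moreover have "\<not> w (Suc k) < w k" using False Suc.prems by blast
      ultimately show ?case using Suc by simp
    qed simp
    then have "w = id" using permutes_natset_ge[OF w] by simp
    moreover have "inversions n id = {}" by (auto simp: inversions_def)
    ultimately show ?thesis by simp
  qed
qed

lemma word_length_gens:
  assumes "w permutes {..<n}"
  shows "word_length (gens n) w = card (inversions n w)"
  unfolding word_length_def
  by (rule Least_equality) (use ex_word_card_inversions[OF assms] card_inversions_le_word in auto)

lemma longer_right: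
  assumes w: "w permutes {..<n}" and i: "Suc i < n"
  shows "longer (gens n) (w \<circ> simple_refl i) w = (if w i < w (Suc i) then w \<circ> simple_refl i else w)"
proof -
  have "w \<circ> simple_refl i permutes {..<n}" by (rule permutes_compose[OF simple_refl_permutes[OF i] w])
  moreover have "w i \<noteq> w (Suc i)" using permutes_inj[OF w] by (simp add: inj_eq)
  ultimately show ?thesis
    using card_inversions_ascent[OF i, of w] card_inversions_descent[OF i, of w]
    by (auto simp: longer_def word_length_gens[OF w] word_length_gens)
qed

lemma longer_left:
  assumes w: "w permutes {..<n}" and i: "Suc i < n"
  shows "longer (gens n) (simple_refl i \<circ> w) w
    = (if perm_inv w i < perm_inv w (Suc i) then simple_refl i \<circ> w else w)"
proof -
  have sw: "simple_refl i \<circ> w permutes {..<n}" by (rule permutes_compose[OF w simple_refl_permutes[OF i]])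
  have "perm_inv w i \<noteq> perm_inv w (Suc i)" using permutes_inj[OF permutes_inv[OF w]] by (simp add: inj_eq)
  then show ?thesis
    using card_inversions_ascent[OF i, of "perm_inv w"] card_inversions_descent[OF i, of "perm_inv w"]
      card_inversions_perm_inv[OF w] card_inversions_perm_inv[OF sw] perm_inv_simple_refl_comp[OF w, of i]
    by (auto simp: longer_def word_length_gens[OF w] word_length_gens[OF sw])
qed

definition star_conj :: "nat \<Rightarrow> (nat \<Rightarrow> nat) \<Rightarrow> nat \<Rightarrow> nat" where
  "star_conj n f = sigma n \<circ> f \<circ> perm_inv (sigma n)"

lemma star_conj_comp: "star_conj n (f \<circ> g) = star_conj n f \<circ> star_conj n g"
  using permutes_inverses(2)[OF sigma_permutes] by (auto simp: star_conj_def fun_eq_iff)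

lemma star_conj_id: "star_conj n id = id"
  using permutes_inverses(1)[OF sigma_permutes] by (auto simp: star_conj_def fun_eq_iff)

lemma inj_star_conj: "inj (star_conj n)"
proof (rule injI)
  fix f g assume "star_conj n f = star_conj n g"
  then have "perm_inv (sigma n) \<circ> star_conj n f \<circ> sigma n = perm_inv (sigma n) \<circ> star_conj n g \<circ> sigma n"
    by simp
  then show "f = g"
    using permutes_inverses(2)[OF sigma_permutes] by (auto simp: star_conj_def fun_eq_iff)
qed

lemma star_conj_permutes:
  assumes "w permutes {..<n}"
  shows "star_conj n w permutes {..<n}"
  unfolding star_conj_def
  by (intro permutes_compose assms sigma_permutes permutes_inv)

lemma ex_star_conj:
  assumes "u permutes {..<n}"
  obtains v where "v permutes {..<n}" "u = star_conj n v"
proof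
  show "perm_inv (sigma n) \<circ> u \<circ> sigma n permutes {..<n}"
    by (intro permutes_compose assms sigma_permutes permutes_inv)
  show "u = star_conj n (perm_inv (sigma n) \<circ> u \<circ> sigma n)"
    using permutes_inverses(1)[OF sigma_permutes] by (auto simp: star_conj_def fun_eq_iff)
qed

lemma refl_star_eq: "refl_star n i = star_conj n (simple_refl i)"
  by (simp add: refl_star_def star_conj_def)

lemma star_conj_simple_refl:
  "star_conj n (simple_refl i) = Transposition.transpose (sigma n i) (sigma n (Suc i))"
proof
  fix x
  have "perm_inv (sigma n) x = k \<longleftrightarrow> x = sigma n k" for k
    using permutes_inv_eq[OF sigma_permutes, of n x k] by auto
  then show "star_conj n (simple_refl i) x = Transposition.transpose (sigma n i) (sigma n (Suc i)) x"
    by (simp add: star_conj_def simple_refl_def Transposition.transpose_def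
        permutes_inverses(1)[OF sigma_permutes])
qed

lemma star_conj_simple_refl_Suc:
  "Suc (Suc i) < n \<Longrightarrow> star_conj n (simple_refl (Suc i)) = simple_refl i"
  unfolding star_conj_simple_refl by (simp add: sigma_def simple_refl_def)

lemma gens_star_eq:
  assumes "n \<ge> 2"
  shows "gens_star n = star_conj n ` gens n"
proof (intro equalityI subsetI)
  fix f assume "f \<in> gens_star n"
  then consider "f = Transposition.transpose 0 (n - 1)" | i where "f = simple_refl i" "i < n - 2"
    by (auto simp: gens_star_def)
  then show "f \<in> star_conj n ` gens n"
  proof cases
    case 1
    then have "f = star_conj n (simple_refl 0)"
      using assms by (simp add: star_conj_simple_refl sigma_def transpose_commute)
    moreover have "simple_refl 0 \<in> gens n" using assms unfolding gens_def by (auto intro!: exI[of _ 0])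
    ultimately show ?thesis by blast
  next
    case 2
    then have "f = star_conj n (simple_refl (Suc i))" by (simp add: star_conj_simple_refl_Suc)
    moreover have "simple_refl (Suc i) \<in> gens n" using 2 by (auto simp: gens_def)
    ultimately show ?thesis by blast
  qed
next
  fix f assume "f \<in> star_conj n ` gens n"
  then obtain i where i: "f = star_conj n (simple_refl i)" "i < n - 1" by (auto simp: gens_def)
  show "f \<in> gens_star n"
  proof (cases i)
    case 0
    then have "f = Transposition.transpose 0 (n - 1)"
      using i assms by (simp add: star_conj_simple_refl sigma_def transpose_commute)
    then show ?thesis by (simp add: gens_star_def)
  next
    case (Suc j)
    then have "f = simple_refl j" using i by (simp add: star_conj_simple_refl_Suc)
    then show ?thesis using i Suc by (auto simp: gens_star_def)
  qed
qed

lemma foldr_star_conj: "foldr (\<circ>) (map (star_conj n) ss) id = star_conj n (foldr (\<circ>) ss id)"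
proof (induction ss)
  case Nil
  have "foldr (\<circ>) [] id = (id :: nat \<Rightarrow> nat)" by simp
  then show ?case by (metis star_conj_id list.map(1))
next
  case (Cons s ss)
  have "foldr (\<circ>) (s # ss) id = s \<circ> foldr (\<circ>) ss id" for s :: "nat \<Rightarrow> nat" and ss by simp
  then show ?case by (metis Cons.IH star_conj_comp list.map(2))
qed

text \<open>Conjugation maps the first set of generators onto the second one, so it maps words to words of the
  same length.\<close>

lemma word_length_star_conj:
  assumes "n \<ge> 2"
  shows "word_length (gens_star n) (star_conj n w) = word_length (gens n) w"
proof -
  have "(\<exists>ss. length ss = k \<and> set ss \<subseteq> gens_star n \<and> foldr (\<circ>) ss id = star_conj n w)
    \<longleftrightarrow> (\<exists>ss. length ss = k \<and> set ss \<subseteq> gens n \<and> foldr (\<circ>) ss id = w)" (is "?L \<longleftrightarrow> ?R") for k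
  proof
    assume ?L
    then obtain ss where ss: "length ss = k" "set ss \<subseteq> star_conj n ` gens n" "foldr (\<circ>) ss id = star_conj n w"
      unfolding gens_star_eq[OF assms] by blast
    then have "ss \<in> lists (star_conj n ` gens n)" by auto
    then obtain ts where ts: "ss = map (star_conj n) ts" "set ts \<subseteq> gens n"
      unfolding lists_image by auto
    then have "foldr (\<circ>) ts id = w" using ss(3) inj_star_conj by (auto simp: foldr_star_conj inj_eq)
    then show ?R using ss(1) ts by auto
  next
    assume ?R
    then obtain ss where "length ss = k" "set ss \<subseteq> gens n" "foldr (\<circ>) ss id = w" by blast
    then show ?L unfolding gens_star_eq[OF assms]
      by (intro exI[of _ "map (star_conj n) ss"]) (auto simp: foldr_star_conj)
  qed
  then show ?thesis unfolding word_length_def by simp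
qed

lemma longer_star_conj:
  "n \<ge> 2 \<Longrightarrow> longer (gens_star n) (star_conj n v) (star_conj n w) = star_conj n (longer (gens n) v w)"
  by (simp add: longer_def word_length_star_conj)

section \<open>Zariski open sets and irreducibility\<close>

lemma openin_GL_iff:
  "openin (subtopology (zariski_mat n) (GL n)) V
    \<longleftrightarrow> (\<exists>P\<subseteq>poly_funs n. V = {g \<in> GL n. \<exists>f\<in>P. f g \<noteq> 0})" (is "?L \<longleftrightarrow> ?R")
proof
  assume ?L
  then obtain P where "P \<subseteq> poly_funs n"
    "V = (carrier_mat n n - {A \<in> carrier_mat n n. \<forall>f\<in>P. f A = 0}) \<inter> GL n"
    by (auto simp: openin_subtopology openin_zariski_mat)
  then show ?R using GL_carrier by (intro exI[of _ P]) auto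
next
  assume ?R
  then obtain P where P: "P \<subseteq> poly_funs n" "V = {g \<in> GL n. \<exists>f\<in>P. f g \<noteq> 0}" by blast
  then have "V = (carrier_mat n n - {A \<in> carrier_mat n n. \<forall>f\<in>P. f A = 0}) \<inter> GL n"
    using GL_carrier by auto
  then show ?L using P(1) unfolding openin_subtopology openin_zariski_mat by blast
qed

definition segment :: "nat \<Rightarrow> complex mat \<Rightarrow> complex mat \<Rightarrow> complex \<Rightarrow> complex mat" where
  "segment n p q t = mat n n (\<lambda>ij. (1 - t) * p $$ ij + t * q $$ ij)"

text \<open>The property of sets cut out by affine equations inside the invertible matrices that makes their
  products irreducible.\<close>

definition segment_closed :: "nat \<Rightarrow> complex mat set \<Rightarrow> bool" where
  "segment_closed n A \<longleftrightarrow> A \<subseteq> GL n \<and>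
    (\<forall>p\<in>A. \<forall>q\<in>A. \<forall>t. segment n p q t \<in> GL n \<longrightarrow> segment n p q t \<in> A)"

lemma segment_carrier [simp]: "segment n p q t \<in> carrier_mat n n"
  by (simp add: segment_def)

lemma segment_ends:
  "p \<in> carrier_mat n n \<Longrightarrow> segment n p q 0 = p"
  "q \<in> carrier_mat n n \<Longrightarrow> segment n p q 1 = q"
  by (auto simp: segment_def intro!: eq_matI)

definition is_poly :: "(complex \<Rightarrow> complex) \<Rightarrow> bool" where
  "is_poly \<phi> \<longleftrightarrow> (\<exists>P. \<forall>t. \<phi> t = poly P t)"

lemma is_poly_const: "is_poly (\<lambda>_. c)"
  unfolding is_poly_def by (intro exI[of _ "[:c:]"]) simp

lemma is_poly_ident: "is_poly (\<lambda>t. t)"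
  unfolding is_poly_def by (intro exI[of _ "[:0, 1:]"]) simp

lemma is_poly_add: "is_poly f \<Longrightarrow> is_poly g \<Longrightarrow> is_poly (\<lambda>t. f t + g t)"
  unfolding is_poly_def by (metis poly_add)

lemma is_poly_mult: "is_poly f \<Longrightarrow> is_poly g \<Longrightarrow> is_poly (\<lambda>t. f t * g t)"
  unfolding is_poly_def by (metis poly_mult)

lemma is_poly_diff: "is_poly f \<Longrightarrow> is_poly g \<Longrightarrow> is_poly (\<lambda>t. f t - g t)"
  unfolding is_poly_def by (metis poly_diff)

lemma is_poly_sum: "finite I \<Longrightarrow> (\<And>i. i \<in> I \<Longrightarrow> is_poly (f i)) \<Longrightarrow> is_poly (\<lambda>t. \<Sum>i\<in>I. f i t)"
  by (induction I rule: finite_induct) (auto intro: is_poly_const is_poly_add)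

lemma is_poly_segment: "i < n \<Longrightarrow> j < n \<Longrightarrow> is_poly (\<lambda>t. segment n p q t $$ (i, j))"
  by (simp add: segment_def is_poly_add is_poly_mult is_poly_diff is_poly_const is_poly_ident)

lemma is_poly_matrix_mult:
  assumes "\<And>t. M t \<in> carrier_mat n n" "\<And>t. N t \<in> carrier_mat n n"
    and "\<And>i j. i < n \<Longrightarrow> j < n \<Longrightarrow> is_poly (\<lambda>t. M t $$ (i, j))"
    and "\<And>i j. i < n \<Longrightarrow> j < n \<Longrightarrow> is_poly (\<lambda>t. N t $$ (i, j))"
    and "i < n" "j < n"
  shows "is_poly (\<lambda>t. (M t * N t) $$ (i, j))"
proof -
  have "is_poly (\<lambda>t. \<Sum>k<n. M t $$ (i, k) * N t $$ (k, j))"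
    using assms by (intro is_poly_sum is_poly_mult) auto
  then show ?thesis using mult_mat_index[OF assms(1,2,5,6)] by simp
qed

lemma is_poly_poly_funs:
  assumes f: "f \<in> poly_funs n" and M: "\<And>i j. i < n \<Longrightarrow> j < n \<Longrightarrow> is_poly (\<lambda>t. M t $$ (i, j))"
  shows "is_poly (\<lambda>t. f (M t))"
  using f by induction (auto intro: is_poly_const is_poly_add is_poly_mult M)

lemma is_poly_det:
  assumes c: "\<And>t. M t \<in> carrier_mat n n" and M: "\<And>i j. i < n \<Longrightarrow> j < n \<Longrightarrow> is_poly (\<lambda>t. M t $$ (i, j))"
  shows "is_poly (\<lambda>t. det (M t))"
proof -
  have "(\<lambda>A. det (mat n n (\<lambda>(i, j). A $$ (i, j)))) \<in> poly_funs n"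
    by (intro poly_funs_det poly_funs.entry)
  then have "is_poly (\<lambda>t. det (mat n n (\<lambda>(i, j). M t $$ (i, j))))"
    by (rule is_poly_poly_funs) (rule M)
  moreover have "mat n n (\<lambda>(i, j). M t $$ (i, j)) = M t" for t
    using c[of t] by (intro eq_matI) auto
  ultimately show ?thesis by simp
qed

lemma is_poly_common_nonzero:
  assumes "is_poly f" "is_poly g" "is_poly h" "is_poly k"
    and "f a \<noteq> 0" "g b \<noteq> 0" "h c \<noteq> 0" "k d \<noteq> 0"
  obtains t where "f t \<noteq> 0" "g t \<noteq> 0" "h t \<noteq> 0" "k t \<noteq> 0"
proof -
  obtain P1 P2 P3 P4 where P: "\<forall>t. f t = poly P1 t" "\<forall>t. g t = poly P2 t" "\<forall>t. h t = poly P3 t"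
    "\<forall>t. k t = poly P4 t" using assms(1-4) unfolding is_poly_def by blast
  have "P1 \<noteq> 0" "P2 \<noteq> 0" "P3 \<noteq> 0" "P4 \<noteq> 0" using assms(5-8) P by auto
  then have "P1 * P2 * P3 * P4 \<noteq> 0" by simp
  then obtain t where "poly (P1 * P2 * P3 * P4) t \<noteq> 0" using poly_all_0_iff_0 by blast
  then show thesis using that[of t] P by auto
qed

text \<open>Two points of a set of products are joined by a polynomial curve that stays in the set
  except where a determinant vanishes. A polynomial that is nonzero at one point of the curve
  is nonzero at all but finitely many.\<close>

lemma products_irreducible:
  assumes A: "segment_closed n A" "segment_closed n A'" and v: "v \<in> carrier_mat n n"
    and V: "openin (subtopology (zariski_mat n) (GL n)) V" "openin (subtopology (zariski_mat n) (GL n)) V'"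
    and ne: "p \<in> A" "q \<in> A'" "p * v * q \<in> V" and ne': "p' \<in> A" "q' \<in> A'" "p' * v * q' \<in> V'"
  shows "\<exists>p\<in>A. \<exists>q\<in>A'. p * v * q \<in> V \<and> p * v * q \<in> V'"
proof -
  obtain P where P: "P \<subseteq> poly_funs n" "V = {g \<in> GL n. \<exists>f\<in>P. f g \<noteq> 0}"
    using V(1) unfolding openin_GL_iff by blast
  obtain P' where P': "P' \<subseteq> poly_funs n" "V' = {g \<in> GL n. \<exists>f\<in>P'. f g \<noteq> 0}"
    using V(2) unfolding openin_GL_iff by blast
  obtain f where f: "f \<in> P" "f (p * v * q) \<noteq> 0" and vG: "p * v * q \<in> GL n" using ne(3) P(2) by blast
  obtain f' where f': "f' \<in> P'" "f' (p' * v * q') \<noteq> 0" using ne'(3) P'(2) by blast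
  have pq: "p \<in> GL n" "p' \<in> GL n" "q \<in> GL n" "q' \<in> GL n"
    using A ne ne' unfolding segment_closed_def by blast+
  note C = pq[THEN GL_carrier]
  define \<gamma> where "\<gamma> t = segment n p p' t * v * segment n q q' t" for t
  have \<gamma>: "is_poly (\<lambda>t. \<gamma> t $$ (i, j))" if "i < n" "j < n" for i j
    unfolding \<gamma>_def
  proof (rule is_poly_matrix_mult[OF _ _ _ _ that])
    show "is_poly (\<lambda>t. (segment n p p' t * v) $$ (i, j))" if "i < n" "j < n" for i j
      by (rule is_poly_matrix_mult[OF _ _ _ _ that]) (auto intro: v is_poly_segment is_poly_const)
  qed (auto intro: is_poly_segment mult_carrier_mat[OF segment_carrier v])
  have "is_poly (\<lambda>t. f (\<gamma> t))" "is_poly (\<lambda>t. f' (\<gamma> t))"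
    using is_poly_poly_funs[of _ n \<gamma>, OF _ \<gamma>] f(1) f'(1) P(1) P'(1) by blast+
  moreover have "is_poly (\<lambda>t. det (segment n p p' t))" "is_poly (\<lambda>t. det (segment n q q' t))"
    by (auto intro!: is_poly_det is_poly_segment)
  moreover have "f (\<gamma> 0) \<noteq> 0" "f' (\<gamma> 1) \<noteq> 0" "det (segment n p p' 0) \<noteq> 0" "det (segment n q q' 0) \<noteq> 0"
    using f(2) f'(2) pq C by (simp_all add: \<gamma>_def segment_ends GL_iff_det)
  ultimately obtain t where t: "f (\<gamma> t) \<noteq> 0" "f' (\<gamma> t) \<noteq> 0" "det (segment n p p' t) \<noteq> 0" "det (segment n q q' t) \<noteq> 0"
    by (rule is_poly_common_nonzero)
  have s: "segment n p p' t \<in> A" "segment n q q' t \<in> A'"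
    using A ne ne' t(3,4) unfolding segment_closed_def by (auto simp: GL_iff_det)
  have "det v \<noteq> 0"
    using vG C v det_mult[OF mult_carrier_mat[OF C(1) v] C(3)] det_mult[OF C(1) v] by (auto simp: GL_iff_det)
  then have "\<gamma> t \<in> GL n"
    unfolding \<gamma>_def using t(3,4) v by (intro mult_GL) (auto simp: GL_iff_det)
  then have "\<gamma> t \<in> V" "\<gamma> t \<in> V'" using t(1,2) f(1) f'(1) P(2) P'(2) by blast+
  then show ?thesis using s unfolding \<gamma>_def by blast
qed

lemma segment_fixed_entry:
  assumes "i < n" "j < n" "p $$ (i, j) = z" "q $$ (i, j) = z"
  shows "segment n p q t $$ (i, j) = z"
  using assms by (simp add: segment_def left_diff_distrib)

lemma segment_closed_zero:
  "segment_closed n {g \<in> GL n. \<forall>r<n. \<forall>c<n. Z r c \<longrightarrow> g $$ (r, c) = 0}"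
  unfolding segment_closed_def by (simp add: segment_fixed_entry)

lemma segment_closed_min_parabolic: "segment_closed n (min_parabolic n i)"
proof -
  have "min_parabolic n i
      = {g \<in> GL n. \<forall>r<n. \<forall>c<n. (c < r \<and> (r, c) \<noteq> (Suc i, i)) \<longrightarrow> g $$ (r, c) = 0}"
    unfolding min_parabolic_def by (meson less_trans)
  then show ?thesis by (simp only: segment_closed_zero)
qed

lemma segment_closed_one: "segment_closed n {1\<^sub>m n}"
  by (auto simp: segment_closed_def segment_def one_GL algebra_simps intro!: eq_matI)

lemma segment_closed_last_trivial:
  assumes n: "0 < n" and A: "segment_closed n A"
  shows "segment_closed n {g \<in> A. last_trivial n g}"
proof -
  have "last_trivial n (segment n p q t)" if "last_trivial n p" "last_trivial n q" for p q t
    using that n unfolding last_trivial_def by (simp add: segment_fixed_entry)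
  then show ?thesis using A unfolding segment_closed_def by blast
qed

lemma segment_closed_min_parabolic_K:
  assumes "Suc i < n - 1"
  shows "segment_closed n (min_parabolic_K n i)"
proof -
  have "min_parabolic_K n i = {g \<in> min_parabolic n i. last_trivial n g}"
    using min_parabolic_K_iff[OF assms] by blast
  then show ?thesis
    using segment_closed_last_trivial[OF _ segment_closed_min_parabolic, of n i] assms by simp
qed

lemma segment_closed_borel_K:
  assumes "0 < n"
  shows "segment_closed n (borel_K n)"
proof -
  have "UT n = {g \<in> GL n. \<forall>r<n. \<forall>c<n. c < r \<longrightarrow> g $$ (r, c) = 0}"
  proof (intro equalityI subsetI)
    fix g assume g: "g \<in> {g \<in> GL n. \<forall>r<n. \<forall>c<n. c < r \<longrightarrow> g $$ (r, c) = 0}"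
    then have "g \<in> GL n" and z: "\<And>r c. r < n \<Longrightarrow> c < r \<Longrightarrow> g $$ (r, c) = 0" by auto
    then have "upper_triangular g"
      using GL_carrier[of g n] by (intro upper_triangularI) (metis carrier_matD(1))
    then show "g \<in> UT n" using \<open>g \<in> GL n\<close> by (simp add: UT_def)
  next
    fix g assume "g \<in> UT n"
    then show "g \<in> {g \<in> GL n. \<forall>r<n. \<forall>c<n. c < r \<longrightarrow> g $$ (r, c) = 0}"
      using UT_zero[of g n] UT_GL[of g n] by simp
  qed
  then have "segment_closed n (UT n)" by (simp only: segment_closed_zero)
  moreover have "borel_K n = {g \<in> UT n. last_trivial n g}" using borel_K_iff[OF assms] by blast
  ultimately show ?thesis using segment_closed_last_trivial[OF assms] by simp
qed

text \<open>A polynomial witness that the closure of the first cell does not contain the second one.\<close>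

definition separated :: "nat \<Rightarrow> (nat \<Rightarrow> nat) \<Rightarrow> (nat \<Rightarrow> nat) \<Rightarrow> bool" where
  "separated n w w' \<longleftrightarrow> (\<exists>f\<in>poly_funs n. (\<forall>g\<in>bruhat_cell n w. f g = 0) \<and> f (perm_mat n w') \<noteq> 0)"

lemma separatedI:
  assumes "w permutes {..<n}" "w' permutes {..<n}" "a < n" "\<And>k. k < a \<Longrightarrow> w k = w' k" "w a < w' a"
  shows "separated n w w'"
proof (rule cell_separating_minor[of w n w' a])
  fix f assume "f \<in> poly_funs n" "\<And>g. g \<in> bruhat_cell n w \<Longrightarrow> f g = 0" "f (perm_mat n w') \<noteq> 0"
  then show ?thesis unfolding separated_def by (intro bexI[of _ f] conjI ballI) simp_all
qed (use assms in auto)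

text \<open>Translating a separating minor by the Borel subgroup on both sides makes its nonvanishing
  locus stable, so that it contains the whole upper cell. Stability on the right lets the open set
  descend to flags.\<close>

lemma separated_neighbourhood:
  assumes sep: "separated n w w'" and T: "T \<in> GL n"
  obtains V where "openin (subtopology (zariski_mat n) (GL n)) V"
    "\<And>g c. g \<in> V \<Longrightarrow> c \<in> UT n \<Longrightarrow> g * c \<in> V"
    "\<And>g. g \<in> GL n \<Longrightarrow> T * g \<in> bruhat_cell n w' \<Longrightarrow> g \<in> V"
    "\<And>g. g \<in> V \<Longrightarrow> T * g \<notin> bruhat_cell n w"
proof -
  obtain f where f: "f \<in> poly_funs n" "\<And>g. g \<in> bruhat_cell n w \<Longrightarrow> f g = 0" "f (perm_mat n w') \<noteq> 0"
    using sep by (auto simp: separated_def)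
  note Tc = GL_carrier[OF T]
  define V where "V = {g \<in> GL n. \<exists>b\<in>UT n. \<exists>c\<in>UT n. f (b * (T * g) * c) \<noteq> 0}"
  define P where "P = {f' \<in> poly_funs n. \<exists>b\<in>UT n. \<exists>c\<in>UT n. \<forall>g\<in>carrier_mat n n. f' g = f ((b * T) * g * c)}"
  have assoc: "(b * T) * g * c = b * (T * g) * c" if "b \<in> UT n" "c \<in> UT n" "g \<in> carrier_mat n n" for b c g
    using UT_carrier[OF that(1)] UT_carrier[OF that(2)] Tc that(3)
    by (simp add: mat_assoc[where n = n])
  have "V = {g \<in> GL n. \<exists>f'\<in>P. f' g \<noteq> 0}"
  proof (intro equalityI subsetI)
    fix g assume "g \<in> V"
    then obtain b c where bc: "b \<in> UT n" "c \<in> UT n" "f (b * (T * g) * c) \<noteq> 0" and g: "g \<in> GL n"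
      by (auto simp: V_def)
    obtain f' where f': "f' \<in> poly_funs n" "\<forall>g\<in>carrier_mat n n. f' g = f ((b * T) * g * c)"
      using poly_funs_translate[OF f(1) mult_carrier_mat[OF UT_carrier[OF bc(1)] Tc] UT_carrier[OF bc(2)]] by blast
    then have "f' \<in> P" using bc unfolding P_def by blast
    moreover have "f' g \<noteq> 0" using f'(2) GL_carrier[OF g] bc(3) assoc[OF bc(1,2) GL_carrier[OF g]] by simp
    ultimately show "g \<in> {g \<in> GL n. \<exists>f'\<in>P. f' g \<noteq> 0}" using g by blast
  next
    fix g assume "g \<in> {g \<in> GL n. \<exists>f'\<in>P. f' g \<noteq> 0}"
    then obtain f' b c where g: "g \<in> GL n" and bc: "b \<in> UT n" "c \<in> UT n"
      and f': "\<forall>g\<in>carrier_mat n n. f' g = f ((b * T) * g * c)" "f' g \<noteq> 0" by (auto simp: P_def)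
    then have "f (b * (T * g) * c) \<noteq> 0" using GL_carrier[OF g] assoc[OF bc GL_carrier[OF g]] by simp
    then show "g \<in> V" using g bc by (auto simp: V_def)
  qed
  then have "openin (subtopology (zariski_mat n) (GL n)) V"
    unfolding openin_GL_iff by (intro exI[of _ P]) (auto simp: P_def)
  moreover have "g * d \<in> V" if g: "g \<in> V" and d: "d \<in> UT n" for g d
  proof -
    obtain b c where bc: "b \<in> UT n" "c \<in> UT n" "f (b * (T * g) * c) \<noteq> 0" and gG: "g \<in> GL n"
      using g by (auto simp: V_def)
    obtain d' where d': "d' \<in> UT n" "d * d' = 1\<^sub>m n" using UT_inverse[OF d] by blast
    note C = UT_carrier[OF bc(1)] UT_carrier[OF bc(2)] UT_carrier[OF d] UT_carrier[OF d'(1)] GL_carrier[OF gG]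
    have "b * (T * (g * d)) * (d' * c) = b * (T * g) * ((d * d') * c)"
      using C Tc by (simp add: mat_assoc[where n = n])
    then have "f (b * (T * (g * d)) * (d' * c)) \<noteq> 0" using bc(3) d'(2) C by simp
    then show ?thesis
      using bc(1) mult_UT[OF d'(1) bc(2)] mult_GL[OF gG UT_GL[OF d]] unfolding V_def by blast
  qed
  moreover have "g \<in> V" if gG: "g \<in> GL n" and cell: "T * g \<in> bruhat_cell n w'" for g
  proof -
    obtain b c where "b \<in> UT n" "c \<in> UT n" "perm_mat n w' = b * (T * g) * c"
      using bruhat_cell_representative[OF cell] .
    then show ?thesis using f(3) gG unfolding V_def by auto
  qed
  moreover have "T * g \<notin> bruhat_cell n w" if "g \<in> V" for g
  proof
    assume "T * g \<in> bruhat_cell n w"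
    then have "f (b * (T * g) * c) = 0" if "b \<in> UT n" "c \<in> UT n" for b c
      using f(2) bruhat_cell_mult_UT[OF _ that] by blast
    then show False using \<open>g \<in> V\<close> by (auto simp: V_def)
  qed
  ultimately show thesis using that by blast
qed

section \<open>The open orbit in a fibre\<close>

abbreviation orbit :: "nat \<Rightarrow> complex mat \<Rightarrow> complex vec set list set" where
  "orbit n g \<equiv> act_set (borel_K n) {act g (E_plus n)}"

lemma orbit_eq:
  assumes n: "0 < n" and g: "g \<in> GL n"
  shows "orbit n g = {act (k * g) (E_plus n) | k. k \<in> borel_K n}"
  unfolding act_set_def
  using act_mult_E_plus[OF UT_carrier[OF borel_K_UT[OF n]] GL_carrier[OF g]] by auto metis+

lemma same_orbit_act:
  assumes n: "0 < n" and g: "g \<in> GL n" and h: "h \<in> GL n"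
  shows "act h (E_plus n) \<in> orbit n g \<longleftrightarrow> same_orbit n g h"
proof -
  have "act h (E_plus n) = act (k * g) (E_plus n) \<longleftrightarrow> (\<exists>c\<in>UT n. h = k * g * c)"
    if "k \<in> borel_K n" for k
    using act_E_plus_eq_iff[OF mult_GL[OF UT_GL[OF borel_K_UT[OF n that]] g] h] by metis
  then show ?thesis unfolding orbit_eq[OF n g] same_orbit_def mem_Collect_eq by blast
qed

lemma orbit_cong:
  assumes n: "0 < n" and g: "g \<in> GL n" and h: "h \<in> GL n" and e: "same_orbit n g h"
  shows "orbit n g = orbit n h"
proof -
  have sub: "orbit n h \<subseteq> orbit n g"
    if g: "g \<in> GL n" and h: "h \<in> GL n" and e: "same_orbit n g h" for g h
  proof
    fix F assume "F \<in> orbit n h"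
    then obtain k where k: "k \<in> borel_K n" "F = act (k * h) (E_plus n)" using orbit_eq[OF n h] by blast
    have kh: "k * h \<in> GL n" using mult_GL[OF UT_GL[OF borel_K_UT[OF n k(1)]] h] .
    have "same_orbit n h (k * h)"
      by (rule same_orbitI[OF k(1) one_UT]) (rule right_mult_one_mat[OF GL_carrier[OF kh], symmetric])
    then have "same_orbit n g (k * h)" using same_orbit_trans[OF n GL_carrier[OF g] e] by blast
    then show "F \<in> orbit n g"
      unfolding k(2) same_orbit_act[OF n g kh] .
  qed
  show ?thesis using sub[OF g h e] sub[OF h g same_orbit_sym[OF n GL_carrier[OF g] e]] by blast
qed

lemma orbits_iff:
  "Q \<in> orbits n \<longleftrightarrow> (\<exists>g\<in>GL n. Q = orbit n g)"
  unfolding orbits_def using flags_adapted_basis act_GL_flags by blast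

definition cells_flags :: "nat \<Rightarrow> (nat \<Rightarrow> nat) \<Rightarrow> (nat \<Rightarrow> nat) \<Rightarrow> complex vec set list set" where
  "cells_flags n w u = {act g (E_plus n) | g. g \<in> bruhat_cell n w \<and> star_shift n * g \<in> bruhat_cell n u}"

lemma cells_flags_orbit:
  assumes n: "0 < n" and w: "w permutes {..<n}"
    and g: "g \<in> bruhat_cell n w" "star_shift n * g \<in> bruhat_cell n u"
  shows "cells_flags n w u = orbit n g"
proof (intro equalityI subsetI)
  have gG: "g \<in> GL n" using bruhat_cell_GL[OF w g(1)] .
  fix F
  {
    assume "F \<in> cells_flags n w u"
    then obtain h where h: "F = act h (E_plus n)" "h \<in> bruhat_cell n w" "star_shift n * h \<in> bruhat_cell n u"
      by (auto simp: cells_flags_def)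
    then show "F \<in> orbit n g"
      using same_cells_same_orbit[OF n w g h(2,3)] same_orbit_act[OF n gG bruhat_cell_GL[OF w h(2)]] by simp
  next
    assume "F \<in> orbit n g"
    then obtain k where k: "k \<in> borel_K n" "F = act (k * g) (E_plus n)" using orbit_eq[OF n gG] by blast
    have "same_orbit n g (k * g)"
      by (rule same_orbitI[OF k(1) one_UT])
        (rule right_mult_one_mat[OF mult_carrier_mat[OF UT_carrier[OF borel_K_UT[OF n k(1)]] GL_carrier[OF gG]], symmetric])
    then show "F \<in> cells_flags n w u"
      using cell_same_orbit[OF n g(1)] star_cell_same_orbit[OF n GL_carrier[OF gG] g(2)] k(2)
      unfolding cells_flags_def by blast
  }
qed

text \<open>The matrices of type \<open>w\<close> and those whose shift has type \<open>u\<close> form two nonempty open parts of the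
  fibre. By irreducibility they meet, their intersection is one orbit because the two cells determine
  the orbit, and every open orbit meets it as well.\<close>

lemma open_orbit:
  assumes n: "0 < n" and v: "v \<in> GL n"
    and A: "segment_closed n A" "segment_closed n A'"
    and stable: "\<And>k p. k \<in> borel_K n \<Longrightarrow> p \<in> A \<Longrightarrow> k * p \<in> A"
    and w: "w permutes {..<n}"
    and sep: "separated n w' w" "separated n u' u"
    and sub: "\<And>p q. p \<in> A \<Longrightarrow> q \<in> A' \<Longrightarrow> p * v * q \<in> bruhat_cell n w' \<union> bruhat_cell n w"
      "\<And>p q. p \<in> A \<Longrightarrow> q \<in> A' \<Longrightarrow> star_shift n * (p * v * q) \<in> bruhat_cell n u' \<union> bruhat_cell n u"
    and ne: "\<exists>p\<in>A. \<exists>q\<in>A'. p * v * q \<in> bruhat_cell n w"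
      "\<exists>p\<in>A. \<exists>q\<in>A'. star_shift n * (p * v * q) \<in> bruhat_cell n u"
    and X: "X = {act (p * v * q) (E_plus n) | p q. p \<in> A \<and> q \<in> A'}"
  shows "\<exists>g\<in>GL n. g \<in> bruhat_cell n w \<and> star_shift n * g \<in> bruhat_cell n u"
    and "openin (subtopology (flag_topology n) X) (cells_flags n w u)"
    and "\<And>Q. Q \<in> orbits n \<Longrightarrow> openin (subtopology (flag_topology n) X) Q \<Longrightarrow> Q = cells_flags n w u"
proof -
  let ?Z = "subtopology (zariski_mat n) (GL n)"
  note vc = GL_carrier[OF v]
  have AG: "p \<in> GL n" if "p \<in> A \<or> p \<in> A'" for p using A that by (auto simp: segment_closed_def)
  have XG: "p * v * q \<in> GL n" if "p \<in> A" "q \<in> A'" for p q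
    using that AG v by (intro mult_GL) auto
  obtain V1 where V1: "openin ?Z V1" "\<And>g c. g \<in> V1 \<Longrightarrow> c \<in> UT n \<Longrightarrow> g * c \<in> V1"
    "\<And>g. g \<in> GL n \<Longrightarrow> 1\<^sub>m n * g \<in> bruhat_cell n w \<Longrightarrow> g \<in> V1"
    "\<And>g. g \<in> V1 \<Longrightarrow> 1\<^sub>m n * g \<notin> bruhat_cell n w'"
    using separated_neighbourhood[OF sep(1) one_GL] by metis
  obtain V2 where V2: "openin ?Z V2" "\<And>g c. g \<in> V2 \<Longrightarrow> c \<in> UT n \<Longrightarrow> g * c \<in> V2"
    "\<And>g. g \<in> GL n \<Longrightarrow> star_shift n * g \<in> bruhat_cell n u \<Longrightarrow> g \<in> V2"
    "\<And>g. g \<in> V2 \<Longrightarrow> star_shift n * g \<notin> bruhat_cell n u'"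
    using separated_neighbourhood[OF sep(2) star_shift_GL] by metis
  define V where "V = V1 \<inter> V2"
  have V: "openin ?Z V" using V1(1) V2(1) unfolding V_def by (rule openin_Int)
  have VG: "V \<subseteq> GL n" using V unfolding openin_GL_iff by blast
  have Vr: "g * c \<in> V" if "g \<in> V" "c \<in> UT n" for g c using that V1(2) V2(2) by (auto simp: V_def)
  have Vcells: "p * v * q \<in> bruhat_cell n w" "star_shift n * (p * v * q) \<in> bruhat_cell n u"
    if "p \<in> A" "q \<in> A'" "p * v * q \<in> V" for p q
  proof -
    have "1\<^sub>m n * (p * v * q) = p * v * q" by (rule left_mult_one_mat[OF GL_carrier[OF XG[OF that(1,2)]]])
    then show "p * v * q \<in> bruhat_cell n w" using sub(1)[OF that(1,2)] V1(4)[of "p * v * q"] that(3) by (auto simp: V_def)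
    show "star_shift n * (p * v * q) \<in> bruhat_cell n u"
      using sub(2)[OF that(1,2)] V2(4) that(3) by (auto simp: V_def)
  qed
  have cellsV: "g \<in> V" if "g \<in> bruhat_cell n w" "star_shift n * g \<in> bruhat_cell n u" for g
    using V1(3)[of g] V2(3)[of g] that bruhat_cell_GL[OF w that(1)] GL_carrier[of g n] by (simp add: V_def)
  obtain p1 q1 where pq1: "p1 \<in> A" "q1 \<in> A'" "p1 * v * q1 \<in> V1"
    using ne(1) V1(3) XG GL_carrier[OF XG] by (metis left_mult_one_mat)
  obtain p2 q2 where pq2: "p2 \<in> A" "q2 \<in> A'" "p2 * v * q2 \<in> V2"
    using ne(2) V2(3) XG by metis
  obtain p q where pq: "p \<in> A" "q \<in> A'" "p * v * q \<in> V"
    using products_irreducible[OF A vc V1(1) V2(1) pq1 pq2] unfolding V_def by blast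
  define x where "x = p * v * q"
  have x: "x \<in> GL n" "x \<in> bruhat_cell n w" "star_shift n * x \<in> bruhat_cell n u"
    using XG[OF pq(1,2)] Vcells[OF pq] by (auto simp: x_def)
  then show "\<exists>g\<in>GL n. g \<in> bruhat_cell n w \<and> star_shift n * g \<in> bruhat_cell n u" by blast
  note cf = cells_flags_orbit[OF n w x(2,3)]
  define U where "U = {act g (E_plus n) | g. g \<in> V}"
  \<comment> \<open>Stability of V on the right makes it the full preimage of its set of flags.\<close>
  have "{g \<in> GL n. act g (E_plus n) \<in> U} = V"
  proof (intro equalityI subsetI)
    fix g assume "g \<in> {g \<in> GL n. act g (E_plus n) \<in> U}"
    then obtain h where "g \<in> GL n" "h \<in> V" "act h (E_plus n) = act g (E_plus n)" by (auto simp: U_def)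
    then show "g \<in> V" using act_E_plus_eq_iff[of h n g] VG Vr by auto
  qed (use VG in \<open>auto simp: U_def\<close>)
  then have U: "openin (flag_topology n) U"
    unfolding openin_flag_topology using V VG act_GL_flags by (auto simp: U_def)
  have "cells_flags n w u = U \<inter> X"
  proof (intro equalityI subsetI)
    fix F assume "F \<in> cells_flags n w u"
    then obtain g where g: "F = act g (E_plus n)" "g \<in> bruhat_cell n w" "star_shift n * g \<in> bruhat_cell n u"
      by (auto simp: cells_flags_def)
    have "F \<in> U" using cellsV[OF g(2,3)] g(1) by (auto simp: U_def)
    moreover have "F \<in> orbit n x" using \<open>F \<in> cells_flags n w u\<close> cf by simp
    then obtain k where k: "k \<in> borel_K n" "F = act (k * x) (E_plus n)" using orbit_eq[OF n x(1)] by blast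
    have "k * x = (k * p) * v * q"
      using UT_carrier[OF borel_K_UT[OF n k(1)]] AG[of p] AG[of q] pq vc
      unfolding x_def by (simp add: GL_carrier mat_assoc[where n = n])
    then have "F = act ((k * p) * v * q) (E_plus n)" using k(2) by simp
    then have "F \<in> X" using stable[OF k(1) pq(1)] pq(2) unfolding X by blast
    ultimately show "F \<in> U \<inter> X" by blast
  next
    fix F assume F: "F \<in> U \<inter> X"
    then obtain g where g: "g \<in> V" "F = act g (E_plus n)" by (auto simp: U_def)
    obtain p' q' where h: "p' \<in> A" "q' \<in> A'" "F = act (p' * v * q') (E_plus n)" using F unfolding X by blast
    obtain c where "c \<in> UT n" "p' * v * q' = g * c"
      using act_E_plus_eq_iff[of g n "p' * v * q'"] g h VG XG[OF h(1,2)] by auto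
    then have "p' * v * q' \<in> V" using Vr g by auto
    then show "F \<in> cells_flags n w u" using Vcells[OF h(1,2)] h(3) unfolding cells_flags_def by blast
  qed
  then show "openin (subtopology (flag_topology n) X) (cells_flags n w u)"
    using U unfolding openin_subtopology by blast
  fix Q assume Q: "Q \<in> orbits n" "openin (subtopology (flag_topology n) X) Q"
  obtain h where h: "h \<in> GL n" "Q = orbit n h"
    using Q(1) unfolding orbits_iff by blast
  obtain U' where U': "openin (flag_topology n) U'" "Q = U' \<inter> X"
    using Q(2) unfolding openin_subtopology by blast
  define V' where "V' = {g \<in> GL n. act g (E_plus n) \<in> U'}"
  have V': "openin ?Z V'" using U'(1) unfolding openin_flag_topology V'_def by blast
  have "same_orbit n h h"
    by (rule same_orbitI[OF one_borel_K[OF n] one_UT]) (use GL_carrier[OF h(1)] in simp)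
  then have "act h (E_plus n) \<in> Q" using same_orbit_act[OF n h(1) h(1)] h(2) by simp
  then obtain p' q' where p': "p' \<in> A" "q' \<in> A'" "act h (E_plus n) = act (p' * v * q') (E_plus n)"
    "act h (E_plus n) \<in> U'" unfolding U'(2) X by blast
  then have "p' * v * q' \<in> V'" using XG by (simp add: V'_def)
  then obtain p0 q0 where pq0: "p0 \<in> A" "q0 \<in> A'" "p0 * v * q0 \<in> V" "p0 * v * q0 \<in> V'"
    using products_irreducible[OF A vc V V' pq p'(1,2)] by blast
  have "act (p0 * v * q0) (E_plus n) \<in> Q"
    using pq0 unfolding U'(2) X V'_def by blast
  then have "same_orbit n h (p0 * v * q0)" using same_orbit_act[OF n h(1) XG[OF pq0(1,2)]] h(2) by simp
  then have "Q = orbit n (p0 * v * q0)"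
    using orbit_cong[OF n h(1) XG[OF pq0(1,2)]] h(2) by simp
  also have "\<dots> = cells_flags n w u" using cells_flags_orbit[OF n w Vcells[OF pq0(1-3)]] by simp
  finally show "Q = cells_flags n w u" .
qed

section \<open>The pair of Weyl group elements of an orbit\<close>

lemma perm_mat_coord_space:
  assumes w: "w permutes {..<n}" and J: "J \<subseteq> {..<n}"
  shows "(*\<^sub>v) (perm_mat n w) ` coord_space n J = coord_space n (w ` J)"
proof -
  have idx: "(perm_mat n v *\<^sub>v x) $ r = x $ perm_inv v r"
    if v: "v permutes {..<n}" and x: "x \<in> carrier_vec n" and r: "r < n" for v x r
  proof -
    have row_pos: "r = v m \<longleftrightarrow> m = perm_inv v r" for m using permutes_inv_eq[OF v, of r m] by auto
    have "dim_row (perm_mat n v) = n" "dim_col (perm_mat n v) = n" by (simp_all add: perm_mat_def)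
    then have "(perm_mat n v *\<^sub>v x) $ r = (\<Sum>k<n. perm_mat n v $$ (r, k) * x $ k)"
      using x r by (auto simp: scalar_prod_def atLeast0LessThan)
    also have "\<dots> = (\<Sum>k<n. if k = perm_inv v r then x $ perm_inv v r else 0)"
      by (rule sum.cong) (use r in \<open>auto simp: perm_mat_index row_pos permutes_inverses(1)[OF v]\<close>)
    finally show ?thesis using permutes_inv_lt[OF v r] by simp
  qed
  have sub: "perm_mat n v *\<^sub>v x \<in> coord_space n (v ` I)"
    if v: "v permutes {..<n}" and x: "x \<in> coord_space n I" for v x I
  proof -
    have xc: "x \<in> carrier_vec n" using x by (simp add: coord_space_def)
    have "x $ perm_inv v r = 0" if "r < n" "r \<notin> v ` I" for r
    proof -
      have "perm_inv v r \<notin> I" using that(2) permutes_inverses(1)[OF v, of r] by (metis imageI)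
      then show ?thesis using x permutes_inv_lt[OF v that(1)] by (simp add: coord_space_def)
    qed
    then show ?thesis
      using idx[OF v xc] mult_mat_vec_carrier[OF perm_mat_carrier xc] by (auto simp: coord_space_def)
  qed
  show ?thesis
  proof (intro equalityI subsetI)
    fix y assume "y \<in> (*\<^sub>v) (perm_mat n w) ` coord_space n J"
    then show "y \<in> coord_space n (w ` J)" using sub[OF w] by blast
  next
    fix y assume y: "y \<in> coord_space n (w ` J)"
    have "perm_inv w ` w ` J = J" using permutes_inverses(2)[OF w] by (simp add: image_image)
    then have 1: "perm_mat n (perm_inv w) *\<^sub>v y \<in> coord_space n J"
      using sub[OF permutes_inv[OF w] y] by simp
    have "y \<in> carrier_vec n" using y by (simp add: coord_space_def)
    then have "perm_mat n w *\<^sub>v (perm_mat n (perm_inv w) *\<^sub>v y) = (perm_mat n w * perm_mat n (perm_inv w)) *\<^sub>v y"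
      by (simp add: assoc_mult_mat_vec[OF perm_mat_carrier perm_mat_carrier])
    then have "y = perm_mat n w *\<^sub>v (perm_mat n (perm_inv w) *\<^sub>v y)"
      using perm_mat_inverse(1)[OF w] \<open>y \<in> carrier_vec n\<close> by simp
    then show "y \<in> (*\<^sub>v) (perm_mat n w) ` coord_space n J" using 1 by blast
  qed
qed

lemma E_star_eq:
  assumes n: "0 < n"
  shows "E_star n = act (perm_mat n (sigma n)) (E_plus n)"
proof -
  let ?js = "(n - 1) # [0..<n - 1]"
  have js: "set (take (Suc i) ?js) = sigma n ` {..i}" if i: "i < n" for i
  proof -
    have "{..i} = insert 0 (Suc ` {..<i})"
      using lessThan_Suc_eq_insert_0[of i] by (simp add: lessThan_Suc_atMost)
    moreover have "sigma n ` Suc ` {..<i} = {..<i}"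
      using i unfolding image_image by (auto simp: sigma_def image_iff)
    ultimately have "sigma n ` {..i} = insert (n - 1) {..<i}" by (simp add: sigma_def)
    then show ?thesis using i by (auto simp: take_upt)
  qed
  have "E_star n = map (\<lambda>i. coord_space n (set (take (Suc i) ?js))) [0..<n]"
    unfolding E_star_def by (rule flag_of_unit_vecs) (use n in auto)
  also have "\<dots> = map (\<lambda>i. coord_space n (sigma n ` {..i})) [0..<n]"
    using js by (intro map_cong refl) simp
  also have "\<dots> = map (\<lambda>i. (*\<^sub>v) (perm_mat n (sigma n)) ` coord_space n {..i}) [0..<n]"
  proof (intro map_cong refl)
    fix i assume "i \<in> set [0..<n]"
    then have "{..i} \<subseteq> {..<n}" by auto
    then show "coord_space n (sigma n ` {..i}) = (*\<^sub>v) (perm_mat n (sigma n)) ` coord_space n {..i}"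
      using perm_mat_coord_space[OF sigma_permutes] by simp
  qed
  finally show ?thesis by (simp add: act_def E_plus_eq comp_def)
qed

lemma borel_star_eq:
  assumes n: "0 < n"
  shows "borel_star n = {perm_mat n (sigma n) * b * star_shift n | b. b \<in> UT n}"
proof -
  let ?S = "star_shift n" and ?T = "perm_mat n (sigma n)"
  have TG: "?T \<in> GL n" by (rule perm_mat_GL[OF sigma_permutes])
  have "act g (E_star n) = E_star n \<longleftrightarrow> (\<exists>b\<in>UT n. g = ?T * b * ?S)" if g: "g \<in> GL n" for g
  proof -
    note gc = GL_carrier[OF g]
    have "act g (E_star n) = E_star n \<longleftrightarrow> act ?T (E_plus n) = act (g * ?T) (E_plus n)"
      unfolding E_star_eq[OF n] using act_mult_E_plus[OF gc perm_mat_carrier] by auto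
    also have "\<dots> \<longleftrightarrow> (\<exists>b\<in>UT n. g * ?T = ?T * b)"
      by (rule act_E_plus_eq_iff[OF TG mult_GL[OF g TG]])
    also have "\<dots> \<longleftrightarrow> (\<exists>b\<in>UT n. g = ?T * b * ?S)"
    proof (intro bex_cong refl)
      fix b assume "b \<in> UT n"
      then have bc: "b \<in> carrier_mat n n" by (rule UT_carrier)
      have "g * ?T * ?S = g" "?T * b * ?S * ?T = ?T * b"
        using star_shift_inverse gc bc right_mult_one_mat[OF mult_carrier_mat[OF perm_mat_carrier bc]]
        by (simp_all add: mat_assoc[where n = n])
      then show "g * ?T = ?T * b \<longleftrightarrow> g = ?T * b * ?S" by metis
    qed
    finally show ?thesis .
  qed
  moreover have "?T * b * ?S \<in> GL n" if "b \<in> UT n" for b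
    by (intro mult_GL TG star_shift_GL UT_GL that)
  ultimately show ?thesis unfolding borel_star_def stabilizer_def by blast
qed

text \<open>Both components of the invariant compare saturations under a group that contains the small Borel
  subgroup, and such saturations are double cosets.\<close>

lemma saturation_eq_iff:
  assumes H: "H \<subseteq> GL n" "\<And>a b. a \<in> H \<Longrightarrow> b \<in> H \<Longrightarrow> a * b \<in> H" "1\<^sub>m n \<in> H"
    "\<And>a. a \<in> H \<Longrightarrow> \<exists>b\<in>H. b * a = 1\<^sub>m n"
    and n: "0 < n" and K: "borel_K n \<subseteq> H" and g: "g \<in> GL n" and h: "h \<in> GL n"
  shows "act_set H (orbit n g) = act_set H {act h (E_plus n)}
    \<longleftrightarrow> (\<exists>a\<in>H. \<exists>c\<in>UT n. h = a * g * c)"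
proof -
  have HG: "a \<in> GL n" and Hc: "a \<in> carrier_mat n n" if "a \<in> H" for a
    using that H(1) GL_carrier by blast+
  have one: "act_set H {act x (E_plus n)} = {act (a * x) (E_plus n) | a. a \<in> H}" if "x \<in> GL n" for x
    unfolding act_set_def using act_mult_E_plus[OF Hc GL_carrier[OF that]] by auto metis+
  have sat: "act_set H (orbit n g) = {act (a * g) (E_plus n) | a. a \<in> H}"
  proof (intro equalityI subsetI)
    fix F assume "F \<in> act_set H (orbit n g)"
    then obtain a k where ak: "a \<in> H" "k \<in> borel_K n" "F = act a (act (k * g) (E_plus n))"
      unfolding orbit_eq[OF n g] by (auto simp: act_set_def)
    note C = Hc[OF ak(1)] Hc[OF subsetD[OF K ak(2)]] GL_carrier[OF g]
    have "F = act ((a * k) * g) (E_plus n)"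
      unfolding ak(3) using act_mult_E_plus[OF C(1) mult_carrier_mat[OF C(2,3)]] assoc_mult_mat[OF C] by simp
    then show "F \<in> {act (a * g) (E_plus n) | a. a \<in> H}" using H(2)[OF ak(1) subsetD[OF K ak(2)]] by blast
  next
    fix F assume "F \<in> {act (a * g) (E_plus n) | a. a \<in> H}"
    then obtain a where a: "a \<in> H" "F = act (a * g) (E_plus n)" by blast
    have "act g (E_plus n) = act (1\<^sub>m n * g) (E_plus n)" using GL_carrier[OF g] by simp
    then have "act g (E_plus n) \<in> orbit n g"
      unfolding orbit_eq[OF n g] using one_borel_K[OF n] by blast
    moreover have "F = act a (act g (E_plus n))"
      using a act_mult_E_plus[OF Hc[OF a(1)] GL_carrier[OF g]] by simp
    ultimately show "F \<in> act_set H (orbit n g)"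
      using a(1) unfolding act_set_def by blast
  qed
  show ?thesis
    unfolding sat one[OF h]
  proof
    assume e: "{act (a * g) (E_plus n) | a. a \<in> H} = {act (a * h) (E_plus n) | a. a \<in> H}"
    have "act (1\<^sub>m n * h) (E_plus n) \<in> {act (a * g) (E_plus n) | a. a \<in> H}" unfolding e using H(3) by blast
    then obtain a where a: "a \<in> H" "act (a * g) (E_plus n) = act h (E_plus n)"
      using GL_carrier[OF h] by auto
    then show "\<exists>a\<in>H. \<exists>c\<in>UT n. h = a * g * c"
      using act_E_plus_eq_iff[OF mult_GL[OF HG[OF a(1)] g] h] by blast
  next
    assume "\<exists>a\<in>H. \<exists>c\<in>UT n. h = a * g * c"
    then obtain a c where a: "a \<in> H" "c \<in> UT n" "h = a * g * c" by blast
    obtain b where b: "b \<in> H" "b * a = 1\<^sub>m n" using H(4)[OF a(1)] by blast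
    note C = Hc[OF a(1)] Hc[OF b(1)] GL_carrier[OF g] UT_carrier[OF a(2)]
    have ah: "act h (E_plus n) = act (a * g) (E_plus n)"
      using act_E_plus_eq_iff[OF mult_GL[OF HG[OF a(1)] g] h] a by metis
    have move: "act (d * h) (E_plus n) = act ((d * a) * g) (E_plus n)" if "d \<in> H" for d
      using act_mult_E_plus[OF Hc[OF that] GL_carrier[OF h]] ah
        act_mult_E_plus[OF Hc[OF that] mult_carrier_mat[OF C(1,3)]] assoc_mult_mat[OF Hc[OF that] C(1,3)] by simp
    show "{act (a * g) (E_plus n) | a. a \<in> H} = {act (a * h) (E_plus n) | a. a \<in> H}"
    proof (intro equalityI subsetI)
      fix F assume "F \<in> {act (a * g) (E_plus n) | a. a \<in> H}"
      then obtain d where d: "d \<in> H" "F = act (d * g) (E_plus n)" by blast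
      have "d * b * a = d" using assoc_mult_mat[OF Hc[OF d(1)] C(2,1)] b(2) Hc[OF d(1)] by simp
      then have "F = act ((d * b) * h) (E_plus n)" using move[OF H(2)[OF d(1) b(1)]] d(2) by simp
      then show "F \<in> {act (a * h) (E_plus n) | a. a \<in> H}" using H(2)[OF d(1) b(1)] by blast
    next
      fix F assume "F \<in> {act (a * h) (E_plus n) | a. a \<in> H}"
      then show "F \<in> {act (a * g) (E_plus n) | a. a \<in> H}" using move H(2) a(1) by blast
    qed
  qed
qed

lemma double_coset_cell_iff:
  assumes g: "g \<in> GL n"
  shows "(\<exists>b\<in>UT n. \<exists>c\<in>UT n. perm_mat n w = b * g * c) \<longleftrightarrow> g \<in> bruhat_cell n w"
proof
  assume "\<exists>b\<in>UT n. \<exists>c\<in>UT n. perm_mat n w = b * g * c"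
  then obtain b c where bc: "b \<in> UT n" "c \<in> UT n" "perm_mat n w = b * g * c" by blast
  obtain b' where b': "b' \<in> UT n" "b' * b = 1\<^sub>m n" using UT_inverse[OF bc(1)] by blast
  obtain c' where c': "c' \<in> UT n" "c * c' = 1\<^sub>m n" using UT_inverse[OF bc(2)] by blast
  have "b' * perm_mat n w * c' = (b' * b) * g * (c * c')"
    unfolding bc(3)
    using GL_carrier[OF g] UT_carrier[OF bc(1)] UT_carrier[OF bc(2)] UT_carrier[OF b'(1)] UT_carrier[OF c'(1)]
    by (simp add: mat_assoc[where n = n])
  then have "g = b' * perm_mat n w * c'" using b' c' GL_carrier[OF g] by simp
  then show "g \<in> bruhat_cell n w" using b' c' unfolding bruhat_cell_def by blast
next
  assume "g \<in> bruhat_cell n w"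
  then show "\<exists>b\<in>UT n. \<exists>c\<in>UT n. perm_mat n w = b * g * c"
    by (rule bruhat_cell_representative) blast
qed

lemma Sh_orbit:
  assumes n: "0 < n" and g: "g \<in> GL n"
    and w: "w permutes {..<n}" "g \<in> bruhat_cell n w"
    and u: "u permutes {..<n}" "star_shift n * g \<in> bruhat_cell n u"
  shows "Sh n (orbit n g) = (w, star_conj n u)"
proof -
  let ?Q = "orbit n g" and ?S = "star_shift n" and ?T = "perm_mat n (sigma n)"
  note gc = GL_carrier[OF g]
  have 1: "act_set (borel n) ?Q = act_set (borel n) {act (perm_mat n v) (E_plus n)} \<longleftrightarrow> g \<in> bruhat_cell n v"
    if "v permutes {..<n}" for v
    unfolding borel_eq double_coset_cell_iff[OF g, symmetric]
  proof (rule saturation_eq_iff[OF _ _ _ _ n _ g perm_mat_GL[OF that]])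
    fix a assume "a \<in> UT n"
    then obtain b where "b \<in> UT n" "b * a = 1\<^sub>m n" using UT_inverse[of a n] by metis
    then show "\<exists>b\<in>UT n. b * a = 1\<^sub>m n" by auto
  qed (auto simp: UT_GL mult_UT one_UT borel_K_UT[OF n])
  have w1: "(THE v. v permutes {..<n} \<and> act_set (borel n) ?Q = act_set (borel n) {act (perm_mat n v) (E_plus n)}) = w"
  proof (rule the_equality)
    show "w permutes {..<n} \<and> act_set (borel n) ?Q = act_set (borel n) {act (perm_mat n w) (E_plus n)}"
      using 1[OF w(1)] w by blast
    fix v assume v: "v permutes {..<n} \<and> act_set (borel n) ?Q = act_set (borel n) {act (perm_mat n v) (E_plus n)}"
    then have "g \<in> bruhat_cell n v" using 1[of v] by blast
    then show "v = w" using bruhat_unique[OF _ w(1) _ w(2)] v by blast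
  qed
  have TG: "?T \<in> GL n" by (rule perm_mat_GL[OF sigma_permutes])
  have star_mult: "(?T * a * ?S) * (?T * b * ?S) = ?T * (a * b) * ?S" if "a \<in> UT n" "b \<in> UT n" for a b
  proof -
    note C = UT_carrier[OF that(1)] UT_carrier[OF that(2)]
    have "(?T * a * ?S) * (?T * b * ?S) = ?T * (a * ((?S * ?T) * (b * ?S)))"
      using C by (simp add: mat_assoc[where n = n])
    then show ?thesis
      using star_shift_inverse(1) left_mult_one_mat[OF mult_carrier_mat[OF C(2) star_shift_carrier]] C
      by (simp add: mat_assoc[where n = n])
  qed
  have star_one: "?T * 1\<^sub>m n * ?S = 1\<^sub>m n" using star_shift_inverse(2) by simp
  have 2: "act_set (borel_star n) ?Q = act_set (borel_star n) {act (perm_mat n (star_conj n v)) (E_star n)}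
      \<longleftrightarrow> ?S * g \<in> bruhat_cell n v" if v: "v permutes {..<n}" for v
  proof -
    note cv = star_conj_permutes[OF v]
    have "star_conj n v \<circ> sigma n = sigma n \<circ> v"
      using permutes_inverses(2)[OF sigma_permutes] by (auto simp: star_conj_def fun_eq_iff)
    then have vT: "perm_mat n (star_conj n v) * ?T = ?T * perm_mat n v"
      using perm_mat_comp[OF cv sigma_permutes] perm_mat_comp[OF sigma_permutes v] by simp
    have vG: "?T * perm_mat n v \<in> GL n" by (rule mult_GL[OF TG perm_mat_GL[OF v]])
    have "act (perm_mat n (star_conj n v)) (E_star n) = act (?T * perm_mat n v) (E_plus n)"
      unfolding E_star_eq[OF n] vT[symmetric] by (rule act_mult_E_plus) auto
    moreover have "act_set (borel_star n) ?Q = act_set (borel_star n) {act (?T * perm_mat n v) (E_plus n)}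
      \<longleftrightarrow> (\<exists>a\<in>borel_star n. \<exists>c\<in>UT n. ?T * perm_mat n v = a * g * c)"
    proof (rule saturation_eq_iff[OF _ _ _ _ n _ g vG])
      show "borel_star n \<subseteq> GL n" by (auto simp: borel_star_def stabilizer_def)
      show "a * b \<in> borel_star n" if "a \<in> borel_star n" "b \<in> borel_star n" for a b
        using that star_mult mult_UT unfolding borel_star_eq[OF n] by blast
      show "1\<^sub>m n \<in> borel_star n" unfolding borel_star_eq[OF n] using star_one[symmetric] one_UT by blast
      show "\<exists>b\<in>borel_star n. b * a = 1\<^sub>m n" if a: "a \<in> borel_star n" for a
      proof -
        obtain d where d: "d \<in> UT n" "a = ?T * d * ?S" using a unfolding borel_star_eq[OF n] by blast
        obtain b where b: "b \<in> UT n" "b * d = 1\<^sub>m n" using UT_inverse[OF d(1)] by blast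
        then have "(?T * b * ?S) * a = 1\<^sub>m n" using star_mult[OF b(1) d(1)] star_one d(2) by simp
        moreover have "?T * b * ?S \<in> borel_star n" unfolding borel_star_eq[OF n] using b(1) by blast
        ultimately show ?thesis by blast
      qed
      show "borel_K n \<subseteq> borel_star n"
      proof
        fix k assume k: "k \<in> borel_K n"
        have kc: "k \<in> carrier_mat n n" using UT_carrier[OF borel_K_UT[OF n k]] .
        have "?T * (?S * k * ?T) * ?S = (?T * ?S) * k * (?T * ?S)"
          using kc by (simp add: mat_assoc[where n = n])
        then have "k = ?T * (?S * k * ?T) * ?S" using star_shift_inverse(2) kc by simp
        then show "k \<in> borel_star n" using star_conj_borel_K[OF n k] unfolding borel_star_eq[OF n] by blast
      qed
    qed
    moreover have "?T * perm_mat n v = (?T * b * ?S) * g * c \<longleftrightarrow> perm_mat n v = b * (?S * g) * c"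
      if "b \<in> UT n" "c \<in> UT n" for b c
    proof -
      have e: "(?T * b * ?S) * g * c = ?T * (b * (?S * g) * c)"
        using UT_carrier[OF that(1)] UT_carrier[OF that(2)] gc by (simp add: mat_assoc[where n = n])
      have "?S * (?T * x) = x" if "x \<in> carrier_mat n n" for x
        using assoc_mult_mat[OF star_shift_carrier perm_mat_carrier that, of "sigma n"] star_shift_inverse(1) that
        by simp
      moreover have "b * (?S * g) * c \<in> carrier_mat n n"
        using UT_carrier[OF that(1)] UT_carrier[OF that(2)] gc by (simp add: mat_assoc[where n = n])
      ultimately show ?thesis unfolding e by (metis perm_mat_carrier)
    qed
    then have "(\<exists>a\<in>borel_star n. \<exists>c\<in>UT n. ?T * perm_mat n v = a * g * c)
      \<longleftrightarrow> (\<exists>b\<in>UT n. \<exists>c\<in>UT n. perm_mat n v = b * (?S * g) * c)"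
      unfolding borel_star_eq[OF n] by blast
    ultimately show ?thesis using double_coset_cell_iff[OF mult_GL[OF star_shift_GL g]] by simp
  qed
  have u1: "(THE v. v permutes {..<n} \<and>
      act_set (borel_star n) ?Q = act_set (borel_star n) {act (perm_mat n v) (E_star n)}) = star_conj n u"
  proof (rule the_equality)
    show "star_conj n u permutes {..<n} \<and>
      act_set (borel_star n) ?Q = act_set (borel_star n) {act (perm_mat n (star_conj n u)) (E_star n)}"
      using 2[OF u(1)] u star_conj_permutes by blast
    fix v assume v: "v permutes {..<n} \<and>
      act_set (borel_star n) ?Q = act_set (borel_star n) {act (perm_mat n v) (E_star n)}"
    then obtain v' where v': "v' permutes {..<n}" "v = star_conj n v'" by (metis ex_star_conj)
    then have "?S * g \<in> bruhat_cell n v'" using v 2[OF v'(1)] by blast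
    then show "v = star_conj n u" using bruhat_unique[OF v'(1) u(1)] u(2) v'(2) by blast
  qed
  show ?thesis unfolding Sh_def w1 u1 ..
qed

section \<open>Both monoid actions\<close>

lemma left_ascent_separated:
  assumes w: "w permutes {..<n}" and i: "Suc i < n" and asc: "perm_inv w i < perm_inv w (Suc i)"
  shows "separated n w (simple_refl i \<circ> w)"
proof (rule separatedI[OF w permutes_compose[OF w simple_refl_permutes[OF i]]])
  show "perm_inv w i < n" using permutes_inv_lt[OF w] i by simp
  show "w (perm_inv w i) < (simple_refl i \<circ> w) (perm_inv w i)"
    using permutes_inverses(1)[OF w] by simp
  fix k assume "k < perm_inv w i"
  then have "w k \<noteq> i" "w k \<noteq> Suc i" using permutes_inverses(2)[OF w, of k] asc by auto
  then show "w k = (simple_refl i \<circ> w) k" by (simp add: simple_refl_other)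
qed

lemma right_ascent_separated:
  assumes w: "w permutes {..<n}" and i: "Suc i < n" and asc: "w i < w (Suc i)"
  shows "separated n w (w \<circ> simple_refl i)"
  by (rule separatedI[OF w permutes_compose[OF simple_refl_permutes[OF i] w], of i])
    (use i asc in \<open>auto simp: simple_refl_other\<close>)

text \<open>Of the two permutations, the longer one is the one whose cell is open in the union of the two cells.\<close>

lemma longer_left_separated:
  assumes w: "w permutes {..<n}" and i: "Suc i < n"
  obtains w' where "separated n w' (longer (gens n) (simple_refl i \<circ> w) w)"
    "{w', longer (gens n) (simple_refl i \<circ> w) w} = {w, simple_refl i \<circ> w}"
proof (cases "perm_inv w i < perm_inv w (Suc i)")
  case True
  then show thesis using that[of w] left_ascent_separated[OF w i] longer_left[OF w i] by auto
next
  case False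
  have "perm_inv w i \<noteq> perm_inv w (Suc i)" using permutes_inj[OF permutes_inv[OF w]] by (simp add: inj_eq)
  then have "perm_inv (simple_refl i \<circ> w) i < perm_inv (simple_refl i \<circ> w) (Suc i)"
    using False perm_inv_simple_refl_comp[OF w, of i] by simp
  then have "separated n (simple_refl i \<circ> w) (simple_refl i \<circ> (simple_refl i \<circ> w))"
    by (rule left_ascent_separated[OF permutes_compose[OF w simple_refl_permutes[OF i]] i])
  then have "separated n (simple_refl i \<circ> w) w" unfolding simple_refl_comp(1) .
  then show thesis using that[of "simple_refl i \<circ> w"] False longer_left[OF w i] by auto
qed

lemma longer_right_separated:
  assumes w: "w permutes {..<n}" and i: "Suc i < n"
  obtains w' where "separated n w' (longer (gens n) (w \<circ> simple_refl i) w)"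
    "{w', longer (gens n) (w \<circ> simple_refl i) w} = {w, w \<circ> simple_refl i}"
proof (cases "w i < w (Suc i)")
  case True
  then show thesis using that[of w] right_ascent_separated[OF w i] longer_right[OF w i] by auto
next
  case False
  have "w i \<noteq> w (Suc i)" using permutes_inj[OF w] by (simp add: inj_eq)
  then have "(w \<circ> simple_refl i) i < (w \<circ> simple_refl i) (Suc i)" using False by simp
  then have "separated n (w \<circ> simple_refl i) (w \<circ> simple_refl i \<circ> simple_refl i)"
    by (rule right_ascent_separated[OF permutes_compose[OF simple_refl_permutes[OF i] w] i])
  then have "separated n (w \<circ> simple_refl i) w" unfolding simple_refl_comp(2) .
  then show thesis using that[of "w \<circ> simple_refl i"] False longer_right[OF w i] by auto
qed

subsection \<open>The fibres meet the upper cells\<close>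

lemma cell_mult_refl_nonempty:
  assumes i: "Suc i < n" and w: "w permutes {..<n}" and g: "g \<in> bruhat_cell n w"
  shows "\<exists>p\<in>min_parabolic n i. g * p \<in> bruhat_cell n (w \<circ> simple_refl i)"
proof -
  note s = simple_refl_permutes[OF i]
  obtain b c where bc: "b \<in> UT n" "c \<in> UT n" "g = b * perm_mat n w * c"
    using g by (auto simp: bruhat_cell_def)
  obtain d where d: "d \<in> UT n" "c * d = 1\<^sub>m n" using UT_inverse[OF bc(2)] by blast
  note C = UT_carrier[OF bc(1)] UT_carrier[OF bc(2)] UT_carrier[OF d(1)]
  have "g * (d * perm_mat n (simple_refl i)) = b * (perm_mat n w * ((c * d) * perm_mat n (simple_refl i)))"
    unfolding bc(3) using C by (simp add: mat_assoc[where n = n])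
  also have "\<dots> = b * perm_mat n (w \<circ> simple_refl i)"
    using d(2) perm_mat_comp[OF w s] by simp
  finally have "g * (d * perm_mat n (simple_refl i)) \<in> bruhat_cell n (w \<circ> simple_refl i)"
    using bruhat_cell_left[OF perm_mat_bruhat_cell perm_mat_carrier bc(1)] by simp
  moreover have "d * perm_mat n (simple_refl i) \<in> min_parabolic n i"
    using min_parabolic_mult_refl(1)[OF _ i] UT_subset_min_parabolic d(1) by blast
  ultimately show ?thesis by blast
qed

text \<open>The parabolic subgroup of the whole group acts transitively on the union of the two cells modulo
  the Borel subgroup on the right. Here \<open>T\<close> is the identity or the shift; by the factorization
  hypothesis an element of this subgroup can be replaced by an element of \<open>P\<close> at the cost of a
  triangular factor on the left.\<close>

lemma refl_mult_cell_nonempty: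
  assumes i: "Suc i < n" and w: "w permutes {..<n}" and g: "g \<in> carrier_mat n n" and T: "T \<in> carrier_mat n n"
    and cell: "T * g \<in> bruhat_cell n w"
    and factor: "\<And>q. q \<in> min_parabolic n i \<Longrightarrow> \<exists>b\<in>UT n. \<exists>p\<in>P. p \<in> carrier_mat n n \<and> b * (q * T) = T * p"
  shows "\<exists>p\<in>P. T * (p * g) \<in> bruhat_cell n (simple_refl i \<circ> w)"
proof -
  let ?s = "perm_mat n (simple_refl i)"
  obtain b c where bc: "b \<in> UT n" "c \<in> UT n" "T * g = b * perm_mat n w * c"
    using cell by (auto simp: bruhat_cell_def)
  obtain b' where b': "b' \<in> UT n" "b' * b = 1\<^sub>m n" using UT_inverse[OF bc(1)] by blast
  have "?s * b' \<in> min_parabolic n i"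
    using min_parabolic_mult_refl(2)[OF _ i] b'(1) UT_subset_min_parabolic by blast
  then obtain d p where d: "d \<in> UT n" "p \<in> P" "p \<in> carrier_mat n n" "d * ((?s * b') * T) = T * p"
    using factor by blast
  note C = UT_carrier[OF bc(1)] UT_carrier[OF bc(2)] UT_carrier[OF b'(1)] UT_carrier[OF d(1)]
  have "T * (p * g) = d * ((?s * b') * T) * g"
    unfolding d(4) using d(3) T g by (simp add: mat_assoc[where n = n])
  also have "\<dots> = d * (?s * (b' * (T * g)))" using C T g by (simp add: mat_assoc[where n = n])
  also have "\<dots> = d * (?s * ((b' * b) * (perm_mat n w * c)))"
    unfolding bc(3) using C by (simp add: mat_assoc[where n = n])
  also have "\<dots> = d * perm_mat n (simple_refl i \<circ> w) * c"
    unfolding b'(2) perm_mat_comp[OF simple_refl_permutes[OF i] w]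
      left_mult_one_mat[OF mult_carrier_mat[OF perm_mat_carrier C(2)]]
    using C by (simp add: mat_assoc[where n = n])
  finally show ?thesis using d(1,2) bc(2) unfolding bruhat_cell_def by blast
qed

text \<open>A parabolic element is a matrix that differs from the identity in its last column, times its
  own upper left block.\<close>

lemma min_parabolic_K_factor:
  assumes i: "Suc i < n - 1" and q: "q \<in> min_parabolic n i"
  shows "\<exists>b\<in>UT n. \<exists>p\<in>min_parabolic_K n i. p \<in> carrier_mat n n \<and> b * (q * 1\<^sub>m n) = 1\<^sub>m n * p"
proof -
  have n1: "n - 1 < n" using i by simp
  note qG = min_parabolic_GL[OF q]
  note qc = GL_carrier[OF qG]
  have q0: "q $$ (n - 1, c) = 0" if "c < n - 1" for c
    using min_parabolic_zero[OF q that n1] i by auto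
  define p where "p = mat n n (\<lambda>(r, c). if r < n - 1 \<and> c < n - 1 then q $$ (r, c) else if r = c then 1 else 0)"
  define b where "b = mat n n (\<lambda>(r, c). if c = n - 1 then q $$ (r, c) else if r = c then 1 else 0)"
  have pc: "p \<in> carrier_mat n n" and bc: "b \<in> carrier_mat n n" by (simp_all add: p_def b_def)
  have qbp: "q = b * p"
  proof (rule eq_matI)
    fix r c assume "r < dim_row (b * p)" "c < dim_col (b * p)"
    then have rc: "r < n" "c < n" using pc bc by auto
    have "(b * p) $$ (r, c) = (\<Sum>k<n. b $$ (r, k) * p $$ (k, c))" by (rule mult_mat_index[OF bc pc rc])
    also have "\<dots> = (\<Sum>k<n. if k = (if c = n - 1 then c else r) then q $$ (r, c) else 0)"
    proof (rule sum.cong[OF refl])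
      fix k assume "k \<in> {..<n}"
      then have "k < n - 1 \<or> k = n - 1" "r < n - 1 \<or> r = n - 1" "c < n - 1 \<or> c = n - 1" using rc by auto
      then show "b $$ (r, k) * p $$ (k, c) = (if k = (if c = n - 1 then c else r) then q $$ (r, c) else 0)"
        using rc q0[of c] n1 by (auto simp: b_def p_def)
    qed
    finally show "q $$ (r, c) = (b * p) $$ (r, c)" using rc by simp
  qed (use qc pc bc in auto)
  then have "b \<in> GL n" and pG: "p \<in> GL n" using qG det_mult[OF bc pc] pc bc by (auto simp: GL_iff_det)
  then have "b \<in> UT n"
    unfolding UT_def by (auto simp: b_def intro!: upper_triangularI q0)
  then obtain b' where b': "b' \<in> UT n" "b' * b = 1\<^sub>m n" using UT_inverse by blast
  have "b' * q = p"
    unfolding qbp using assoc_mult_mat[OF UT_carrier[OF b'(1)] bc pc] b'(2) pc by simp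
  then have "b' * (q * 1\<^sub>m n) = 1\<^sub>m n * p" using qc pc by simp
  moreover have "p \<in> min_parabolic n i"
  proof (rule min_parabolicI[OF pG])
    fix r c assume "c < r" "r < n" "(r, c) \<noteq> (Suc i, i)"
    then show "p $$ (r, c) = 0" using min_parabolic_zero[OF q, of c r] by (simp add: p_def)
  qed
  then have "p \<in> min_parabolic_K n i"
    unfolding min_parabolic_K_iff[OF i] using n1 by (simp add: last_trivial_def p_def)
  ultimately show ?thesis using b'(1) pc by blast
qed

text \<open>In the shifted picture the block sits in the lower right corner, and the quotient of the two
  matrices differs from the identity in its first row only.\<close>

lemma min_parabolic_K_star_factor:
  assumes i: "Suc i < n - 1" and q: "q \<in> min_parabolic n (Suc i)"
  shows "\<exists>b\<in>UT n. \<exists>p\<in>min_parabolic_K n i. p \<in> carrier_mat n n \<and> b * (q * star_shift n) = star_shift n * p"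
proof -
  let ?S = "star_shift n" and ?T = "perm_mat n (sigma n)"
  have n: "0 < n" using i by simp
  note qG = min_parabolic_GL[OF q]
  note qc = GL_carrier[OF qG]
  have q0: "q $$ (r, 0) = 0" if "0 < r" "r < n" for r
    using min_parabolic_zero[OF q that] by simp
  define m where "m = mat n n (\<lambda>(r, c). if 0 < r \<and> 0 < c then q $$ (r, c) else if r = c then 1 else 0)"
  define a where "a = mat n n (\<lambda>(r, c). if r = 0 then q $$ (r, c) else if r = c then 1 else 0)"
  define p where "p = mat n n (\<lambda>(r, c). if r < n - 1 \<and> c < n - 1 then q $$ (Suc r, Suc c) else if r = c then 1 else 0)"
  have mc: "m \<in> carrier_mat n n" and ac: "a \<in> carrier_mat n n" and pc: "p \<in> carrier_mat n n"
    by (simp_all add: m_def a_def p_def)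
  have qma: "q = m * a"
  proof (rule eq_matI)
    fix r c assume "r < dim_row (m * a)" "c < dim_col (m * a)"
    then have rc: "r < n" "c < n" using mc ac by auto
    have "(m * a) $$ (r, c) = (\<Sum>k<n. m $$ (r, k) * a $$ (k, c))" by (rule mult_mat_index[OF mc ac rc])
    also have "\<dots> = (\<Sum>k<n. if k = (if r = 0 then 0 else c) then q $$ (r, c) else 0)"
      by (rule sum.cong) (use rc q0[of r] in \<open>auto simp: m_def a_def\<close>)
    finally show "q $$ (r, c) = (m * a) $$ (r, c)" using rc n by simp
  qed (use qc mc ac in auto)
  then have mG: "m \<in> GL n" using qG det_mult[OF mc ac] mc by (auto simp: GL_iff_det)
  obtain h where h: "h \<in> GL n" "q * h = 1\<^sub>m n" "h * q = 1\<^sub>m n" using GL_inverse[OF qG] by blast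
  note hc = GL_carrier[OF h(1)]
  have row: "(m * h) $$ (r, c) = (if r = c then 1 else 0)" if "0 < r" "r < n" "c < n" for r c
  proof -
    have "(m * h) $$ (r, c) = (\<Sum>k<n. m $$ (r, k) * h $$ (k, c))" by (rule mult_mat_index[OF mc hc that(2,3)])
    also have "\<dots> = (\<Sum>k<n. q $$ (r, k) * h $$ (k, c))"
      by (rule sum.cong) (use that q0[of r] in \<open>auto simp: m_def\<close>)
    also have "\<dots> = (q * h) $$ (r, c)" using mult_mat_index[OF qc hc that(2,3)] by simp
    finally show ?thesis using h(2) that by simp
  qed
  have mhG: "m * h \<in> GL n" by (rule mult_GL[OF mG h(1)])
  then have mhU: "m * h \<in> UT n"
    using row mc unfolding UT_def by (auto intro!: upper_triangularI)
  have SpT: "?S * p * ?T = m"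
  proof (rule eq_matI)
    fix r c assume "r < dim_row m" "c < dim_col m"
    then have rc: "r < n" "c < n" using mc by auto
    show "(?S * p * ?T) $$ (r, c) = m $$ (r, c)"
      unfolding star_conj_index[OF pc rc] using rc by (cases r; cases c) (auto simp: p_def m_def sigma_def)
  qed (use mc in \<open>auto simp: star_shift_def perm_mat_def\<close>)
  have "m * ?S = ?S * p * (?T * ?S)"
    unfolding SpT[symmetric] using pc by (simp add: mat_assoc[where n = n])
  then have mS: "m * ?S = ?S * p"
    using star_shift_inverse(2) right_mult_one_mat[OF mult_carrier_mat[OF star_shift_carrier pc]] by simp
  have "(m * h) * (q * ?S) = m * ((h * q) * ?S)" using mc hc qc by (simp add: mat_assoc[where n = n])
  then have "(m * h) * (q * ?S) = ?S * p" unfolding h(3) using mS left_mult_one_mat[OF star_shift_carrier] by simp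
  moreover have "p \<in> min_parabolic_K n i"
  proof -
    have "det ?S * det p * det ?T = det m"
      using SpT det_mult[OF mult_carrier_mat[OF star_shift_carrier pc] perm_mat_carrier] det_mult[OF star_shift_carrier pc]
      by metis
    then have "p \<in> GL n" using mG pc by (auto simp: GL_iff_det)
    then have "p \<in> min_parabolic n i"
    proof (rule min_parabolicI)
      fix r c assume "c < r" "r < n" "(r, c) \<noteq> (Suc i, i)"
      then show "p $$ (r, c) = 0" using min_parabolic_zero[OF q, of "Suc c" "Suc r"] by (auto simp: p_def)
    qed
    then show ?thesis
      unfolding min_parabolic_K_iff[OF i] using n by (simp add: last_trivial_def p_def)
  qed
  ultimately show ?thesis using mhU pc by blast
qed

text \<open>The shift moves the rows and columns of the block down by one, and so the simple root moves to the
  next one.\<close>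

lemma star_conj_min_parabolic_K:
  assumes i: "Suc i < n - 1" and p: "p \<in> min_parabolic_K n i"
  shows "star_shift n * p * perm_mat n (sigma n) \<in> min_parabolic n (Suc i)"
proof (rule min_parabolicI)
  have pP: "p \<in> min_parabolic n i" and pl: "last_trivial n p" using p i by (auto simp: min_parabolic_K_iff)
  note pG = min_parabolic_GL[OF pP]
  show "star_shift n * p * perm_mat n (sigma n) \<in> GL n"
    by (intro mult_GL star_shift_GL pG perm_mat_GL sigma_permutes)
  fix r c assume rc: "c < r" "r < n" "(r, c) \<noteq> (Suc (Suc i), Suc i)"
  have "p $$ (sigma n r, sigma n c) = 0"
  proof (cases "c = 0")
    case True
    then show ?thesis using rc pl by (auto simp: last_trivial_def sigma_def)
  next
    case False
    then have "(r - 1, c - 1) \<noteq> (Suc i, i)" using rc by auto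
    then show ?thesis using False rc min_parabolic_zero[OF pP, of "c - 1" "r - 1"] by (auto simp: sigma_def)
  qed
  then show "(star_shift n * p * perm_mat n (sigma n)) $$ (r, c) = 0"
    using rc by (simp add: star_conj_index[OF GL_carrier[OF pG]])
qed

subsection \<open>The open orbits\<close>

lemma orbit_cells:
  assumes n: "0 < n" and g: "g \<in> GL n" "g \<in> bruhat_cell n w" "star_shift n * g \<in> bruhat_cell n u"
    and v: "v \<in> GL n" and e: "orbit n g = orbit n v"
  shows "v \<in> bruhat_cell n w" "star_shift n * v \<in> bruhat_cell n u"
proof -
  have "same_orbit n v v"
    by (rule same_orbitI[OF one_borel_K[OF n] one_UT]) (use GL_carrier[OF v] in simp)
  then have "same_orbit n g v" using same_orbit_act[OF n g(1) v] same_orbit_act[OF n v v] e by simp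
  then show "v \<in> bruhat_cell n w" "star_shift n * v \<in> bruhat_cell n u"
    using cell_same_orbit[OF n g(2)] star_cell_same_orbit[OF n GL_carrier[OF g(1)] g(3)] by auto
qed

text \<open>The fibre depends on the chosen representative \<open>v\<close>, but the open orbit depends only on the cells of
  \<open>v\<close>, and these are invariants of the orbit. This makes the definite description meaningful.\<close>

lemma Sh_open_orbit:
  assumes n: "0 < n" and g: "g \<in> GL n" "g \<in> bruhat_cell n w" "star_shift n * g \<in> bruhat_cell n u"
    and w1: "w1 permutes {..<n}" and u1: "u1 permutes {..<n}"
    and fibre: "\<And>v. v \<in> GL n \<Longrightarrow> v \<in> bruhat_cell n w \<Longrightarrow> star_shift n * v \<in> bruhat_cell n u \<Longrightarrow>
      (\<exists>h\<in>GL n. h \<in> bruhat_cell n w1 \<and> star_shift n * h \<in> bruhat_cell n u1)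
      \<and> openin (subtopology (flag_topology n) (X v)) (cells_flags n w1 u1)
      \<and> (\<forall>Q\<in>orbits n. openin (subtopology (flag_topology n) (X v)) Q \<longrightarrow> Q = cells_flags n w1 u1)"
    and Q: "Q = orbit n g"
  shows "Sh n (THE Q'. Q' \<in> orbits n \<and> (\<exists>v\<in>GL n. Q = orbit n v \<and>
    openin (subtopology (flag_topology n) (X v)) Q')) = (w1, star_conj n u1)" (is "Sh n (THE Q'. ?P Q') = _")
proof -
  obtain h where h: "h \<in> GL n" "h \<in> bruhat_cell n w1" "star_shift n * h \<in> bruhat_cell n u1"
    using fibre[OF g] by blast
  note cf = cells_flags_orbit[OF n w1 h(2,3)]
  have "(THE Q'. ?P Q') = cells_flags n w1 u1"
  proof (rule the_equality)
    show "?P (cells_flags n w1 u1)"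
      using fibre[OF g] g(1) h(1) cf Q unfolding orbits_iff by blast
    fix Q' assume "?P Q'"
    then obtain v where v: "Q' \<in> orbits n" "v \<in> GL n" "Q = orbit n v"
      "openin (subtopology (flag_topology n) (X v)) Q'" by blast
    then show "Q' = cells_flags n w1 u1"
      using fibre[OF v(2) orbit_cells[OF n g v(2) v(3)[unfolded Q]]] by blast
  qed
  then show ?thesis using Sh_orbit[OF n h(1) w1 h(2) u1 h(3)] cf by simp
qed

lemma m_left_orbit:
  assumes i: "i < n - 2" and g: "g \<in> GL n"
    and w: "w permutes {..<n}" "g \<in> bruhat_cell n w"
    and u: "u permutes {..<n}" "star_shift n * g \<in> bruhat_cell n u"
  defines "w1 \<equiv> longer (gens n) (simple_refl i \<circ> w) w"
    and "u1 \<equiv> longer (gens n) (simple_refl (Suc i) \<circ> u) u"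
  shows "Sh n (m_left n i (orbit n g)) = (w1, star_conj n u1)"
proof -
  let ?Q = "orbit n g" and ?S = "star_shift n"
  let ?X = "\<lambda>v. {act (p * v) (E_plus n) | p. p \<in> min_parabolic_K n i}"
  have n: "0 < n" and i1: "Suc i < n - 1" and i2: "Suc i < n" "Suc (Suc i) < n" using i by auto
  have sw: "simple_refl i \<circ> w permutes {..<n}" by (rule permutes_compose[OF w(1) simple_refl_permutes[OF i2(1)]])
  have su: "simple_refl (Suc i) \<circ> u permutes {..<n}"
    by (rule permutes_compose[OF u(1) simple_refl_permutes[OF i2(2)]])
  obtain w' where w': "separated n w' w1" "{w', w1} = {w, simple_refl i \<circ> w}"
    using longer_left_separated[OF w(1) i2(1)] unfolding w1_def by blast
  obtain u' where u': "separated n u' u1" "{u', u1} = {u, simple_refl (Suc i) \<circ> u}"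
    using longer_left_separated[OF u(1) i2(2)] unfolding u1_def by blast
  have w1_cases: "w1 = w \<or> w1 = simple_refl i \<circ> w" and u1_cases: "u1 = u \<or> u1 = simple_refl (Suc i) \<circ> u"
    unfolding w1_def u1_def longer_def by meson+
  have w1: "w1 permutes {..<n}" using w(1) sw w1_cases by metis
  have u1: "u1 permutes {..<n}" using u(1) su u1_cases by metis
  have PG: "p \<in> GL n" if "p \<in> min_parabolic_K n i" for p
    using that min_parabolic_GL by (auto simp: min_parabolic_K_iff[OF i1])
  have one: "1\<^sub>m n \<in> min_parabolic_K n i"
    using one_UT UT_subset_min_parabolic one_borel_K[OF n] borel_K_iff[OF n]
    by (auto simp: min_parabolic_K_iff[OF i1])
  have *: "(\<exists>g\<in>GL n. g \<in> bruhat_cell n w1 \<and> ?S * g \<in> bruhat_cell n u1)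
      \<and> openin (subtopology (flag_topology n) (?X v)) (cells_flags n w1 u1)
      \<and> (\<forall>Q\<in>orbits n. openin (subtopology (flag_topology n) (?X v)) Q \<longrightarrow> Q = cells_flags n w1 u1)"
    if v: "v \<in> GL n" "v \<in> bruhat_cell n w" "?S * v \<in> bruhat_cell n u" for v
  proof -
    note vc = GL_carrier[OF v(1)]
    have pv: "p * v * 1\<^sub>m n = p * v" if "p \<in> min_parabolic_K n i" for p
      using right_mult_one_mat[OF mult_carrier_mat[OF GL_carrier[OF PG[OF that]] vc]] .
    have 1: "k * p \<in> min_parabolic_K n i" if "k \<in> borel_K n" "p \<in> min_parabolic_K n i" for k p
      using that last_trivial_closed[OF UT_carrier GL_carrier[OF PG] n, of k p]
        min_parabolic_mult_UT(2)[of p n i k]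
      by (auto simp: min_parabolic_K_iff[OF i1] borel_K_iff[OF n])
    have 2: "p * v * q \<in> bruhat_cell n w' \<union> bruhat_cell n w1" if "p \<in> min_parabolic_K n i" "q \<in> {1\<^sub>m n}" for p q
    proof -
      have "p * v \<in> bruhat_cell n w \<union> bruhat_cell n (simple_refl i \<circ> w)"
        using min_parabolic_mult_cell[OF _ i2(1) w(1) v(2)] that(1) by (simp add: min_parabolic_K_iff[OF i1])
      then show ?thesis using w'(2) that pv by (auto simp: doubleton_eq_iff)
    qed
    have 3: "?S * (p * v * q) \<in> bruhat_cell n u' \<union> bruhat_cell n u1" if "p \<in> min_parabolic_K n i" "q \<in> {1\<^sub>m n}" for p q
    proof -
      have "?S * (p * v) \<in> bruhat_cell n u \<union> bruhat_cell n (simple_refl (Suc i) \<circ> u)"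
        unfolding star_shift_pull[OF GL_carrier[OF PG[OF that(1)]] vc]
        by (rule min_parabolic_mult_cell[OF star_conj_min_parabolic_K[OF i1 that(1)] i2(2) u(1) v(3)])
      then show ?thesis using u'(2) that pv by (auto simp: doubleton_eq_iff)
    qed
    have 4: "\<exists>p\<in>min_parabolic_K n i. \<exists>q\<in>{1\<^sub>m n}. p * v * q \<in> bruhat_cell n w1"
    proof -
      have "\<exists>p\<in>min_parabolic_K n i. 1\<^sub>m n * (p * v) \<in> bruhat_cell n (simple_refl i \<circ> w)"
        by (rule refl_mult_cell_nonempty[OF i2(1) w(1) vc _ _ min_parabolic_K_factor[OF i1]]) (use v vc in auto)
      then have nonempty: "\<exists>p\<in>min_parabolic_K n i. p * v \<in> bruhat_cell n (simple_refl i \<circ> w)"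
        using PG GL_carrier left_mult_one_mat[OF mult_carrier_mat[OF _ vc]] by metis
      have "1\<^sub>m n * v = v" using vc by simp
      then have "\<exists>p\<in>min_parabolic_K n i. p * v \<in> bruhat_cell n w1"
        using one v(2) nonempty w1_cases by metis
      then show ?thesis using pv by auto
    qed
    have 5: "\<exists>p\<in>min_parabolic_K n i. \<exists>q\<in>{1\<^sub>m n}. ?S * (p * v * q) \<in> bruhat_cell n u1"
    proof -
      have "1\<^sub>m n * v = v" using vc by simp
      then have "\<exists>p\<in>min_parabolic_K n i. ?S * (p * v) \<in> bruhat_cell n u1"
        using one v(3) u1_cases
          refl_mult_cell_nonempty[OF i2(2) u(1) vc star_shift_carrier v(3) min_parabolic_K_star_factor[OF i1]] by metis
      then show ?thesis using pv by auto
    qed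
    have X: "?X v = {act (p * v * q) (E_plus n) | p q. p \<in> min_parabolic_K n i \<and> q \<in> {1\<^sub>m n}}"
      using pv by auto metis+
    note O = open_orbit[OF n v(1) segment_closed_min_parabolic_K[OF i1] segment_closed_one 1 w1 w'(1) u'(1) 2 3 4 5 X]
    show ?thesis using O by blast
  qed
  show ?thesis unfolding m_left_def by (rule Sh_open_orbit[OF n g w(2) u(2) w1 u1 * refl])
qed

lemma m_right_orbit:
  assumes i: "i < n - 1" and g: "g \<in> GL n"
    and w: "w permutes {..<n}" "g \<in> bruhat_cell n w"
    and u: "u permutes {..<n}" "star_shift n * g \<in> bruhat_cell n u"
  defines "w1 \<equiv> longer (gens n) (w \<circ> simple_refl i) w"
    and "u1 \<equiv> longer (gens n) (u \<circ> simple_refl i) u"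
  shows "Sh n (m_right n i (orbit n g)) = (w1, star_conj n u1)"
proof -
  let ?Q = "orbit n g" and ?S = "star_shift n"
  let ?X = "\<lambda>v. {act (b * v * p) (E_plus n) | b p. b \<in> borel_K n \<and> p \<in> min_parabolic n i}"
  have n: "0 < n" and i2: "Suc i < n" using i by auto
  have ws: "w \<circ> simple_refl i permutes {..<n}" by (rule permutes_compose[OF simple_refl_permutes[OF i2] w(1)])
  have us: "u \<circ> simple_refl i permutes {..<n}" by (rule permutes_compose[OF simple_refl_permutes[OF i2] u(1)])
  obtain w' where w': "separated n w' w1" "{w', w1} = {w, w \<circ> simple_refl i}"
    using longer_right_separated[OF w(1) i2] unfolding w1_def by blast
  obtain u' where u': "separated n u' u1" "{u', u1} = {u, u \<circ> simple_refl i}"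
    using longer_right_separated[OF u(1) i2] unfolding u1_def by blast
  have w1_cases: "w1 = w \<or> w1 = w \<circ> simple_refl i" and u1_cases: "u1 = u \<or> u1 = u \<circ> simple_refl i"
    unfolding w1_def u1_def longer_def by meson+
  have w1: "w1 permutes {..<n}" using w(1) ws w1_cases by metis
  have u1: "u1 permutes {..<n}" using u(1) us u1_cases by metis
  have one: "1\<^sub>m n \<in> min_parabolic n i" using one_UT UT_subset_min_parabolic by blast
  have *: "(\<exists>g\<in>GL n. g \<in> bruhat_cell n w1 \<and> ?S * g \<in> bruhat_cell n u1)
      \<and> openin (subtopology (flag_topology n) (?X v)) (cells_flags n w1 u1)
      \<and> (\<forall>Q\<in>orbits n. openin (subtopology (flag_topology n) (?X v)) Q \<longrightarrow> Q = cells_flags n w1 u1)"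
    if v: "v \<in> GL n" "v \<in> bruhat_cell n w" "?S * v \<in> bruhat_cell n u" for v
  proof -
    note vc = GL_carrier[OF v(1)]
    have kv: "same_orbit n v (k * v)" if "k \<in> borel_K n" for k
      by (rule same_orbitI[OF that one_UT], rule right_mult_one_mat[symmetric])
        (rule mult_carrier_mat[OF UT_carrier[OF borel_K_UT[OF n that]] vc])
    have 2: "k * v * p \<in> bruhat_cell n w' \<union> bruhat_cell n w1" if "k \<in> borel_K n" "p \<in> min_parabolic n i" for k p
      using cell_mult_min_parabolic[OF that(2) i2 w(1) cell_same_orbit[OF n v(2) kv[OF that(1)]]] w'(2)
      by (auto simp: doubleton_eq_iff)
    have 3: "?S * (k * v * p) \<in> bruhat_cell n u' \<union> bruhat_cell n u1" if "k \<in> borel_K n" "p \<in> min_parabolic n i" for k p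
    proof -
      have "?S * (k * v * p) = ?S * (k * v) * p"
        using vc UT_carrier[OF borel_K_UT[OF n that(1)]] GL_carrier[OF min_parabolic_GL[OF that(2)]]
        by (simp add: mat_assoc[where n = n])
      then show ?thesis
        using cell_mult_min_parabolic[OF that(2) i2 u(1) star_cell_same_orbit[OF n vc v(3) kv[OF that(1)]]] u'(2)
        by (auto simp: doubleton_eq_iff)
    qed
    have onev: "1\<^sub>m n * v = v" "v * 1\<^sub>m n = v" using vc by simp_all
    have 4: "\<exists>k\<in>borel_K n. \<exists>p\<in>min_parabolic n i. k * v * p \<in> bruhat_cell n w1"
    proof -
      have "\<exists>p\<in>min_parabolic n i. v * p \<in> bruhat_cell n w1"
        using one onev v(2) cell_mult_refl_nonempty[OF i2 w(1) v(2)] w1_cases by metis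
      then show ?thesis using one_borel_K[OF n] onev(1) by metis
    qed
    have 5: "\<exists>k\<in>borel_K n. \<exists>p\<in>min_parabolic n i. ?S * (k * v * p) \<in> bruhat_cell n u1"
    proof -
      have "\<exists>p\<in>min_parabolic n i. ?S * v * p \<in> bruhat_cell n u1"
        using one right_mult_one_mat[OF mult_carrier_mat[OF star_shift_carrier vc]] v(3)
          cell_mult_refl_nonempty[OF i2 u(1) v(3)] u1_cases by metis
      moreover have "?S * v * p = ?S * (1\<^sub>m n * v * p)" if "p \<in> min_parabolic n i" for p
        using assoc_mult_mat[OF star_shift_carrier vc GL_carrier[OF min_parabolic_GL[OF that]]] onev(1) by simp
      ultimately show ?thesis using one_borel_K[OF n] by metis
    qed
    note O = open_orbit[OF n v(1) segment_closed_borel_K[OF n] segment_closed_min_parabolic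
        mult_borel_K[OF n] w1 w'(1) u'(1) 2 3 4 5 refl]
    show ?thesis using O by blast
  qed
  show ?thesis unfolding m_right_def by (rule Sh_open_orbit[OF n g w(2) u(2) w1 u1 * refl])
qed

theorem theorem1p3:
  fixes n :: nat and \<alpha> :: "nat + nat" and Q :: "complex vec set list set"
  assumes "n \<ge> 2"
    and "\<alpha> \<in> simple_roots n"
    and "Q \<in> orbits n"
  shows "Sh n (m_orbit n \<alpha> Q) = m_weyl n \<alpha> (Sh n Q)"
proof -
  have n: "0 < n" using assms(1) by simp
  obtain g where g: "g \<in> GL n" and Q: "Q = orbit n g"
    using assms(3) unfolding orbits_iff by blast
  obtain w where w: "w permutes {..<n}" "g \<in> bruhat_cell n w" using bruhat_exists[OF g] .
  obtain u where u: "u permutes {..<n}" "star_shift n * g \<in> bruhat_cell n u"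
    using bruhat_exists[OF mult_GL[OF star_shift_GL g]] .
  have Sh: "Sh n Q = (w, star_conj n u)" unfolding Q by (rule Sh_orbit[OF n g w u])
  consider i where "\<alpha> = Inl i" "i < n - 2" | i where "\<alpha> = Inr i" "i < n - 1"
    using assms(2) by (auto simp: simple_roots_def)
  then show ?thesis
  proof cases
    case 1
    then have "simple_refl i \<circ> star_conj n u = star_conj n (simple_refl (Suc i) \<circ> u)"
      by (simp only: star_conj_comp star_conj_simple_refl_Suc less_diff_conv)
    then show ?thesis
      using m_left_orbit[OF 1(2) g w u] 1(1) Sh longer_star_conj[OF assms(1)] Q by simp
  next
    case 2
    have "star_conj n u \<circ> refl_star n i = star_conj n (u \<circ> simple_refl i)"
      by (simp only: star_conj_comp refl_star_eq)
    then show ?thesis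
      using m_right_orbit[OF 2(2) g w u] 2(1) Sh longer_star_conj[OF assms(1)] Q by simp
  qed
qed

end
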